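(* Let $n$ be a positive integer and let $0<c_0\le C_0$. There is a function $\mu:[0,\infty)\to(0,\infty)$, depending only on $n$, $c_0$ and $C_0$, such that the following holds. Let $\Omega\subset\mathbb{R}^n$ be a bounded smooth domain, let $a_{ij}$ ($1\le i,j\le n$) be functions that are smooth in $\overline\Omega$ and satisfy $$c_0|\xi|^2\le a_{ij}(x)\,\xi_i\,\xi_j\le C_0|\xi|^2\qquad\text{for all }\xi\in\mathbb{R}^n\text{ and all }x\in\Omega,$$ let $b=(b_1,\dots,b_n)\in L^\infty(\Omega;\mathbb{R}^n)$, and let $L_0u=a_{ij}(x)\,\partial_{ij}u+b_i(x)\,\partial_iu$. Then the principal eigenvalue $\lambda_1(L_0,\Omega)$ of $L_0$ in $\Omega$ satisfies $$\lambda_1(L_0,\Omega)\ \ge\ \mu\big(\|b\|_{L^n(\Omega)}\big)\,|\Omega|^{-2/n}.$$ That is, $\lambda_1(L_0,\Omega)\ge\mu|\Omega|^{-2/n}$ with a positive constant $\mu$ depending only on $n$, $c_0$, $C_0$ and $\|b\|_{L^n(\Omega)}$.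
   Context: Repeated indices are summed from $1$ to $n$. A domain is a nonempty connected open set, $|\Omega|$ denotes the Lebesgue measure of $\Omega$, and $\|b\|_{L^n(\Omega)}=\big(\int_\Omega |b(x)|^n\,dx\big)^{1/n}$ with $|b|$ the Euclidean norm of $b$. Principal eigenvalue: for $\Omega$ a bounded smooth domain, $a_{ij}$ smooth in $\overline\Omega$ and uniformly elliptic, and $b_i\in L^\infty(\Omega)$, it is known (Berestycki, Nirenberg and Varadhan) that there is a unique real eigenvalue $\lambda_1=\lambda_1(L_0,\Omega)$ of $-L_0$ in $\Omega$ with zero Dirichlet boundary condition that has a positive eigenfunction $\varphi_1$, i.e. $$L_0\varphi_1=-\lambda_1\varphi_1\ \text{ in }\Omega,\qquad \varphi_1=0\ \text{ on }\partial\Omega,\qquad \varphi_1>0\ \text{ in }\Omega.$$ Here $\varphi_1\in W^{2,q}_{\mathrm{loc}}(\Omega)\cap C(\overline\Omega)$ for every $q<\infty$ and the equation holds almost everywhere in $\Omega$. Moreover $\lambda_1$ is simple and $\lambda_1>0$. The number $\lambda_1(L_0,\Omega)$ is called the principal eigenvalue of $L_0$ in $\Omega$. *)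

theory Defs
  imports "HOL-Analysis.Analysis"
begin

definition partial_deriv :: "'n::finite \<Rightarrow> (real^'n \<Rightarrow> real) \<Rightarrow> real^'n \<Rightarrow> real" where
  "partial_deriv i f x = frechet_derivative f (at x) (axis i 1)"

abbreviation iter_partial :: "'n::finite list \<Rightarrow> (real^'n \<Rightarrow> real) \<Rightarrow> real^'n \<Rightarrow> real" where
  "iter_partial ks f \<equiv> foldr partial_deriv ks f"

text \<open>
  \<open>C\<^sup>\<infinity>\<close> on an open set: the empty list gives \<open>f\<close> itself, and differentiability of all iterated
  partial derivatives makes each of them continuous.
\<close>
definition smooth_on :: "(real^'n::finite) set \<Rightarrow> (real^'n \<Rightarrow> real) \<Rightarrow> bool" where
  "smooth_on U f \<longleftrightarrow> (\<forall>ks. iter_partial ks f differentiable_on U)"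

text \<open>
  Smooth up to the boundary, for open \<open>\<Omega>\<close>: all derivatives extend continuously to the closure.
\<close>
definition smooth_upto_closure :: "(real^'n::finite) set \<Rightarrow> (real^'n \<Rightarrow> real) \<Rightarrow> bool" where
  "smooth_upto_closure \<Omega> f \<longleftrightarrow> smooth_on \<Omega> f \<and>
     (\<forall>ks. \<exists>g. continuous_on (closure \<Omega>) g \<and> (\<forall>x\<in>\<Omega>. g x = iter_partial ks f x))"

text \<open>
  Near each boundary point the set is, after relabelling and reorienting the coordinate axes, the
  region above the graph of a smooth function of \<open>n - 1\<close> variables. That function is represented as
  a function on the whole space which does not depend on the \<open>i\<close>-th coordinate.
\<close>
definition smooth_boundary :: "(real^'n::finite) set \<Rightarrow> bool" where
  "smooth_boundary \<Omega> \<longleftrightarrow> (\<forall>p\<in>frontier \<Omega>. \<exists>r>0. \<exists>i. \<exists>s\<in>{1, -1}. \<exists>\<gamma>.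
     smooth_on UNIV \<gamma> \<and> (\<forall>y t. \<gamma> (y + t *\<^sub>R axis i 1) = \<gamma> y) \<and>
     (\<forall>y\<in>ball p r. y \<in> \<Omega> \<longleftrightarrow> s * y $ i > \<gamma> y))"

definition bounded_smooth_domain :: "(real^'n::finite) set \<Rightarrow> bool" where
  "bounded_smooth_domain \<Omega> \<longleftrightarrow>
     \<Omega> \<noteq> {} \<and> open \<Omega> \<and> connected \<Omega> \<and> bounded \<Omega> \<and> smooth_boundary \<Omega>"

definition test_function :: "(real^'n::finite) set \<Rightarrow> (real^'n \<Rightarrow> real) \<Rightarrow> bool" where
  "test_function \<Omega> \<psi> \<longleftrightarrow> smooth_on UNIV \<psi> \<and>
     compact (closure {x. \<psi> x \<noteq> 0}) \<and> closure {x. \<psi> x \<noteq> 0} \<subseteq> \<Omega>"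

definition Lq_loc :: "real \<Rightarrow> (real^'n::finite) set \<Rightarrow> (real^'n \<Rightarrow> real) \<Rightarrow> bool" where
  "Lq_loc q \<Omega> f \<longleftrightarrow> f \<in> borel_measurable (lebesgue_on \<Omega>) \<and>
     (\<forall>K. compact K \<and> K \<subseteq> \<Omega> \<longrightarrow> integrable (lebesgue_on K) (\<lambda>x. \<bar>f x\<bar> powr q))"

definition has_weak_partial ::
    "(real^'n::finite) set \<Rightarrow> 'n \<Rightarrow> (real^'n \<Rightarrow> real) \<Rightarrow> (real^'n \<Rightarrow> real) \<Rightarrow> bool" where
  "has_weak_partial \<Omega> i u g \<longleftrightarrow> Lq_loc 1 \<Omega> u \<and> Lq_loc 1 \<Omega> g \<and>
     (\<forall>\<psi>. test_function \<Omega> \<psi> \<longrightarrow>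
        (LINT x|lebesgue_on \<Omega>. u x * partial_deriv i \<psi> x) = - (LINT x|lebesgue_on \<Omega>. g x * \<psi> x))"

text \<open>
  \<open>u \<in> W\<^sup>2\<^sup>,\<^sup>q\<^sub>l\<^sub>o\<^sub>c(\<Omega>)\<close> with weak gradient \<open>Du\<close> and weak Hessian \<open>D2u\<close>; these are unique up to null sets,
  and are carried along so that the differential equation can be stated.
\<close>
definition W2q_loc :: "real \<Rightarrow> (real^'n::finite) set \<Rightarrow>
    (real^'n \<Rightarrow> real) \<Rightarrow> (real^'n \<Rightarrow> real^'n) \<Rightarrow> (real^'n \<Rightarrow> real^'n^'n) \<Rightarrow> bool" where
  "W2q_loc q \<Omega> u Du D2u \<longleftrightarrow> Lq_loc q \<Omega> u \<and>
     (\<forall>i. Lq_loc q \<Omega> (\<lambda>x. Du x $ i) \<and> has_weak_partial \<Omega> i u (\<lambda>x. Du x $ i)) \<and>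
     (\<forall>i j. Lq_loc q \<Omega> (\<lambda>x. D2u x $ i $ j) \<and>
        has_weak_partial \<Omega> i (\<lambda>x. Du x $ j) (\<lambda>x. D2u x $ i $ j))"

text \<open>
  The value at \<open>x\<close> of \<open>L\<^sub>0 u = a\<^sub>i\<^sub>j \<partial>\<^sub>i\<^sub>j u + b\<^sub>i \<partial>\<^sub>i u\<close>, in terms of the derivatives of \<open>u\<close>.
\<close>
definition L0 :: "(real^'n \<Rightarrow> real^'n^'n) \<Rightarrow> (real^'n \<Rightarrow> real^'n) \<Rightarrow>
    (real^'n \<Rightarrow> real^'n) \<Rightarrow> (real^'n \<Rightarrow> real^'n^'n) \<Rightarrow> real^'n::finite \<Rightarrow> real" where
  "L0 a b Du D2u x =
     (\<Sum>i\<in>UNIV. \<Sum>j\<in>UNIV. a x $ i $ j * D2u x $ i $ j) + (\<Sum>i\<in>UNIV. b x $ i * Du x $ i)"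

text \<open>
  \<open>lam\<close> is an eigenvalue of \<open>- L\<^sub>0\<close> in \<open>\<Omega>\<close>, with zero Dirichlet condition, that has a positive
  eigenfunction. By Berestycki, Nirenberg and Varadhan exactly one such \<open>lam\<close> exists for a bounded
  smooth domain, smooth uniformly elliptic \<open>a\<close> and bounded \<open>b\<close>; being \<open>\<lambda>\<^sub>1(L\<^sub>0, \<Omega>)\<close> is therefore
  expressed as a relation.
\<close>
definition is_principal_eigenvalue :: "(real^'n \<Rightarrow> real^'n^'n) \<Rightarrow> (real^'n \<Rightarrow> real^'n) \<Rightarrow>
    (real^'n::finite) set \<Rightarrow> real \<Rightarrow> bool" where
  "is_principal_eigenvalue a b \<Omega> lam \<longleftrightarrow> (\<exists>\<phi> D\<phi> D2\<phi>.
     (\<forall>q\<ge>1. W2q_loc q \<Omega> \<phi> D\<phi> D2\<phi>) \<and> continuous_on (closure \<Omega>) \<phi> \<and>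
     (AE x in lebesgue_on \<Omega>. L0 a b D\<phi> D2\<phi> x = - lam * \<phi> x) \<and>
     (\<forall>x\<in>frontier \<Omega>. \<phi> x = 0) \<and> (\<forall>x\<in>\<Omega>. \<phi> x > 0))"

definition elliptic_on :: "real \<Rightarrow> real \<Rightarrow> (real^'n::finite) set \<Rightarrow> (real^'n \<Rightarrow> real^'n^'n) \<Rightarrow> bool" where
  "elliptic_on c0 C0 \<Omega> a \<longleftrightarrow> (\<forall>x\<in>\<Omega>. \<forall>\<xi>.
     c0 * (norm \<xi>)\<^sup>2 \<le> (\<Sum>i\<in>UNIV. \<Sum>j\<in>UNIV. a x $ i $ j * \<xi> $ i * \<xi> $ j) \<and>
     (\<Sum>i\<in>UNIV. \<Sum>j\<in>UNIV. a x $ i $ j * \<xi> $ i * \<xi> $ j) \<le> C0 * (norm \<xi>)\<^sup>2)"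

definition Linfty_on :: "(real^'n::finite) set \<Rightarrow> (real^'n \<Rightarrow> real^'n) \<Rightarrow> bool" where
  "Linfty_on \<Omega> b \<longleftrightarrow> b \<in> borel_measurable (lebesgue_on \<Omega>) \<and>
     (\<exists>M. AE x in lebesgue_on \<Omega>. norm (b x) \<le> M)"

definition Ln_norm :: "(real^'n::finite) set \<Rightarrow> (real^'n \<Rightarrow> real^'n) \<Rightarrow> real" where
  "Ln_norm \<Omega> b = (LINT x|lebesgue_on \<Omega>. norm (b x) ^ CARD('n)) powr (1 / real CARD('n))"

end

theory Submission
  imports Defs
begin

text \<open>
  The estimate is an Aleksandrov-Bakelman-Pucci argument for the logarithm of the principal
  eigenfunction \<open>\<phi>\<close>. Put \<open>w = - ln \<phi>\<close>. As \<open>w\<close> tends to infinity at the boundary of the bounded set \<open>\<Omega>\<close>,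
  the function \<open>w - p \<bullet> x\<close> has an interior minimum for every vector \<open>p\<close> whatsoever; hence the
  gradient of \<open>w\<close> maps the set of contact points with supporting planes onto the whole space. The
  diameter of \<open>\<Omega>\<close>, which enters the usual form of the argument, therefore does not appear. At a
  contact point the Hessian of \<open>w\<close> is positive semidefinite, and with \<open>p = \<nabla>w\<close> the equation becomes
  \<open>a\<^sub>i\<^sub>j \<partial>\<^sub>i\<^sub>j w = \<lambda> - b \<bullet> p + a\<^sub>i\<^sub>j p\<^sub>i p\<^sub>j \<le> \<lambda> + |b| |p| + C0 |p|\<^sup>2\<close>,
  so that the Jacobian determinant of the gradient map is at most a constant times the \<open>n\<close>-th power
  of the right-hand side.

  Change of variables with the weight \<open>1 / (\<kappa>\<^sup>n + |p|\<^sup>n)\<close> on the ball of radius \<open>M\<close> then gives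
  \<open>\<integral> dp / (\<kappa>\<^sup>n + |p|\<^sup>n) \<le> C1 (((2 \<lambda>)\<^sup>n / \<kappa>\<^sup>n + (C0 M)\<^sup>n) |\<Omega>| + \<integral> |b|\<^sup>n)\<close>.
  This is \<open>eigenvalue_gradient_estimate\<close>, where \<open>\<lambda>\<close> on the right stands for its positive part.
  The weight is chosen such that \<open>|b|\<^sup>n |p|\<^sup>n\<close> contributes at most
  \<open>\<integral> |b|\<^sup>n\<close>, although the left-hand side is unbounded as \<open>\<kappa>\<close> decreases: all dyadic shells between
  radius \<open>\<kappa>\<close> and radius \<open>M\<close> contribute comparable amounts to it (\<open>weight_integral_ge\<close>). With
  \<open>M = |\<Omega>|\<^sup>-\<^sup>1\<^sup>/\<^sup>n\<close> and \<open>\<kappa> = M / 2\<^sup>N\<close>, where \<open>N\<close> is large in terms of \<open>n\<close>, \<open>c0\<close>, \<open>C0\<close> and the norm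
  of \<open>b\<close>, the term with \<open>\<lambda>\<close> is forced to be at least \<open>C1\<close>, which is the asserted bound.

  The eigenfunction only has weak second derivatives that are locally integrable to all powers, so
  the argument is applied to a mollification \<open>v\<close> of \<open>\<phi>\<close> on a compact set which contains all contact
  points with \<open>|p| \<le> M\<close>. There \<open>v\<close> is close to \<open>\<phi>\<close> uniformly, and its first and second derivatives
  are close to the weak derivatives of \<open>\<phi>\<close> in \<open>L\<^sup>n\<close> (\<open>mollifier_Lp_convergence\<close>). The error made in
  the equation thus adds a term to the right-hand side which tends to zero.
\<close>

section \<open>Positive semidefinite matrices\<close>

definition quad_form :: "('n::finite \<Rightarrow> 'n \<Rightarrow> real) \<Rightarrow> ('n \<Rightarrow> real) \<Rightarrow> real" where
  "quad_form H \<xi> = (\<Sum>i\<in>UNIV. \<Sum>j\<in>UNIV. H i j * \<xi> i * \<xi> j)"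

definition psd :: "('n::finite \<Rightarrow> 'n \<Rightarrow> real) \<Rightarrow> bool" where
  "psd H \<longleftrightarrow> (\<forall>i j. H i j = H j i) \<and> (\<forall>\<xi>. 0 \<le> quad_form H \<xi>)"

lemma quad_form_shift:
  fixes H :: "'n::finite \<Rightarrow> 'n \<Rightarrow> real"
  assumes sym: "\<And>i j. H i j = H j i"
  shows "quad_form H (\<lambda>i. \<xi> i + t * of_bool (i = k)) =
    quad_form H \<xi> + 2 * t * (\<Sum>j\<in>UNIV. H k j * \<xi> j) + t\<^sup>2 * H k k"
proof -
  obtain r where r: "\<And>i. H i k = r i" "\<And>j. H k j = r j"
    using sym by metis
  have 1: "(\<Sum>i\<in>UNIV. \<Sum>j\<in>UNIV. H i j * \<xi> i * (t * of_bool (j = k))) = t * (\<Sum>j\<in>UNIV. H k j * \<xi> j)"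
    using r by (simp add: of_bool_def if_distrib[of "\<lambda>x. _ * x"] sum_distrib_left mult_ac cong: if_cong)
  have "(\<Sum>i\<in>UNIV. \<Sum>j\<in>UNIV. H i j * (t * of_bool (i = k)) * \<xi> j)
      = (\<Sum>i\<in>UNIV. if i = k then t * (\<Sum>j\<in>UNIV. H k j * \<xi> j) else 0)"
    by (intro sum.cong refl) (auto simp: sum_distrib_left mult_ac)
  then have 2: "(\<Sum>i\<in>UNIV. \<Sum>j\<in>UNIV. H i j * (t * of_bool (i = k)) * \<xi> j) = t * (\<Sum>j\<in>UNIV. H k j * \<xi> j)"
    by simp
  have "(\<Sum>i\<in>UNIV. \<Sum>j\<in>UNIV. H i j * (t * of_bool (i = k)) * (t * of_bool (j = k)))
     = (\<Sum>i\<in>UNIV. if i = k then t\<^sup>2 * H k k else 0)"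
    by (intro sum.cong refl)
      (auto simp: power2_eq_square of_bool_def if_distrib[of "\<lambda>x. _ * x"] mult_ac cong: if_cong)
  then have 3: "(\<Sum>i\<in>UNIV. \<Sum>j\<in>UNIV. H i j * (t * of_bool (i = k)) * (t * of_bool (j = k))) = t\<^sup>2 * H k k"
    by simp
  have "quad_form H (\<lambda>i. \<xi> i + t * of_bool (i = k)) = quad_form H \<xi>
      + (\<Sum>i\<in>UNIV. \<Sum>j\<in>UNIV. H i j * \<xi> i * (t * of_bool (j = k)))
      + (\<Sum>i\<in>UNIV. \<Sum>j\<in>UNIV. H i j * (t * of_bool (i = k)) * \<xi> j)
      + (\<Sum>i\<in>UNIV. \<Sum>j\<in>UNIV. H i j * (t * of_bool (i = k)) * (t * of_bool (j = k)))"
    unfolding quad_form_def by (simp only: distrib_left distrib_right sum.distrib add_ac)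
  then show ?thesis using 1 2 3 by simp
qed

lemma quad_form_axis: "quad_form H (\<lambda>i. of_bool (i = k)) = H k k"
proof -
  have "quad_form H (\<lambda>i. of_bool (i = k)) = (\<Sum>i\<in>UNIV. if i = k then H k k else 0)"
    unfolding quad_form_def
    by (intro sum.cong refl) (auto simp: of_bool_def if_distrib[of "\<lambda>x. _ * x"] cong: if_cong)
  then show ?thesis by simp
qed

lemma psd_diag_nonneg: "psd H \<Longrightarrow> 0 \<le> H k k"
  using quad_form_axis[of H k] unfolding psd_def by metis

lemma psd_two_by_two:
  assumes "psd H"
  shows "0 \<le> H j j + 2 * t * H k j + t\<^sup>2 * H k k"
proof -
  have "0 \<le> quad_form H (\<lambda>i. of_bool (i = j) + t * of_bool (i = k))"
    using assms unfolding psd_def by blast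
  also have "\<dots> = H j j + 2 * t * (\<Sum>l\<in>UNIV. H k l * of_bool (l = j)) + t\<^sup>2 * H k k"
    using assms by (subst quad_form_shift) (auto simp: psd_def quad_form_axis)
  also have "(\<Sum>l\<in>UNIV. H k l * of_bool (l = j)) = H k j"
    by (simp add: of_bool_def if_distrib[of "\<lambda>x. _ * x"] cong: if_cong)
  finally show ?thesis .
qed

lemma psd_zero_row:
  assumes "psd H" "H k k = 0"
  shows "H k j = 0"
proof (rule ccontr)
  assume nz: "H k j \<noteq> 0"
  have "0 \<le> H j j + 2 * (- (H j j + 1) / (2 * H k j)) * H k j"
    using psd_two_by_two[OF assms(1), of j "- (H j j + 1) / (2 * H k j)" k] assms(2) by simp
  then show False using nz by (simp add: field_simps)
qed

text \<open>
  One step of Gaussian elimination. The form of the reduced matrix at \<open>\<xi>\<close> is the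
  minimum of the original form over the line \<open>\<xi> + t e\<^sub>k\<close>, hence
  nonnegative.
\<close>
lemma psd_eliminate:
  assumes H: "psd H" and k: "H k k > 0"
  shows "psd (\<lambda>i j. H i j - H i k * H k j / H k k)"
  unfolding psd_def
proof (intro conjI allI)
  have sym: "\<And>i j. H i j = H j i" using H by (auto simp: psd_def)
  show "H i j - H i k * H k j / H k k = H j i - H j k * H k i / H k k" for i j
    using sym[of i j] sym[of i k] sym[of k j] by (simp add: mult_ac)
  fix \<xi> :: "'a \<Rightarrow> real"
  obtain r where r: "\<And>i. H i k = r i" "\<And>j. H k j = r j"
    using sym by metis
  let ?s = "\<Sum>j\<in>UNIV. H k j * \<xi> j"
  have "quad_form (\<lambda>i j. H i j - H i k * H k j / H k k) \<xi>
      = quad_form H \<xi> - (\<Sum>i\<in>UNIV. \<Sum>j\<in>UNIV. (H k i * \<xi> i) * (H k j * \<xi> j) / H k k)"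
    unfolding quad_form_def
    by (simp add: sum_subtractf[symmetric] r algebra_simps)
  also have "(\<Sum>i\<in>UNIV. \<Sum>j\<in>UNIV. (H k i * \<xi> i) * (H k j * \<xi> j) / H k k) = ?s * ?s / H k k"
    by (simp only: sum_product sum_divide_distrib)
  also have "quad_form H \<xi> - ?s * ?s / H k k =
     quad_form H (\<lambda>i. \<xi> i + (- ?s / H k k) * of_bool (i = k))"
    using k by (subst quad_form_shift[OF sym]) (simp add: field_simps power2_eq_square)
  also have "\<dots> \<ge> 0" using H unfolding psd_def by blast
  finally show "0 \<le> quad_form (\<lambda>i j. H i j - H i k * H k j / H k k) \<xi>" .
qed

text \<open>
  Elimination writes \<open>H\<close> as a sum of matrices \<open>r r\<^sup>T\<close>, and
  contracting \<open>A\<close> with \<open>r r\<^sup>T\<close> evaluates the form of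
  \<open>A\<close> at \<open>r\<close>.
\<close>
lemma psd_contract_nonneg:
  fixes A H :: "'n::finite \<Rightarrow> 'n \<Rightarrow> real"
  assumes A: "\<And>\<xi>. 0 \<le> quad_form A \<xi>" and H: "psd H"
  shows "0 \<le> (\<Sum>i\<in>UNIV. \<Sum>j\<in>UNIV. A i j * H i j)"
  using H
proof (induction "card {i. H i i \<noteq> 0}" arbitrary: H rule: less_induct)
  case less
  show ?case
  proof (cases "\<exists>k. H k k \<noteq> 0")
    case False
    then show ?thesis using psd_zero_row[OF less.prems] by simp
  next
    case True
    then obtain k where "H k k \<noteq> 0" by blast
    then have k: "H k k > 0" using psd_diag_nonneg[OF less.prems, of k] by simp
    have sym: "\<And>i j. H i j = H j i" using less.prems by (auto simp: psd_def)
    obtain r where r: "\<And>i. H i k = r i" "\<And>j. H k j = r j"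
      using sym by metis
    define H' where "H' = (\<lambda>i j. H i j - H i k * H k j / H k k)"
    have psd': "psd H'" unfolding H'_def by (rule psd_eliminate[OF less.prems k])
    have "{i. H' i i \<noteq> 0} \<subset> {i. H i i \<noteq> 0}"
    proof (rule psubsetI)
      show "{i. H' i i \<noteq> 0} \<subseteq> {i. H i i \<noteq> 0}"
      proof safe
        fix i assume i: "H' i i \<noteq> 0" "H i i = 0"
        have "H i k = 0" by (rule psd_zero_row[OF less.prems i(2)])
        then show False using i by (simp add: H'_def)
      qed
      show "{i. H' i i \<noteq> 0} \<noteq> {i. H i i \<noteq> 0}"
      proof
        assume "{i. H' i i \<noteq> 0} = {i. H i i \<noteq> 0}"
        then have "k \<in> {i. H' i i \<noteq> 0}" using \<open>H k k \<noteq> 0\<close> by blast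
        then show False using k by (simp add: H'_def)
      qed
    qed
    then have "card {i. H' i i \<noteq> 0} < card {i. H i i \<noteq> 0}"
      by (intro psubset_card_mono) auto
    then have IH: "0 \<le> (\<Sum>i\<in>UNIV. \<Sum>j\<in>UNIV. A i j * H' i j)"
      using less.hyps psd' by blast
    have "(\<Sum>i\<in>UNIV. \<Sum>j\<in>UNIV. A i j * H i j) =
       (\<Sum>i\<in>UNIV. \<Sum>j\<in>UNIV. A i j * H' i j) + quad_form A (H k) / H k k"
      unfolding H'_def quad_form_def
      by (simp add: right_diff_distrib sum_subtractf sum_divide_distrib r mult_ac)
    then show ?thesis using IH A[of "H k"] k by simp
  qed
qed

lemma psd_entry_le_trace:
  assumes "psd H"
  shows "\<bar>H i j\<bar> \<le> (\<Sum>k\<in>UNIV. H k k)"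
proof -
  have t: "H l l \<le> (\<Sum>k\<in>UNIV. H k k)" for l
    by (rule member_le_sum) (auto intro: psd_diag_nonneg[OF assms])
  show ?thesis
    using psd_two_by_two[OF assms, of j 1 i] psd_two_by_two[OF assms, of j "-1" i] t[of i] t[of j]
    by (simp add: abs_le_iff)
qed

text \<open>
  The arithmetic-geometric mean inequality for the eigenvalues would give the constant
  \<open>n\<^sup>-\<^sup>n\<close>. The factor \<open>n!\<close> comes from estimating each summand
  of the Leibniz formula separately, since no entry exceeds the trace.
\<close>
lemma psd_det_le:
  fixes H :: "real^'n^'n"
  assumes "psd (\<lambda>i j. H $ i $ j)"
  shows "\<bar>det H\<bar> \<le> fact CARD('n) * (\<Sum>k\<in>UNIV. H $ k $ k) ^ CARD('n)"
proof -
  let ?T = "\<Sum>k\<in>UNIV. H $ k $ k"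
  have "\<bar>det H\<bar> \<le> (\<Sum>p\<in>{p. p permutes (UNIV::'n set)}. \<bar>of_int (sign p) * (\<Prod>i\<in>UNIV. H $ i $ p i)\<bar>)"
    unfolding det_def by (rule sum_abs)
  also have "\<dots> \<le> (\<Sum>p\<in>{p. p permutes (UNIV::'n set)}. ?T ^ CARD('n))"
  proof (rule sum_mono)
    fix p :: "'n \<Rightarrow> 'n"
    have "\<bar>of_int (sign p) * (\<Prod>i\<in>UNIV. H $ i $ p i)\<bar> = (\<Prod>i\<in>UNIV. \<bar>H $ i $ p i\<bar>)"
      by (simp add: abs_mult abs_prod sign_def)
    also have "\<dots> \<le> (\<Prod>i\<in>(UNIV::'n set). ?T)"
      by (rule prod_mono) (use psd_entry_le_trace[OF assms] in auto)
    finally show "\<bar>of_int (sign p) * (\<Prod>i\<in>UNIV. H $ i $ p i)\<bar> \<le> ?T ^ CARD('n)" by simp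
  qed
  also have "\<dots> = fact CARD('n) * ?T ^ CARD('n)"
    by (simp add: card_permutations)
  finally show ?thesis .
qed

text \<open>
  Ellipticity says that \<open>A - c I\<close> has a nonnegative form, and such a matrix has a
  nonnegative contraction with \<open>H\<close>.
\<close>
lemma elliptic_trace_le:
  fixes A H :: "'n::finite \<Rightarrow> 'n \<Rightarrow> real"
  assumes A: "\<And>\<xi>. c * (\<Sum>i\<in>UNIV. (\<xi> i)\<^sup>2) \<le> quad_form A \<xi>" and H: "psd H"
  shows "c * (\<Sum>i\<in>UNIV. H i i) \<le> (\<Sum>i\<in>UNIV. \<Sum>j\<in>UNIV. A i j * H i j)"
proof -
  define A' where "A' = (\<lambda>i j. A i j - c * of_bool (i = j))"
  have q: "(\<Sum>i\<in>UNIV. \<Sum>j\<in>UNIV. c * of_bool (i = j) * X i j) = c * (\<Sum>i\<in>UNIV. X i i)"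
    for X :: "'n \<Rightarrow> 'n \<Rightarrow> real"
    by (simp add: of_bool_def if_distrib[of "\<lambda>x. _ * x"] if_distrib[of "\<lambda>x. x * _"] sum_distrib_left cong: if_cong)
  have "0 \<le> quad_form A' \<xi>" for \<xi>
  proof -
    have "quad_form A' \<xi> = quad_form A \<xi> - (\<Sum>i\<in>UNIV. \<Sum>j\<in>UNIV. c * of_bool (i = j) * (\<xi> i * \<xi> j))"
      unfolding quad_form_def A'_def
      by (simp add: left_diff_distrib sum_subtractf mult.assoc)
    also have "\<dots> = quad_form A \<xi> - c * (\<Sum>i\<in>UNIV. (\<xi> i)\<^sup>2)"
      by (subst q) (simp add: power2_eq_square)
    finally show ?thesis using A[of \<xi>] by simp
  qed
  from psd_contract_nonneg[of A', OF this H] show ?thesis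
    unfolding A'_def by (simp add: left_diff_distrib sum_subtractf q)
qed

section \<open>The gradient image of the contact set\<close>

lemma continuous_on_compact_integrable_on:
  fixes f :: "'a::euclidean_space \<Rightarrow> real"
  assumes "compact S" "continuous_on S f"
  shows "f absolutely_integrable_on S" "f integrable_on S"
    "integral S f = (\<integral>x. indicator S x *\<^sub>R f x \<partial>lborel)"
proof -
  have i: "integrable lborel (\<lambda>x. indicator S x *\<^sub>R f x)"
    by (rule borel_integrable_compact[OF assms])
  then show a: "f absolutely_integrable_on S"
    unfolding set_integrable_def by (subst integrable_completion) (auto dest: borel_measurable_integrable)
  then show "f integrable_on S" by (rule set_lebesgue_integral_eq_integral(1))
  show "integral S f = (\<integral>x. indicator S x *\<^sub>R f x \<partial>lborel)"
    using set_lebesgue_integral_eq_integral(2)[OF a] i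
    unfolding set_lebesgue_integral_def by (subst (asm) integral_completion) (auto dest: borel_measurable_integrable)
qed

lemma continuous_on_det:
  fixes H :: "'a::topological_space \<Rightarrow> real^'n^'n"
  assumes "continuous_on S H"
  shows "continuous_on S (\<lambda>x. det (H x))"
  unfolding det_def by (intro continuous_intros assms)

text \<open>
  Bounding the Jacobian determinant by the trace before relabelling the coordinates leaves a
  statement about sums of diagonal entries, which are easier to transport to another index type than
  determinants.
\<close>
lemma area_trace_wellorder:
  fixes G :: "real^'n::{finite,wellorder} \<Rightarrow> real^'n::_" and H :: "real^'n::_ \<Rightarrow> real^'n::_^'n::_"
  assumes S: "compact S"
    and G: "\<And>x. x \<in> S \<Longrightarrow> (G has_derivative (\<lambda>v. H x *v v)) (at x within S)"
    and H: "continuous_on S H"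
    and psd: "\<And>x. x \<in> S \<Longrightarrow> psd (\<lambda>i j. H x $ i $ j)"
    and f: "continuous_on UNIV f" "\<And>p. 0 \<le> f p"
  shows "integral (G ` S) f \<le>
    integral S (\<lambda>x. fact CARD('n) * (\<Sum>k\<in>UNIV. H x $ k $ k) ^ CARD('n) * f (G x))"
proof -
  have Gc: "continuous_on S G"
    using G by (intro has_derivative_continuous_on) auto
  have fG: "continuous_on S (\<lambda>x. f (G x))"
    using continuous_on_compose2[OF f(1) Gc] by auto
  have M: "matrix (\<lambda>v. H x *v v) = H x" for x by (rule matrix_of_matrix_vector_mul)
  have c1: "continuous_on S (\<lambda>x. \<bar>det (matrix (\<lambda>v. H x *v v))\<bar> * f (G x))"
    unfolding M by (intro continuous_intros continuous_on_det H fG)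
  have c2: "continuous_on S (\<lambda>x. fact CARD('n) * (\<Sum>k\<in>UNIV. H x $ k $ k) ^ CARD('n) * f (G x))"
    by (intro continuous_intros H fG)
  have "integral (G ` S) f \<le> integral S (\<lambda>x. \<bar>det (matrix (\<lambda>v. H x *v v))\<bar> * f (G x))"
    using integral_on_image_ubound_nonneg[OF f(2) G continuous_on_compact_integrable_on(2)[OF S c1]] by blast
  also have "\<dots> \<le> integral S (\<lambda>x. fact CARD('n) * (\<Sum>k\<in>UNIV. H x $ k $ k) ^ CARD('n) * f (G x))"
    using psd_det_le[OF psd] f(2)
    by (intro integral_le continuous_on_compact_integrable_on(2) S c1 c2) (auto simp: M intro!: mult_right_mono)
  finally show ?thesis .
qed

text \<open>
  The change of variables inequality \<open>integral_on_image_ubound_nonneg\<close> is stated for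
  coordinates indexed by a well-ordered type. A finite type \<open>'n\<close> has well-orders but
  none is distinguished; this copy of \<open>'n\<close> is ordered through some injection into the
  natural numbers, and relabelling the coordinates is an isometry that preserves Lebesgue measure.
\<close>
typedef 'n::finite wo = "UNIV :: 'n set" ..

instantiation wo :: (finite) wellorder
begin

definition rank_wo :: "'a wo \<Rightarrow> nat" where
  "rank_wo x = (SOME f. inj f) (Rep_wo x)"

definition less_eq_wo :: "'a wo \<Rightarrow> 'a wo \<Rightarrow> bool" where
  "less_eq_wo x y \<longleftrightarrow> rank_wo x \<le> rank_wo y"

definition less_wo :: "'a wo \<Rightarrow> 'a wo \<Rightarrow> bool" where
  "less_wo x y \<longleftrightarrow> rank_wo x < rank_wo y"

instance
proof
  have "\<exists>f :: 'a \<Rightarrow> nat. inj f"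
    using finite_imp_inj_to_nat_seg[of "UNIV :: 'a set"] by auto
  then have "inj (SOME f :: 'a \<Rightarrow> nat. inj f)" by (rule someI_ex)
  then have inj: "rank_wo x = rank_wo y \<Longrightarrow> x = y" for x y :: "'a wo"
    unfolding rank_wo_def by (simp add: inj_eq Rep_wo_inject)
  fix x y z :: "'a wo"
  show "x < y \<longleftrightarrow> x \<le> y \<and> \<not> y \<le> x" "x \<le> x" "x \<le> y \<or> y \<le> x"
    by (auto simp: less_eq_wo_def less_wo_def)
  show "x \<le> y \<Longrightarrow> y \<le> z \<Longrightarrow> x \<le> z" "x \<le> y \<Longrightarrow> y \<le> x \<Longrightarrow> x = y"
    using inj by (auto simp: less_eq_wo_def)
  show "(\<And>x. (\<And>y. y < x \<Longrightarrow> P y) \<Longrightarrow> P x) \<Longrightarrow> P a" for P and a :: "'a wo"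
    unfolding less_wo_def using measure_induct_rule[of rank_wo P a] by blast
qed

end

lemma bij_Rep_wo: "bij Rep_wo"
  by (metis Abs_wo_inverse Rep_wo_inverse UNIV_I bijI')

instance wo :: (finite) finite
proof
  show "finite (UNIV :: 'a wo set)"
    using bij_betw_finite[OF bij_Rep_wo] by simp
qed

lemma card_wo: "CARD('n::finite wo) = CARD('n)"
  using bij_Rep_wo bij_betw_same_card by blast

lemma sum_wo: "(\<Sum>c\<in>(UNIV :: 'n::finite wo set). g (Rep_wo c)) = (\<Sum>i\<in>UNIV. g i)"
  by (rule sum.reindex_bij_betw[OF bij_Rep_wo])

lemma prod_wo: "(\<Prod>c\<in>(UNIV :: 'n::finite wo set). g (Rep_wo c)) = (\<Prod>i\<in>UNIV. g i)"
  by (rule prod.reindex_bij_betw[OF bij_Rep_wo])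

definition to_wo :: "real^'n::finite \<Rightarrow> real^'n wo" where
  "to_wo v = (\<chi> c. v $ Rep_wo c)"

definition of_wo :: "real^'n wo \<Rightarrow> real^'n::finite" where
  "of_wo u = (\<chi> i. u $ Abs_wo i)"

lemma to_wo_of_wo [simp]: "to_wo (of_wo u) = u" "of_wo (to_wo v) = v"
  by (simp_all add: to_wo_def of_wo_def vec_eq_iff Rep_wo_inverse Abs_wo_inverse)

lemma linear_to_wo: "linear to_wo" "linear of_wo"
  by (auto simp: linear_iff to_wo_def of_wo_def vec_eq_iff)

lemma bounded_linear_to_wo: "bounded_linear to_wo" "bounded_linear of_wo"
  using linear_to_wo by (auto simp: linear_conv_bounded_linear)

lemma continuous_on_to_wo: "continuous_on S to_wo"
  by (rule linear_continuous_on[OF bounded_linear_to_wo(1)])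

lemma continuous_on_of_wo: "continuous_on S of_wo"
  by (rule linear_continuous_on[OF bounded_linear_to_wo(2)])

lemma prod_Basis_vec: "(\<Prod>b\<in>(Basis :: (real^'n) set). g b) = (\<Prod>i\<in>UNIV. g (axis i 1))"
proof -
  have B: "(Basis :: (real^'n) set) = (\<lambda>i. axis i 1) ` UNIV"
    by (auto simp: Basis_vec_def)
  have "inj (\<lambda>i::'n. axis i (1::real))"
    by (auto simp: inj_def axis_eq_axis)
  then show ?thesis unfolding B by (subst prod.reindex) auto
qed

lemma lborel_to_wo: "distr lborel borel to_wo = (lborel :: (real^'n::finite wo) measure)"
proof (rule lborel_eqI[symmetric])
  have m: "to_wo \<in> borel_measurable (borel :: (real^'n) measure)"
    by (intro borel_measurable_continuous_onI continuous_on_to_wo)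
  fix l u :: "real^'n wo"
  assume le: "\<And>b. b \<in> Basis \<Longrightarrow> l \<bullet> b \<le> u \<bullet> b"
  have le': "l $ c \<le> u $ c" for c
    using le[of "axis c 1"] by (simp add: axis_in_Basis_iff inner_axis)
  have "to_wo -` box l u = box (of_wo l) (of_wo u :: real^'n)"
  proof (rule set_eqI)
    fix v :: "real^'n"
    have "(\<forall>i::'n. l $ Abs_wo i < v $ i \<and> v $ i < u $ Abs_wo i) \<longleftrightarrow>
        (\<forall>c. l $ c < v $ Rep_wo c \<and> v $ Rep_wo c < u $ c)"
      by (metis Abs_wo_inverse Rep_wo_inverse UNIV_I)
    then show "v \<in> to_wo -` box l u \<longleftrightarrow> v \<in> box (of_wo l) (of_wo u)"
      by (simp add: mem_box_cart to_wo_def of_wo_def)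
  qed
  then have "emeasure (distr lborel borel to_wo) (box l u) = emeasure lborel (box (of_wo l) (of_wo u :: real^'n))"
    using m by (subst emeasure_distr) auto
  also have "\<dots> = (\<Prod>b\<in>Basis. (of_wo u - of_wo l :: real^'n) \<bullet> b)"
    using le' by (intro emeasure_lborel_box) (auto simp: Basis_vec_def inner_axis of_wo_def)
  also have "(\<Prod>b\<in>Basis. (of_wo u - of_wo l :: real^'n) \<bullet> b) = (\<Prod>i\<in>UNIV. (of_wo u - of_wo l :: real^'n) $ i)"
    by (simp add: prod_Basis_vec inner_axis)
  also have "\<dots> = (\<Prod>c\<in>UNIV. (u - l) $ c)"
    by (subst prod_wo[symmetric]) (simp add: of_wo_def Rep_wo_inverse)
  also have "\<dots> = (\<Prod>b\<in>Basis. (u - l) \<bullet> b)"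
    by (simp add: prod_Basis_vec inner_axis)
  finally show "emeasure (distr lborel borel to_wo) (box l u) = (\<Prod>b\<in>Basis. (u - l) \<bullet> b)" .
qed simp

lemma integral_to_wo:
  fixes f :: "real^'n::finite wo \<Rightarrow> real"
  assumes S: "compact S" and f: "continuous_on (to_wo ` S) f"
  shows "integral (to_wo ` S) f = integral S (\<lambda>x. f (to_wo x))"
proof -
  have S': "compact (to_wo ` S)" by (intro compact_continuous_image continuous_on_to_wo S)
  have c: "continuous_on S (\<lambda>x. f (to_wo x))"
    by (rule continuous_on_compose2[OF f continuous_on_to_wo]) auto
  have m: "to_wo \<in> borel_measurable (borel :: (real^'n) measure)"
    by (intro borel_measurable_continuous_onI continuous_on_to_wo)
  have "inj (to_wo :: real^'n \<Rightarrow> _)" by (metis injI to_wo_of_wo(2))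
  then have ind: "indicator (to_wo ` S) (to_wo x) = (indicator S x :: real)" for x
    by (auto simp: indicator_def inj_image_mem_iff)
  have bm: "(\<lambda>y. indicator (to_wo ` S) y *\<^sub>R f y) \<in> borel_measurable borel"
    using borel_integrable_compact[OF S' f] by (auto dest: borel_measurable_integrable)
  have "integral (to_wo ` S) f = (\<integral>y. indicator (to_wo ` S) y *\<^sub>R f y \<partial>distr lborel borel to_wo)"
    by (simp add: continuous_on_compact_integrable_on(3)[OF S' f] lborel_to_wo)
  also have "\<dots> = (\<integral>x. indicator S x *\<^sub>R f (to_wo x) \<partial>lborel)"
    using m bm by (subst integral_distr) (auto simp: ind)
  also have "\<dots> = integral S (\<lambda>x. f (to_wo x))"
    by (simp add: continuous_on_compact_integrable_on(3)[OF S c])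
  finally show ?thesis .
qed

lemma area_trace:
  fixes G :: "real^'n::finite \<Rightarrow> real^'n" and H :: "real^'n \<Rightarrow> real^'n^'n"
  assumes S: "compact S"
    and G: "\<And>x. x \<in> S \<Longrightarrow> (G has_derivative (\<lambda>v. H x *v v)) (at x within S)"
    and H: "continuous_on S H"
    and psd: "\<And>x. x \<in> S \<Longrightarrow> psd (\<lambda>i j. H x $ i $ j)"
    and f: "continuous_on UNIV f" "\<And>p. 0 \<le> f p"
  shows "integral (G ` S) f \<le>
    integral S (\<lambda>x. fact CARD('n) * (\<Sum>k\<in>UNIV. H x $ k $ k) ^ CARD('n) * f (G x))"
proof -
  define S' where "S' = to_wo ` S"
  define G' where "G' = (\<lambda>y. to_wo (G (of_wo y)))"
  define H' :: "real^'n wo \<Rightarrow> real^'n wo^'n wo" where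
    "H' = (\<lambda>y. \<chi> c d. H (of_wo y) $ Rep_wo c $ Rep_wo d)"
  define f' where "f' = (\<lambda>p. f (of_wo p))"
  have Gc: "continuous_on S G"
    using G by (intro has_derivative_continuous_on) auto
  have fG: "continuous_on S (\<lambda>x. f (G x))"
    using continuous_on_compose2[OF f(1) Gc] by auto
  have S': "compact S'" unfolding S'_def by (intro compact_continuous_image continuous_on_to_wo S)
  have ofS: "of_wo ` S' = S" by (auto simp: S'_def image_image)
  have mul: "to_wo (H x *v of_wo v) = H' (to_wo x) *v v" for x v
  proof -
    have "(H x *v of_wo v) $ i = (\<Sum>d\<in>UNIV. H x $ i $ Rep_wo d * v $ d)" for i
      unfolding matrix_vector_mult_def
      by (subst sum_wo[symmetric]) (simp add: of_wo_def Rep_wo_inverse)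
    then show ?thesis
      by (simp add: vec_eq_iff to_wo_def[of "H x *v of_wo v"]) (simp add: matrix_vector_mult_def H'_def)
  qed
  have H'c: "continuous_on S' H'"
    unfolding H'_def S'_def
    by (intro continuous_intros continuous_on_compose2[OF H continuous_on_of_wo]) auto
  have f'c: "continuous_on UNIV f'"
    unfolding f'_def by (rule continuous_on_compose2[OF f(1) continuous_on_of_wo]) auto
  have "integral (G' ` S') f' \<le>
    integral S' (\<lambda>x. fact CARD('n wo) * (\<Sum>k\<in>UNIV. H' x $ k $ k) ^ CARD('n wo) * f' (G' x))"
  proof (rule area_trace_wellorder[OF S' _ H'c _ f'c])
    fix y assume "y \<in> S'"
    then obtain x where x: "y = to_wo x" "x \<in> S" by (auto simp: S'_def)
    have "(G has_derivative (\<lambda>v. H x *v v)) (at (of_wo y) within of_wo ` S')"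
      using G[OF x(2)] by (simp add: ofS x(1))
    from has_derivative_in_compose[OF bounded_linear_imp_has_derivative[OF bounded_linear_to_wo(2)] this]
    have "((\<lambda>y. G (of_wo y)) has_derivative (\<lambda>v. H x *v of_wo v)) (at y within S')" .
    from bounded_linear.has_derivative[OF bounded_linear_to_wo(1) this]
    show "(G' has_derivative (\<lambda>v. H' y *v v)) (at y within S')"
      unfolding G'_def mul x(1) .
    have "psd (\<lambda>i j. H x $ i $ j)" by (rule psd[OF x(2)])
    moreover have "quad_form (\<lambda>c d. H' y $ c $ d) \<xi> = quad_form (\<lambda>i j. H x $ i $ j) (\<lambda>i. \<xi> (Abs_wo i))" for \<xi>
    proof -
      have "quad_form (\<lambda>c d. H' y $ c $ d) \<xi> = (\<Sum>c\<in>UNIV. \<Sum>d\<in>UNIV.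
          H x $ Rep_wo c $ Rep_wo d * \<xi> (Abs_wo (Rep_wo c)) * \<xi> (Abs_wo (Rep_wo d)))"
        unfolding quad_form_def by (simp add: H'_def x(1) Rep_wo_inverse)
      also have "\<dots> = (\<Sum>c\<in>UNIV. \<Sum>j\<in>UNIV.
          H x $ Rep_wo c $ j * \<xi> (Abs_wo (Rep_wo c)) * \<xi> (Abs_wo j))"
        by (intro sum.cong refl sum_wo)
      also have "\<dots> = quad_form (\<lambda>i j. H x $ i $ j) (\<lambda>i. \<xi> (Abs_wo i))"
        unfolding quad_form_def by (rule sum_wo)
      finally show ?thesis .
    qed
    ultimately show "psd (\<lambda>c d. H' y $ c $ d)"
      by (simp add: psd_def) (simp add: H'_def x(1))
  qed (use f(2) in \<open>simp add: f'_def\<close>)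
  also have "integral S' (\<lambda>x. fact CARD('n wo) * (\<Sum>k\<in>UNIV. H' x $ k $ k) ^ CARD('n wo) * f' (G' x))
    = integral S (\<lambda>x. fact CARD('n) * (\<Sum>k\<in>UNIV. H x $ k $ k) ^ CARD('n) * f (G x))"
  proof -
    have "continuous_on S' (\<lambda>x. f (G (of_wo x)))"
      using continuous_on_compose2[OF fG continuous_on_of_wo[of S']] ofS by auto
    then have "continuous_on (to_wo ` S)
      (\<lambda>x. fact CARD('n wo) * (\<Sum>k\<in>UNIV. H' x $ k $ k) ^ CARD('n wo) * f' (G' x))"
      unfolding f'_def G'_def S'_def[symmetric] by (intro continuous_intros H'c) simp
    from integral_to_wo[OF S this] show ?thesis
      unfolding S'_def card_wo f'_def G'_def H'_def by (simp add: sum_wo[of "\<lambda>i. H _ $ i $ i"])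
  qed
  also have "integral (G' ` S') f' = integral (G ` S) f"
  proof -
    have "G' ` S' = to_wo ` G ` S" by (force simp: G'_def S'_def)
    then show ?thesis
      using integral_to_wo[OF compact_continuous_image[OF Gc S], of f'] continuous_on_subset[OF f'c]
      by (simp add: f'_def)
  qed
  finally show ?thesis .
qed

text \<open>
  If the Hessian were negative in the direction \<open>\<xi>\<close>, the slope of \<open>w\<close>
  along \<open>\<xi>\<close>, relative to the supporting plane, would become negative at once, and
  \<open>w\<close> would fall below the plane.
\<close>
lemma hessian_nonneg_at_interior_min:
  fixes w :: "real^'n::finite \<Rightarrow> real"
  assumes W: "open W" "x \<in> W"
    and w: "\<And>y. y \<in> W \<Longrightarrow> (w has_derivative (\<lambda>v. G y \<bullet> v)) (at y)"
    and G: "(G has_derivative (\<lambda>v. H *v v)) (at x)"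
    and min: "\<And>y. y \<in> W \<Longrightarrow> w x + G x \<bullet> (y - x) \<le> w y"
  shows "0 \<le> \<xi> \<bullet> (H *v \<xi>)"
proof (rule ccontr)
  assume neg: "\<not> 0 \<le> \<xi> \<bullet> (H *v \<xi>)"
  define q where "q = (\<lambda>t. (G (x + t *\<^sub>R \<xi>) - G x) \<bullet> \<xi>)"
  have l: "((\<lambda>t. x + t *\<^sub>R \<xi>) has_derivative (\<lambda>t. t *\<^sub>R \<xi>)) (at t)" for t
    by (auto intro!: derivative_eq_intros)
  have "((\<lambda>t. G (x + t *\<^sub>R \<xi>)) has_derivative (\<lambda>t. H *v (t *\<^sub>R \<xi>))) (at 0)"
    using has_derivative_compose[OF l[of 0], of G "\<lambda>v. H *v v"] G by simp
  then have "(q has_derivative (\<lambda>t. (H *v (t *\<^sub>R \<xi>)) \<bullet> \<xi>)) (at 0)"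
    unfolding q_def by (auto intro!: derivative_eq_intros)
  then have "(q has_real_derivative \<xi> \<bullet> (H *v \<xi>)) (at 0)"
    by (simp add: has_field_derivative_def matrix_vector_mult_scaleR inner_commute mult.commute[of _ "_ \<bullet> _"])
  then obtain d where d: "d > 0" "\<And>h. 0 < h \<Longrightarrow> h < d \<Longrightarrow> q (0 + h) < q 0"
    using DERIV_neg_dec_right[of q "\<xi> \<bullet> (H *v \<xi>)" 0] neg by force
  obtain e where e: "e > 0" "ball x e \<subseteq> W" using W open_contains_ball by blast
  define h where "h = min (d / 2) (e / (2 * (norm \<xi> + 1)))"
  have n: "norm \<xi> + 1 > 0" by (simp add: add_nonneg_pos)
  have h: "h > 0" "h < d" using d(1) e(1) n by (auto simp: h_def min_less_iff_disj)
  have "h * norm \<xi> \<le> e / (2 * (norm \<xi> + 1)) * (norm \<xi> + 1)"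
    using e(1) n by (intro mult_mono) (auto simp: h_def)
  also have "\<dots> = e / 2" using n by (simp add: field_simps)
  also have "\<dots> < e" using e(1) by simp
  finally have he: "h * norm \<xi> < e" .
  have inW: "x + t *\<^sub>R \<xi> \<in> W" if "0 \<le> t" "t \<le> h" for t
  proof -
    have "t * norm \<xi> \<le> h * norm \<xi>" using that by (intro mult_right_mono) auto
    then show ?thesis using e(2) he that by (auto simp: dist_norm subset_iff)
  qed
  define u where "u = (\<lambda>t. w (x + t *\<^sub>R \<xi>) - t * (G x \<bullet> \<xi>))"
  have du: "(u has_real_derivative q t) (at t)" if "0 \<le> t" "t \<le> h" for t
  proof -
    have "((\<lambda>t. w (x + t *\<^sub>R \<xi>)) has_derivative (\<lambda>s. G (x + t *\<^sub>R \<xi>) \<bullet> (s *\<^sub>R \<xi>))) (at t)"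
      by (rule has_derivative_compose[OF l w[OF inW[OF that]]])
    then have "(u has_derivative (\<lambda>s. G (x + t *\<^sub>R \<xi>) \<bullet> (s *\<^sub>R \<xi>) - s * (G x \<bullet> \<xi>))) (at t)"
      unfolding u_def by (auto intro!: derivative_eq_intros)
    then show ?thesis unfolding has_field_derivative_def q_def
      by (rule has_derivative_eq_rhs) (simp add: fun_eq_iff algebra_simps inner_diff_left)
  qed
  obtain z where z: "0 < z" "z < h" "u h - u 0 = (h - 0) * q z"
    using MVT2[OF h(1), of u q] du by auto
  have "q z < 0" using d(2)[of z] z h by (simp add: q_def)
  then have "u h < u 0" using z(3) h(1) by (simp add: mult_pos_neg) (metis diff_less_0_iff_less mult_pos_neg)
  moreover have "u 0 \<le> u h"
    using min[OF inW[of h]] h(1) by (simp add: u_def)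
  ultimately show False by simp
qed

text \<open>
  The set \<open>S\<close> consists of the points where the tangent plane, of slope at most
  \<open>M\<close>, supports \<open>w\<close> on \<open>K\<close> from below. Every \<open>p\<close>
  in the ball of radius \<open>M\<close> is the gradient at a minimum point of
  \<open>w - p \<bullet> x\<close>; the hypothesis \<open>interior\<close> keeps these points
  away from the boundary of \<open>K\<close>, where the gradient need not be \<open>p\<close>.
\<close>
lemma abp_gradient_image:
  fixes w :: "real^'n::finite \<Rightarrow> real" and H :: "real^'n \<Rightarrow> real^'n^'n"
  assumes K: "compact K" "K \<noteq> {}" and W: "open W" "W \<subseteq> K"
    and wc: "continuous_on K w" and Gc: "continuous_on K G" and Hc: "continuous_on K H"
    and w: "\<And>x. x \<in> W \<Longrightarrow> (w has_derivative (\<lambda>v. G x \<bullet> v)) (at x)"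
    and G: "\<And>x. x \<in> W \<Longrightarrow> (G has_derivative (\<lambda>v. H x *v v)) (at x)"
    and sym: "\<And>x i j. x \<in> W \<Longrightarrow> H x $ i $ j = H x $ j $ i"
    and interior: "\<And>p x. norm p \<le> M \<Longrightarrow> x \<in> K \<Longrightarrow> (\<And>y. y \<in> K \<Longrightarrow> w x - p \<bullet> x \<le> w y - p \<bullet> y) \<Longrightarrow> x \<in> W"
    and f: "continuous_on UNIV f" "\<And>p. 0 \<le> f p"
  obtains S where "compact S" "S \<subseteq> W" "\<And>x. x \<in> S \<Longrightarrow> norm (G x) \<le> M"
    "\<And>x. x \<in> S \<Longrightarrow> psd (\<lambda>i j. H x $ i $ j)"
    "integral (cball 0 M) f \<le>
      integral S (\<lambda>x. fact CARD('n) * (\<Sum>k\<in>UNIV. H x $ k $ k) ^ CARD('n) * f (G x))"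
proof -
  define S where "S = {x \<in> K. norm (G x) \<le> M \<and> (\<forall>y\<in>K. w x - G x \<bullet> x \<le> w y - G x \<bullet> y)}"
  have "S = (\<Inter>y\<in>K. {x \<in> K. w x - G x \<bullet> x \<le> w y - G x \<bullet> y}) \<inter> {x \<in> K. norm (G x) \<le> M}"
    using K(2) by (auto simp: S_def)
  moreover have "closed {x \<in> K. w x - G x \<bullet> x \<le> w y - G x \<bullet> y}" for y
    using K(1) by (intro continuous_on_closed_Collect_le continuous_intros wc Gc compact_imp_closed)
  moreover have "closed {x \<in> K. norm (G x) \<le> M}"
    using K(1) by (intro continuous_on_closed_Collect_le continuous_intros Gc compact_imp_closed)
  ultimately have "closed S" by auto
  moreover have "S \<subseteq> K" by (auto simp: S_def)
  ultimately have S: "compact S" using K(1) by (metis compact_Int_closed inf.absorb_iff2 inf.commute)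
  have SW: "S \<subseteq> W"
  proof
    fix x assume "x \<in> S"
    then show "x \<in> W" using interior[of "G x" x] by (auto simp: S_def)
  qed
  have psd: "psd (\<lambda>i j. H x $ i $ j)" if "x \<in> S" for x
    unfolding psd_def
  proof (intro conjI allI)
    have xW: "x \<in> W" using that SW by blast
    show "H x $ i $ j = H x $ j $ i" for i j by (rule sym[OF xW])
    fix \<xi> :: "'n \<Rightarrow> real"
    have "0 \<le> vec_lambda \<xi> \<bullet> (H x *v vec_lambda \<xi>)"
    proof (rule hessian_nonneg_at_interior_min[OF W(1) xW w G[OF xW]])
      fix y assume "y \<in> W"
      then show "w x + G x \<bullet> (y - x) \<le> w y"
        using that W(2) by (auto simp: S_def inner_diff_right algebra_simps)
    qed
    then show "0 \<le> quad_form (\<lambda>i j. H x $ i $ j) \<xi>"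
      by (simp add: quad_form_def inner_vec_def matrix_vector_mult_def sum_distrib_left mult_ac)
  qed
  have img: "cball 0 M = G ` S"
  proof (rule set_eqI, rule iffI)
    fix p :: "real^'n" assume "p \<in> cball 0 M"
    then have p: "norm p \<le> M" by simp
    have "continuous_on K (\<lambda>x. w x - p \<bullet> x)" by (intro continuous_intros wc)
    then obtain x where x: "x \<in> K" "\<And>y. y \<in> K \<Longrightarrow> w x - p \<bullet> x \<le> w y - p \<bullet> y"
      using continuous_attains_inf[OF K] by blast
    have xW: "x \<in> W" using interior[OF p x] .
    have "((\<lambda>y. w y - p \<bullet> y) has_derivative (\<lambda>v. G x \<bullet> v - p \<bullet> v)) (at x)"
      using w[OF xW] by (auto intro!: derivative_eq_intros)
    then have "(\<lambda>v. G x \<bullet> v - p \<bullet> v) = (\<lambda>v. 0)"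
      by (rule differential_zero_maxmin[OF xW W(1)]) (use x(2) W(2) in blast)
    then have "(G x - p) \<bullet> (G x - p) = 0" by (metis inner_diff_left)
    then have "G x = p" by simp
    then show "p \<in> G ` S" using x p by (auto simp: S_def)
  qed (auto simp: S_def)
  have Hc': "continuous_on S H" using Hc \<open>S \<subseteq> K\<close> continuous_on_subset by blast
  have G': "(G has_derivative (\<lambda>v. H x *v v)) (at x within S)" if "x \<in> S" for x
    using G SW that has_derivative_at_withinI by blast
  show thesis
    using area_trace[OF S G' Hc' psd f] that[OF S SW _ psd] by (auto simp: img S_def)
qed

section \<open>A smooth kernel and its convolutions\<close>

text \<open>
  The derivatives of \<open>exp (- 1 / t)\<close>, extended by zero to
  \<open>t \<le> 0\<close>, are linear combinations of these functions.
\<close>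
definition exp_inv :: "nat \<Rightarrow> real \<Rightarrow> real" where
  "exp_inv m t = (if t > 0 then (1 / t) ^ m * exp (- (1 / t)) else 0)"

lemma exp_inv_nonneg: "0 \<le> exp_inv m t"
  by (simp add: exp_inv_def)

text \<open>
  At \<open>t = 0\<close> the difference quotient from the right is
  \<open>x\<^sup>m\<^sup>+\<^sup>1 / exp x\<close> with \<open>x = 1 / t\<close>, which tends
  to zero as \<open>x\<close> tends to infinity.
\<close>
lemma exp_inv_deriv:
  "(exp_inv m has_real_derivative exp_inv (m + 2) t - real m * exp_inv (Suc m) t) (at t)"
proof -
  consider "t > 0" | "t < 0" | "t = 0" by linarith
  then show ?thesis
  proof cases
    case 1
    have "((\<lambda>t. (1 / t) ^ m * exp (- (1 / t))) has_real_derivative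
        exp_inv (m + 2) t - real m * exp_inv (Suc m) t) (at t)"
    proof -
      have d: "((\<lambda>t. 1 / t) has_real_derivative - ((1 / t)\<^sup>2)) (at t)"
        using 1 by (auto intro!: derivative_eq_intros simp: power2_eq_square)
      have e: "((\<lambda>t. exp (- (1 / t))) has_real_derivative (1 / t)\<^sup>2 * exp (- (1 / t))) (at t)"
        by (rule derivative_eq_intros d refl)+ simp
      have p: "((\<lambda>t. (1 / t) ^ m) has_real_derivative - (real m * (1 / t) ^ Suc m)) (at t)"
      proof (cases m)
        case (Suc k)
        then show ?thesis
          using DERIV_power[OF d, of m] by (simp add: power2_eq_square mult_ac)
      qed simp
      show ?thesis
        using DERIV_mult[OF p e] 1 by (simp add: exp_inv_def algebra_simps power2_eq_square)
    qed
    moreover have "eventually (\<lambda>s. exp_inv m s = (1 / s) ^ m * exp (- (1 / s))) (nhds t)"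
      using eventually_nhds_in_open[of "{0<..}" t] 1
      by (auto elim!: eventually_mono simp: exp_inv_def)
    ultimately show ?thesis by (subst DERIV_cong_ev) auto
  next
    case 2
    have "eventually (\<lambda>s. exp_inv m s = 0) (nhds t)"
      using eventually_nhds_in_open[of "{..<0}" t] 2
      by (auto elim!: eventually_mono simp: exp_inv_def)
    then show ?thesis using 2 by (subst DERIV_cong_ev[OF refl _ refl]) (auto simp: exp_inv_def)
  next
    case 3
    have "((\<lambda>x::real. x ^ Suc m / exp x) \<longlongrightarrow> 0) at_top"
      by (rule tendsto_power_div_exp_0)
    then have "((\<lambda>t. inverse t ^ Suc m / exp (inverse t)) \<longlongrightarrow> (0::real)) (at_right 0)"
      by (rule filterlim_compose[OF _ filterlim_inverse_at_top_right])
    moreover have "eventually (\<lambda>t. inverse t ^ Suc m / exp (inverse t) = (exp_inv m (0 + t) - exp_inv m 0) / t) (at_right (0::real))"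
      using eventually_at_right_less[of "0::real"]
      by eventually_elim (simp add: exp_inv_def exp_minus divide_inverse mult_ac)
    ultimately have r: "((\<lambda>t. (exp_inv m (0 + t) - exp_inv m 0) / t) \<longlongrightarrow> 0) (at_right 0)"
      by (rule Lim_transform_eventually)
    have "eventually (\<lambda>t. 0 = (exp_inv m (0 + t) - exp_inv m 0) / t) (at_left (0::real))"
      by (auto simp: eventually_at_filter exp_inv_def)
    then have l: "((\<lambda>t. (exp_inv m (0 + t) - exp_inv m 0) / t) \<longlongrightarrow> 0) (at_left 0)"
      by (rule Lim_transform_eventually[OF tendsto_const])
    show ?thesis using filterlim_split_at_real[OF l r] 3
      by (simp add: DERIV_def exp_inv_def)
  qed
qed

text \<open>
  A space of functions that contains a bump supported in \<open>[-1, 1]\<close> and is closed under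
  differentiation. Membership replaces an explicit formula for the higher derivatives.
\<close>
inductive_set bump_span :: "(real \<Rightarrow> real) set" where
  base: "(\<lambda>t. exp_inv m (1 + t) * exp_inv l (1 - t)) \<in> bump_span"
| add: "f \<in> bump_span \<Longrightarrow> g \<in> bump_span \<Longrightarrow> (\<lambda>t. f t + g t) \<in> bump_span"
| scale: "f \<in> bump_span \<Longrightarrow> (\<lambda>t. c * f t) \<in> bump_span"

lemma bump_span_deriv:
  "f \<in> bump_span \<Longrightarrow> \<exists>f'\<in>bump_span. \<forall>t. (f has_real_derivative f' t) (at t)"
proof (induction rule: bump_span.induct)
  case (base m l)
  let ?f' = "\<lambda>t. (exp_inv (m + 2) (1 + t) * exp_inv l (1 - t)
      + - real m * (exp_inv (Suc m) (1 + t) * exp_inv l (1 - t)))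
      + (- 1 * (exp_inv m (1 + t) * exp_inv (l + 2) (1 - t))
      + real l * (exp_inv m (1 + t) * exp_inv (Suc l) (1 - t)))"
  have "?f' \<in> bump_span"
    by (intro bump_span.intros)
  moreover have "((\<lambda>t. exp_inv m (1 + t) * exp_inv l (1 - t)) has_real_derivative ?f' t) (at t)" for t
    by (rule derivative_eq_intros DERIV_chain2[OF exp_inv_deriv] refl)+ (simp add: algebra_simps)
  ultimately show ?case by (intro bexI[of _ ?f'] allI)
next
  case (add f g)
  then obtain f' g' where "f' \<in> bump_span" "\<And>t. (f has_real_derivative f' t) (at t)"
    "g' \<in> bump_span" "\<And>t. (g has_real_derivative g' t) (at t)" by blast
  then show ?case
    by (intro bexI[of _ "\<lambda>t. f' t + g' t"] allI DERIV_add bump_span.add) auto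
next
  case (scale f c)
  then obtain f' where "f' \<in> bump_span" "\<And>t. (f has_real_derivative f' t) (at t)" by blast
  then show ?case
    by (intro bexI[of _ "\<lambda>t. c * f' t"] allI DERIV_cmult bump_span.scale) auto
qed

lemma bump_span_support: "f \<in> bump_span \<Longrightarrow> 1 \<le> \<bar>t\<bar> \<Longrightarrow> f t = 0"
  by (induction rule: bump_span.induct) (auto simp: exp_inv_def abs_if split: if_splits)

lemma ex_bump_derivs:
  "\<exists>h :: nat \<Rightarrow> real \<Rightarrow> real. (\<forall>k t. (h k has_real_derivative h (Suc k) t) (at t)) \<and>
     (\<forall>k t. 1 \<le> \<bar>t\<bar> \<longrightarrow> h k t = 0) \<and> (\<forall>t. 0 \<le> h 0 t) \<and> 0 < h 0 0"
proof -
  let ?b = "\<lambda>t. exp_inv 0 (1 + t) * exp_inv 0 (1 - t)"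
  have "\<exists>h. \<forall>k. (h k \<in> bump_span \<and> (k = 0 \<longrightarrow> h k = ?b)) \<and> (\<forall>t. (h k has_real_derivative h (Suc k) t) (at t))"
  proof (rule dependent_nat_choice)
    show "\<exists>f. f \<in> bump_span \<and> (0 = 0 \<longrightarrow> f = ?b)" using bump_span.base by blast
    show "\<exists>g. (g \<in> bump_span \<and> (Suc k = 0 \<longrightarrow> g = ?b)) \<and> (\<forall>t. (f has_real_derivative g t) (at t))"
      if "f \<in> bump_span \<and> (k = 0 \<longrightarrow> f = ?b)" for f k
      using bump_span_deriv that by blast
  qed
  then obtain h where "\<And>k. h k \<in> bump_span" "h 0 = ?b" "\<And>k t. (h k has_real_derivative h (Suc k) t) (at t)"
    by blast
  then show ?thesis
    by (intro exI[of _ h]) (auto simp: bump_span_support exp_inv_nonneg, simp add: exp_inv_def)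
qed

definition bump_deriv :: "nat \<Rightarrow> real \<Rightarrow> real" where
  "bump_deriv = (SOME h. (\<forall>k t. (h k has_real_derivative h (Suc k) t) (at t)) \<and>
     (\<forall>k t. 1 \<le> \<bar>t\<bar> \<longrightarrow> h k t = 0) \<and> (\<forall>t. 0 \<le> h 0 t) \<and> 0 < h 0 0)"

lemma bump_deriv:
  "(bump_deriv k has_real_derivative bump_deriv (Suc k) t) (at t)"
  "1 \<le> \<bar>t\<bar> \<Longrightarrow> bump_deriv k t = 0" "0 \<le> bump_deriv 0 t" "0 < bump_deriv 0 0"
  using someI_ex[OF ex_bump_derivs] unfolding bump_deriv_def[symmetric] by blast+

text \<open>
  Up to a factor, the mixed partial derivative with multi-index \<open>k\<close> of a product of
  one-dimensional bumps in the rescaled variables \<open>s z\<^sub>i\<close>. Keeping the factor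
  \<open>c\<close> as a parameter makes the family closed under partial derivatives.
\<close>
definition kern :: "real \<Rightarrow> real \<Rightarrow> ('n::finite \<Rightarrow> nat) \<Rightarrow> real^'n \<Rightarrow> real" where
  "kern c s k z = c * (\<Prod>i\<in>UNIV. bump_deriv (k i) (s * z $ i))"

lemma kern_deriv:
  "(kern c s k has_derivative (\<lambda>v. \<Sum>j\<in>UNIV. kern (c * s) s (k(j := Suc (k j))) z * v $ j)) (at z)"
proof -
  have d: "((\<lambda>z. bump_deriv (k i) (s * z $ i)) has_derivative (\<lambda>v. bump_deriv (Suc (k i)) (s * z $ i) * (s * v $ i))) (at z)" for i
  proof -
    have "((\<lambda>z. s * z $ i) has_derivative (\<lambda>v. s * v $ i)) (at z)"
      by (intro has_derivative_mult_right bounded_linear.has_derivative[OF bounded_linear_vec_nth] has_derivative_ident)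
    from has_derivative_compose[OF this bump_deriv(1)[unfolded has_field_derivative_def]]
    show ?thesis .
  qed
  have e: "(\<Prod>i\<in>UNIV. bump_deriv ((k(j := Suc (k j))) i) (s * z $ i))
      = bump_deriv (Suc (k j)) (s * z $ j) * (\<Prod>i\<in>UNIV - {j}. bump_deriv (k i) (s * z $ i))" for j
    by (subst prod.remove[of _ j]) auto
  have "(kern c s k has_derivative (\<lambda>v. c * (\<Sum>j\<in>UNIV. bump_deriv (Suc (k j)) (s * z $ j) * (s * v $ j) *
      (\<Prod>i\<in>UNIV - {j}. bump_deriv (k i) (s * z $ i))))) (at z)"
    unfolding kern_def[abs_def]
    by (intro has_derivative_mult_right has_derivative_prod d)
  then show ?thesis
    by (rule has_derivative_eq_rhs) (simp only: kern_def e sum_distrib_left mult_ac)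
qed

lemma kern_support: "kern c s k z \<noteq> 0 \<Longrightarrow> s > 0 \<Longrightarrow> norm z \<le> real CARD('n) / s"
  for z :: "real^'n::finite"
proof -
  assume a: "kern c s k z \<noteq> 0" and s: "s > 0"
  have "\<bar>z $ i\<bar> \<le> 1 / s" for i
  proof (rule ccontr)
    assume "\<not> \<bar>z $ i\<bar> \<le> 1 / s"
    then have "1 \<le> \<bar>s * z $ i\<bar>" using s by (simp add: abs_mult field_simps)
    then have "bump_deriv (k i) (s * z $ i) = 0" by (rule bump_deriv(2))
    then show False using a by (auto simp: kern_def prod_zero)
  qed
  then have "(\<Sum>i\<in>UNIV. \<bar>z $ i\<bar>) \<le> (\<Sum>i\<in>(UNIV::'n set). 1 / s)" by (intro sum_mono)
  then show ?thesis using norm_le_l1_cart[of z] by simp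
qed

lemma kern_continuous: "continuous_on S (kern c s k)"
  by (auto intro!: continuous_at_imp_continuous_on has_derivative_continuous[OF kern_deriv])

lemma kern_measurable [measurable]: "kern c s k \<in> borel_measurable borel"
  using kern_continuous by (rule borel_measurable_continuous_onI)

lemma kern_bounded: 
  assumes "s > 0" shows "\<exists>B>0. \<forall>z. \<bar>kern c s k z\<bar> \<le> B"
proof -
  let ?C = "cball (0::real^'a) (real CARD('a) / s)"
  have "compact (kern c s k ` ?C)" by (intro compact_continuous_image kern_continuous compact_cball)
  then obtain B where B: "B > 0" "\<And>z. z \<in> ?C \<Longrightarrow> \<bar>kern c s k z\<bar> \<le> B"
    using compact_imp_bounded bounded_pos by (metis imageI real_norm_def)
  have "\<bar>kern c s k z\<bar> \<le> B" for z
  proof (cases "kern c s k z = 0")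
    case False
    then show ?thesis using B(2)[of z] kern_support[OF False assms] by simp
  qed (use B(1) in simp)
  then show ?thesis using B(1) by blast
qed

text \<open>
  The sign comes from the reflection \<open>y \<mapsto> x - y\<close>.
\<close>
lemma kern_test_partial:
  "partial_deriv j (\<lambda>y. kern c s k (x - y)) = (\<lambda>y. kern (- (c * s)) s (k(j := Suc (k j))) (x - y))"
proof
  fix y :: "real^'a"
  have "((\<lambda>y. x - y) has_derivative (\<lambda>v. - v)) (at y)" by (auto intro!: derivative_eq_intros)
  from has_derivative_compose[OF this kern_deriv[of c s k]]
  have "((\<lambda>y. kern c s k (x - y)) has_derivative
      (\<lambda>v. \<Sum>j\<in>UNIV. kern (c * s) s (k(j := Suc (k j))) (x - y) * (- v) $ j)) (at y)" .
  then have "frechet_derivative (\<lambda>y. kern c s k (x - y)) (at y) =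
      (\<lambda>v. \<Sum>j\<in>UNIV. kern (c * s) s (k(j := Suc (k j))) (x - y) * (- v) $ j)"
    by (rule frechet_derivative_at[symmetric])
  then have "partial_deriv j (\<lambda>y. kern c s k (x - y)) y
      = (\<Sum>i\<in>UNIV. kern (c * s) s (k(i := Suc (k i))) (x - y) * (- axis j 1) $ i)"
    by (simp add: partial_deriv_def)
  also have "\<dots> = (\<Sum>i\<in>UNIV. if i = j then - kern (c * s) s (k(j := Suc (k j))) (x - y) else 0)"
    by (intro sum.cong refl) (auto simp: axis_def)
  also have "\<dots> = kern (- (c * s)) s (k(j := Suc (k j))) (x - y)"
    by (simp add: kern_def)
  finally show "partial_deriv j (\<lambda>y. kern c s k (x - y)) y = kern (- (c * s)) s (k(j := Suc (k j))) (x - y)" .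
qed

lemma kern_test_function:
  fixes x :: "real^'n::finite"
  assumes s: "s > 0" and sub: "cball x (real CARD('n) / s) \<subseteq> \<Omega>"
  shows "test_function \<Omega> (\<lambda>y. kern c s k (x - y))"
proof -
  have it: "\<exists>c' k'. iter_partial ks (\<lambda>y. kern c s k (x - y)) = (\<lambda>y. kern c' s k' (x - y))" for ks
  proof (induction ks)
    case (Cons j ks)
    then obtain c' k' where "iter_partial ks (\<lambda>y. kern c s k (x - y)) = (\<lambda>y. kern c' s k' (x - y))"
      by blast
    then show ?case by (auto simp: kern_test_partial)
  qed auto
  have "(\<lambda>y. kern c' s k' (x - y)) differentiable_on UNIV" for c' k'
  proof -
    have "((\<lambda>y. x - y) has_derivative (\<lambda>v. - v)) (at y)" for y by (auto intro!: derivative_eq_intros)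
    from has_derivative_compose[OF this kern_deriv[of c' s k']]
    show ?thesis by (auto simp: differentiable_on_def differentiable_def)
  qed
  then have "smooth_on UNIV (\<lambda>y. kern c s k (x - y))"
    using it unfolding smooth_on_def by metis
  moreover have "{y. kern c s k (x - y) \<noteq> 0} \<subseteq> cball x (real CARD('n) / s)"
    using kern_support[OF _ s] by (auto simp: dist_norm)
  then have "closure {y. kern c s k (x - y) \<noteq> 0} \<subseteq> cball x (real CARD('n) / s)"
    by (rule closure_minimal) auto
  ultimately show ?thesis
    unfolding test_function_def using sub by (meson closed_closure compact_Int_closed compact_cball inf.absorb_iff2 order_trans bounded_subset compact_eq_bounded_closed bounded_cball)
qed

definition conv :: "(real^'n::finite \<Rightarrow> real) \<Rightarrow> (real^'n \<Rightarrow> real) \<Rightarrow> real^'n \<Rightarrow> real" where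
  "conv f K x = (\<integral>y. f y * K (x - y) \<partial>lebesgue)"

lemma conv_kern_integrable:
  assumes f: "integrable lebesgue f" and s: "s > 0"
  shows "integrable lebesgue (\<lambda>y. f y * kern c s k (x - y))"
proof -
  obtain B where B: "\<And>z. \<bar>kern c s k z\<bar> \<le> B" using kern_bounded[OF s] by blast
  have [measurable]: "f \<in> borel_measurable lebesgue" using f by auto
  have "(\<lambda>y. kern c s k (x - y)) \<in> borel_measurable borel" by measurable
  then have [measurable]: "(\<lambda>y. kern c s k (x - y)) \<in> borel_measurable lebesgue"
    by (simp add: measurable_completion)
  show ?thesis
  proof (rule Bochner_Integration.integrable_bound[of _ "\<lambda>y. B * f y"])
    show "AE y in lebesgue. norm (f y * kern c s k (x - y)) \<le> norm (B * f y)"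
    proof (rule AE_I2)
      fix y
      have "\<bar>f y\<bar> * \<bar>kern c s k (x - y)\<bar> \<le> \<bar>f y\<bar> * \<bar>B\<bar>"
        by (rule mult_left_mono) (use B[of "x - y"] in auto)
      then show "norm (f y * kern c s k (x - y)) \<le> norm (B * f y)"
        by (simp add: abs_mult mult.commute)
    qed
  qed (use f in auto)
qed

text \<open>
  Second derivatives of the kernel are bounded because they are continuous with compact support.
\<close>
lemma kern_linearization:
  fixes z v :: "real^'n::finite"
  assumes s: "s > 0"
  shows "\<exists>B\<ge>0. \<forall>z v::real^'n. \<bar>kern c s k (z + v) - kern c s k z - (\<Sum>j\<in>UNIV. kern (c * s) s (k(j := Suc (k j))) z * v $ j)\<bar>
     \<le> B * (norm v)\<^sup>2"
proof -
  let ?D = "\<lambda>j. kern (c * s) s (k(j := Suc (k j))) :: real^'n \<Rightarrow> real"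
  let ?D2 = "\<lambda>i j. kern (c * s * s) s ((k(j := Suc (k j)))(i := Suc ((k(j := Suc (k j))) i))) :: real^'n \<Rightarrow> real"
  define B where "B = (\<lambda>i j. SOME B. B > 0 \<and> (\<forall>z. \<bar>?D2 i j z\<bar> \<le> B))"
  have "B i j > 0 \<and> (\<forall>z. \<bar>?D2 i j z\<bar> \<le> B i j)" for i j
    unfolding B_def by (rule someI_ex[OF kern_bounded[OF s]])
  then have B: "B i j > 0" "\<bar>?D2 i j z\<bar> \<le> B i j" for i j z
    by blast+
  define L where "L = (\<lambda>j. \<Sum>i\<in>UNIV. B i j)"
  have lin: "linear (\<lambda>v. \<Sum>i\<in>UNIV. a i * v $ i)" for a :: "'n \<Rightarrow> real"
    by (auto simp: linear_iff algebra_simps sum.distrib sum_distrib_left)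
  have lip: "\<bar>?D j z - ?D j z'\<bar> \<le> L j * norm (z - z')" for j z z'
  proof -
    have "norm (?D j z - ?D j z') \<le> L j * norm (z - z')"
    proof (rule differentiable_bound[OF convex_UNIV _ _ UNIV_I UNIV_I])
      fix x :: "real^'n"
      let ?f' = "\<lambda>v. \<Sum>i\<in>UNIV. ?D2 i j x * v $ i"
      show "(?D j has_derivative ?f') (at x)" by (rule kern_deriv)
      show "onorm ?f' \<le> L j"
      proof (rule onorm_le)
        fix v :: "real^'n"
        have "norm (?f' v) \<le> (\<Sum>i\<in>UNIV. B i j * norm v)"
          by (intro sum_norm_le, unfold real_norm_def abs_mult)
             (intro mult_mono B(2) component_le_norm_cart abs_ge_zero less_imp_le[OF B(1)])
        then show "norm (?f' v) \<le> L j * norm v" by (simp add: L_def sum_distrib_right)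
      qed
    qed
    then show ?thesis by simp
  qed
  have Lnn: "L j \<ge> 0" for j unfolding L_def by (intro sum_nonneg less_imp_le[OF B(1)])
  show ?thesis
  proof (intro exI[of _ "\<Sum>j\<in>UNIV. L j"] conjI allI)
    show "(\<Sum>j\<in>UNIV. L j) \<ge> 0" by (intro sum_nonneg Lnn)
    fix z v :: "real^'n"
    let ?f' = "\<lambda>x v. \<Sum>j\<in>UNIV. ?D j x * v $ j"
    have "norm (kern c s k (z + v) - kern c s k z - ?f' z ((z + v) - z)) \<le> norm ((z + v) - z) * ((\<Sum>j\<in>UNIV. L j) * norm v)"
    proof (rule differentiable_bound_linearization[where S = "closed_segment z (z + v)"])
      show "z + t *\<^sub>R (z + v - z) \<in> closed_segment z (z + v)" if "t \<in> {0..1}" for t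
        using that by (auto simp: in_segment algebra_simps intro!: exI[of _ t])
      show "(kern c s k has_derivative ?f' x) (at x within closed_segment z (z + v))" for x
        by (rule has_derivative_at_withinI[OF kern_deriv])
      show "onorm (?f' x - ?f' z) \<le> (\<Sum>j\<in>UNIV. L j) * norm v" if x: "x \<in> closed_segment z (z + v)" for x
        unfolding fun_diff_def
      proof (rule onorm_le)
        fix u :: "real^'n"
        have xz: "norm (x - z) \<le> norm v"
          using segment_bound(1)[OF x] by (simp add: norm_minus_commute)
        have "norm (?f' x u - ?f' z u) = norm (\<Sum>j\<in>UNIV. (?D j x - ?D j z) * u $ j)"
          by (simp add: sum_subtractf left_diff_distrib)
        also have "\<dots> \<le> (\<Sum>j\<in>UNIV. (L j * norm v) * norm u)"
          by (intro sum_norm_le, unfold real_norm_def abs_mult)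
             (intro mult_mono order_trans[OF lip] mult_left_mono[OF xz] component_le_norm_cart abs_ge_zero
                mult_nonneg_nonneg Lnn norm_ge_zero)
        finally show "norm (?f' x u - ?f' z u) \<le> (\<Sum>j\<in>UNIV. L j) * norm v * norm u"
          by (simp add: sum_distrib_right)
      qed
    qed auto
    then show "\<bar>kern c s k (z + v) - kern c s k z - ?f' z v\<bar> \<le> (\<Sum>j\<in>UNIV. L j) * (norm v)\<^sup>2"
      by (simp add: power2_eq_square mult_ac)
  qed
qed

text \<open>
  Differentiation under the integral sign: the linearization error of the kernel is quadratic
  uniformly in its argument, so it survives integration against an integrable function.
\<close>
lemma conv_kern_deriv:
  assumes f: "integrable lebesgue f" and s: "s > 0"
  shows "(conv f (kern c s k) has_derivative
     (\<lambda>v. \<Sum>j\<in>UNIV. conv f (kern (c * s) s (k(j := Suc (k j)))) x * v $ j)) (at x)"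
proof -
  let ?D = "\<lambda>j. kern (c * s) s (k(j := Suc (k j)))"
  obtain B where B: "B \<ge> 0" "\<And>z v. \<bar>kern c s k (z + v) - kern c s k z - (\<Sum>j\<in>UNIV. ?D j z * v $ j)\<bar> \<le> B * (norm v)\<^sup>2"
    using kern_linearization[OF s, of c k] by blast
  define N where "N = (\<integral>y. \<bar>f y\<bar> \<partial>lebesgue)"
  have int: "integrable lebesgue (\<lambda>y. f y * kern c' s k' (x - y))" for c' k' x
    by (rule conv_kern_integrable[OF f s])
  have est: "\<bar>conv f (kern c s k) (x + v) - conv f (kern c s k) x - (\<Sum>j\<in>UNIV. conv f (?D j) x * v $ j)\<bar>
     \<le> N * (B * (norm v)\<^sup>2)" for v
  proof -
    let ?R = "\<lambda>y. f y * (kern c s k ((x - y) + v) - kern c s k (x - y) - (\<Sum>j\<in>UNIV. ?D j (x - y) * v $ j))"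
    have eq: "?R y = f y * kern c s k ((x + v) - y) - f y * kern c s k (x - y) - (\<Sum>j\<in>UNIV. (f y * ?D j (x - y)) * v $ j)" for y
      by (simp add: algebra_simps sum_distrib_left)
    have iR: "integrable lebesgue ?R"
      unfolding eq by (intro Bochner_Integration.integrable_diff Bochner_Integration.integrable_sum int integrable_mult_left)
    have E: "conv f (kern c s k) (x + v) - conv f (kern c s k) x - (\<Sum>j\<in>UNIV. conv f (?D j) x * v $ j) = (\<integral>y. ?R y \<partial>lebesgue)"
      unfolding eq conv_def
      by (subst Bochner_Integration.integral_diff Bochner_Integration.integral_sum
          | intro Bochner_Integration.integrable_diff Bochner_Integration.integrable_sum int integrable_mult_left
          | simp)+
    have "\<bar>\<integral>y. ?R y \<partial>lebesgue\<bar> \<le> (\<integral>y. \<bar>?R y\<bar> \<partial>lebesgue)"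
      by (rule integral_abs_bound)
    also have "\<dots> \<le> (\<integral>y. \<bar>f y\<bar> * (B * (norm v)\<^sup>2) \<partial>lebesgue)"
    proof (rule integral_mono)
      show "integrable lebesgue (\<lambda>y. \<bar>?R y\<bar>)" using iR by (rule integrable_abs)
      show "integrable lebesgue (\<lambda>y. \<bar>f y\<bar> * (B * (norm v)\<^sup>2))" using f by simp
      show "\<bar>?R y\<bar> \<le> \<bar>f y\<bar> * (B * (norm v)\<^sup>2)" for y
        unfolding abs_mult by (rule mult_left_mono[OF B(2) abs_ge_zero])
    qed
    also have "\<dots> = N * (B * (norm v)\<^sup>2)" by (simp add: N_def)
    finally show ?thesis unfolding E .
  qed
  show ?thesis
  proof (rule has_derivativeI_sandwich[of 1])
    show "bounded_linear (\<lambda>v. \<Sum>j\<in>UNIV. conv f (?D j) x * v $ j)"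
      by (auto simp: linear_conv_bounded_linear[symmetric] linear_iff algebra_simps sum.distrib sum_distrib_left)
    show "norm (conv f (kern c s k) y - conv f (kern c s k) x - (\<Sum>j\<in>UNIV. conv f (?D j) x * (y - x) $ j)) / norm (y - x)
      \<le> N * B * norm (y - x)" if "y \<noteq> x" for y
      using est[of "y - x"] that by (simp add: divide_le_eq power2_eq_square mult_ac)
    show "((\<lambda>y. N * B * norm (y - x)) \<longlongrightarrow> 0) (at x)"
      by (auto intro!: tendsto_eq_intros)
  qed auto
qed

section \<open>Mollification contracts the Lebesgue norms\<close>

lemma nn_integral_lborel_affine:
  fixes f :: "'a::euclidean_space \<Rightarrow> ennreal"
  assumes [measurable]: "f \<in> borel_measurable borel" and c: "c \<noteq> 0"
  shows "(\<integral>\<^sup>+x. f x \<partial>lborel) = ennreal (\<bar>c\<bar> ^ DIM('a)) * (\<integral>\<^sup>+x. f (t + c *\<^sub>R x) \<partial>lborel)"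
  by (subst lborel_affine[OF c, of t])
     (simp add: nn_integral_density nn_integral_distr nn_integral_cmult)

lemma nn_integral_lborel_reflect:
  fixes f :: "'a::euclidean_space \<Rightarrow> ennreal"
  assumes "f \<in> borel_measurable borel"
  shows "(\<integral>\<^sup>+x. f (t - x) \<partial>lborel) = (\<integral>\<^sup>+x. f x \<partial>lborel)"
  using nn_integral_lborel_affine[OF assms, of "-1" t] by simp

text \<open>
  The kernel with total mass one, concentrated on a neighbourhood of the origin of size
  \<open>1 / s\<close>; thus \<open>s\<close> tends to infinity where one usually lets the radius
  tend to zero.
\<close>
definition mollifier :: "real \<Rightarrow> real^'n::finite \<Rightarrow> real" where
  "mollifier s = kern (s ^ CARD('n) / (\<integral>z. kern 1 1 (\<lambda>_. 0) (z::real^'n) \<partial>lborel)) s (\<lambda>_. 0)"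

text \<open>
  The total mass is positive because the bump is continuous, nonnegative and positive at the origin.
\<close>
lemma kern_unit_mass:
  "integrable lborel (kern 1 1 (\<lambda>_. 0) :: real^'n::finite \<Rightarrow> real)"
  "(\<integral>z. kern 1 1 (\<lambda>_. 0) (z::real^'n::finite) \<partial>lborel) > 0"
  "0 \<le> kern 1 1 (\<lambda>_. 0) (z::real^'n::finite)"
proof -
  let ?k = "kern 1 1 (\<lambda>_. 0) :: real^'n \<Rightarrow> real"
  let ?C = "cball (0::real^'n) (real CARD('n))"
  show nn: "0 \<le> ?k z" for z
    by (simp add: kern_def prod_nonneg bump_deriv(3))
  have "integrable lborel (\<lambda>z. indicator ?C z *\<^sub>R ?k z)"
    by (intro borel_integrable_compact kern_continuous) auto
  moreover have "(\<lambda>z. indicator ?C z *\<^sub>R ?k z) = ?k"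
    using kern_support[of 1 1 "\<lambda>_. 0"] by (force simp: indicator_def)
  ultimately show int: "integrable lborel ?k" by metis
  show "(\<integral>z. ?k z \<partial>lborel) > 0"
  proof (rule ccontr)
    assume "\<not> (\<integral>z. ?k z \<partial>lborel) > 0"
    then have "(\<integral>z. ?k z \<partial>lborel) = 0"
      using integral_nonneg_AE[of ?k lborel] nn by (simp add: eq_iff)
    then have "AE z in lborel. ?k z = 0"
      using integral_nonneg_eq_0_iff_AE[OF int] nn by simp
    then have "AE z\<in>UNIV in lebesgue. z \<in> {z. ?k z = 0}"
      by (simp add: AE_completion)
    moreover have "closed {z. ?k z = 0}"
      by (intro closed_Collect_eq kern_continuous continuous_intros)
    ultimately have "(0::real^'n) \<in> {z. ?k z = 0}"
      using mem_closed_if_AE_lebesgue_open[OF open_UNIV] by blast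
    then show False using bump_deriv(4) by (simp add: kern_def)
  qed
qed

lemma mollifier_nonneg: "s > 0 \<Longrightarrow> 0 \<le> mollifier s z"
  using kern_unit_mass(2)[where 'n='a] by (simp add: mollifier_def kern_def prod_nonneg bump_deriv(3))

lemma mollifier_measurable [measurable]: "mollifier s \<in> borel_measurable borel"
  by (simp add: mollifier_def)

lemma nn_integral_mollifier:
  assumes s: "s > 0"
  shows "(\<integral>\<^sup>+z. ennreal (mollifier s (z::real^'n::finite)) \<partial>lborel) = 1"
proof -
  let ?k = "kern 1 1 (\<lambda>_. 0) :: real^'n \<Rightarrow> real"
  let ?I = "\<integral>z. ?k z \<partial>lborel"
  have I: "(\<integral>\<^sup>+z. ennreal (?k z) \<partial>lborel) = ennreal ?I"
    using kern_unit_mass(1,3) by (subst nn_integral_eq_integral) auto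
  have "mollifier s z = (s ^ CARD('n) / ?I) * ?k (s *\<^sub>R z)" for z :: "real^'n"
    by (simp add: mollifier_def kern_def)
  then have "(\<integral>\<^sup>+z. ennreal (mollifier s (z::real^'n)) \<partial>lborel)
     = (\<integral>\<^sup>+z. ennreal (1 / ?I) * (ennreal (s ^ CARD('n)) * ennreal (?k (0 + s *\<^sub>R z))) \<partial>lborel)"
    using s kern_unit_mass(2)[where 'n='n] kern_unit_mass(3)[where 'n='n]
    by (intro nn_integral_cong) (simp add: ennreal_mult[symmetric])
  also have "\<dots> = ennreal (1 / ?I) * (ennreal (s ^ CARD('n)) * (\<integral>\<^sup>+z. ennreal (?k (0 + s *\<^sub>R z)) \<partial>lborel))"
    by (simp add: nn_integral_cmult)
  also have "ennreal (s ^ CARD('n)) * (\<integral>\<^sup>+z. ennreal (?k (0 + s *\<^sub>R z)) \<partial>lborel) = ennreal ?I"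
    using nn_integral_lborel_affine[of "\<lambda>z. ennreal (?k z)" s 0] s I by simp
  also have "ennreal (1 / ?I) * ennreal ?I = 1"
    using kern_unit_mass(2)[where 'n='n] by (simp add: ennreal_mult[symmetric])
  finally show ?thesis .
qed

lemma mollifier_translate:
  fixes x :: "real^'n::finite"
  assumes s: "s > 0"
  shows "integrable lebesgue (\<lambda>y. mollifier s (x - y))" "(\<integral>y. mollifier s (x - y) \<partial>lebesgue) = 1"
proof -
  have n: "(\<integral>\<^sup>+y. ennreal (mollifier s (x - y)) \<partial>lborel) = 1"
    using nn_integral_lborel_reflect[of "\<lambda>z. ennreal (mollifier s z)" x] nn_integral_mollifier[OF s] by simp
  have i: "integrable lborel (\<lambda>y. mollifier s (x - y))"
    by (rule integrableI_nonneg) (use n mollifier_nonneg[OF s] in auto)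
  then show "integrable lebesgue (\<lambda>y. mollifier s (x - y))"
    by (subst integrable_completion) auto
  have "(\<integral>y. mollifier s (x - y) \<partial>lborel) = 1"
    using i n mollifier_nonneg[OF s] by (subst integral_eq_nn_integral) auto
  then show "(\<integral>y. mollifier s (x - y) \<partial>lebesgue) = 1"
    by (subst integral_completion) auto
qed

lemma mollifier_support: "mollifier s z \<noteq> 0 \<Longrightarrow> s > 0 \<Longrightarrow> norm z \<le> real CARD('n) / s"
  for z :: "real^'n::finite"
  unfolding mollifier_def by (rule kern_support)

lemma conv_mollifier_integrable:
  "integrable lebesgue f \<Longrightarrow> s > 0 \<Longrightarrow> integrable lebesgue (\<lambda>y. f y * mollifier s (x - y))"
  unfolding mollifier_def by (rule conv_kern_integrable)

lemma conv_mollifier_continuous: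
  assumes "integrable lebesgue f" "s > 0"
  shows "continuous_on S (conv f (mollifier s))"
  unfolding mollifier_def
  by (auto intro!: continuous_at_imp_continuous_on has_derivative_continuous[OF conv_kern_deriv] assms)

text \<open>
  The mollification at \<open>x\<close> is an average of the values of \<open>f\<close> over the
  support of the translated kernel.
\<close>
lemma conv_mollifier_close:
  fixes x :: "real^'n::finite"
  assumes f: "integrable lebesgue f" and s: "s > 0"
    and close: "\<And>y. norm (x - y) \<le> real CARD('n) / s \<Longrightarrow> \<bar>f y - f x\<bar> \<le> \<eta>"
  shows "\<bar>conv f (mollifier s) x - f x\<bar> \<le> \<eta>"
proof -
  have i: "integrable lebesgue (\<lambda>y. f y * mollifier s (x - y) - f x * mollifier s (x - y))"
    by (intro Bochner_Integration.integrable_diff conv_mollifier_integrable f s integrable_mult_right mollifier_translate)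
  have "conv f (mollifier s) x - f x = (\<integral>y. f y * mollifier s (x - y) - f x * mollifier s (x - y) \<partial>lebesgue)"
    unfolding conv_def
    by (subst Bochner_Integration.integral_diff)
      (auto intro!: conv_mollifier_integrable f s integrable_mult_right mollifier_translate simp: mollifier_translate[OF s])
  moreover have "\<bar>\<integral>y. f y * mollifier s (x - y) - f x * mollifier s (x - y) \<partial>lebesgue\<bar>
      \<le> (\<integral>y. \<bar>f y * mollifier s (x - y) - f x * mollifier s (x - y)\<bar> \<partial>lebesgue)"
    by (rule integral_abs_bound)
  moreover have "\<dots> \<le> (\<integral>y. \<eta> * mollifier s (x - y) \<partial>lebesgue)"
  proof (rule integral_mono)
    show "\<bar>f y * mollifier s (x - y) - f x * mollifier s (x - y)\<bar> \<le> \<eta> * mollifier s (x - y)" for y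
    proof (cases "mollifier s (x - y) = 0")
      case False
      then have "\<bar>f y - f x\<bar> \<le> \<eta>" by (intro close mollifier_support s)
      then have "\<bar>f y - f x\<bar> * mollifier s (x - y) \<le> \<eta> * mollifier s (x - y)"
        by (intro mult_right_mono mollifier_nonneg s)
      then show ?thesis
        using mollifier_nonneg[OF s, of "x - y"] by (simp add: left_diff_distrib[symmetric] abs_mult)
    qed simp
  qed (use i in \<open>auto intro!: integrable_mult_right mollifier_translate s\<close>)
  moreover have "(\<integral>y. \<eta> * mollifier s (x - y) \<partial>lebesgue) = \<eta>"
    by (simp add: mollifier_translate[OF s])
  ultimately show ?thesis by linarith
qed

text \<open>
  Convexity: the graph of \<open>t\<^sup>N\<close> lies above its tangent at \<open>a\<close>.
\<close>
lemma power_tangent_le: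
  fixes a t :: real
  assumes "0 \<le> a" "0 \<le> t"
  shows "a ^ N + real N * a ^ (N - 1) * (t - a) \<le> t ^ N"
proof (induction N)
  case (Suc N)
  show ?case
  proof (cases N)
    case (Suc m)
    have "a ^ Suc N + real (Suc N) * a ^ N * (t - a) = t * (a ^ N + real N * a ^ m * (t - a)) - real N * a ^ m * (t - a)\<^sup>2"
      unfolding Suc by (simp add: algebra_simps power2_eq_square)
    also have "\<dots> \<le> t * (a ^ N + real N * a ^ m * (t - a))" using assms by simp
    also have "\<dots> \<le> t * t ^ N" using Suc.IH Suc assms by (intro mult_left_mono) auto
    finally show ?thesis by simp
  qed simp
qed simp

text \<open>
  The inequality of Jensen for the averaging with respect to the mollifier: integrate the tangent
  inequality at the mean \<open>a\<close> of \<open>|f|\<close>.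
\<close>
lemma conv_power_le_borel:
  fixes f :: "real^'n::finite \<Rightarrow> real"
  assumes f: "integrable lborel f" and s: "s > 0"
  shows "ennreal (\<bar>conv f (mollifier s) x\<bar> ^ N) \<le> (\<integral>\<^sup>+y. ennreal (\<bar>f y\<bar> ^ N * mollifier s (x - y)) \<partial>lborel)"
proof (cases "(\<integral>\<^sup>+y. ennreal (\<bar>f y\<bar> ^ N * mollifier s (x - y)) \<partial>lborel) < \<infinity>")
  case True
  have [measurable]: "f \<in> borel_measurable borel" using f by auto
  let ?m = "\<lambda>y. mollifier s (x - y)"
  have m0: "0 \<le> ?m y" for y by (rule mollifier_nonneg[OF s])
  have fl: "integrable lebesgue f" using f by (subst integrable_completion) auto
  have m1: "integrable lborel ?m" "(\<integral>y. ?m y \<partial>lborel) = 1"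
    using mollifier_translate[OF s, of x] by (simp_all add: integrable_completion integral_completion)
  have i1: "integrable lborel (\<lambda>y. \<bar>f y\<bar> * ?m y)"
    using conv_mollifier_integrable[OF integrable_abs[OF fl] s, of x] by (subst (asm) integrable_completion) auto
  define a where "a = (\<integral>y. \<bar>f y\<bar> * ?m y \<partial>lborel)"
  have a0: "a \<ge> 0" unfolding a_def by (intro integral_nonneg_AE AE_I2 mult_nonneg_nonneg m0) auto
  have "conv f (mollifier s) x = (\<integral>y. f y * ?m y \<partial>lborel)"
    unfolding conv_def by (rule integral_completion) auto
  moreover have "\<bar>\<integral>y. f y * ?m y \<partial>lborel\<bar> \<le> (\<integral>y. \<bar>f y * ?m y\<bar> \<partial>lborel)"
    by (rule integral_abs_bound)
  moreover have "\<bar>f y * ?m y\<bar> = \<bar>f y\<bar> * ?m y" for y using m0[of y] by (simp add: abs_mult)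
  ultimately have "\<bar>conv f (mollifier s) x\<bar> \<le> a" unfolding a_def by simp
  then have 1: "\<bar>conv f (mollifier s) x\<bar> ^ N \<le> a ^ N" by (intro power_mono) auto
  have iN: "integrable lborel (\<lambda>y. \<bar>f y\<bar> ^ N * ?m y)"
    by (rule integrableI_nonneg) (use True m0 in auto)
  have "a ^ N = (\<integral>y. (a ^ N - real N * a ^ (N - 1) * a) * ?m y + real N * a ^ (N - 1) * (\<bar>f y\<bar> * ?m y) \<partial>lborel)"
    by (subst Bochner_Integration.integral_add) (auto simp: m1 i1 a_def[symmetric])
  also have "\<dots> \<le> (\<integral>y. \<bar>f y\<bar> ^ N * ?m y \<partial>lborel)"
  proof (rule integral_mono[OF _ iN])
    fix y
    have "(a ^ N + real N * a ^ (N - 1) * (\<bar>f y\<bar> - a)) * ?m y \<le> \<bar>f y\<bar> ^ N * ?m y"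
      by (intro mult_right_mono power_tangent_le a0 m0) auto
    then show "(a ^ N - real N * a ^ (N - 1) * a) * ?m y + real N * a ^ (N - 1) * (\<bar>f y\<bar> * ?m y) \<le> \<bar>f y\<bar> ^ N * ?m y"
      by (simp add: algebra_simps)
  qed (auto simp: m1 i1)
  finally have "\<bar>conv f (mollifier s) x\<bar> ^ N \<le> (\<integral>y. \<bar>f y\<bar> ^ N * ?m y \<partial>lborel)" using 1 by simp
  then have "ennreal (\<bar>conv f (mollifier s) x\<bar> ^ N) \<le> ennreal (\<integral>y. \<bar>f y\<bar> ^ N * ?m y \<partial>lborel)"
    by (rule ennreal_leI)
  also have "\<dots> = (\<integral>\<^sup>+y. ennreal (\<bar>f y\<bar> ^ N * ?m y) \<partial>lborel)"
    using iN m0 by (intro nn_integral_eq_integral[symmetric]) auto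
  finally show ?thesis .
qed (simp add: less_top[symmetric])

text \<open>
  Integrate the inequality of Jensen over \<open>x\<close> and exchange the integrals. The exchange
  needs a Borel function, so \<open>f\<close> is first replaced by a Borel function that agrees with
  it almost everywhere.
\<close>
lemma conv_Lp_contraction:
  fixes f :: "real^'n::finite \<Rightarrow> real"
  assumes f: "integrable lebesgue f" and s: "s > 0"
  shows "(\<integral>\<^sup>+x. ennreal (\<bar>conv f (mollifier s) x\<bar> ^ N) \<partial>lebesgue) \<le> (\<integral>\<^sup>+x. ennreal (\<bar>f x\<bar> ^ N) \<partial>lebesgue)"
proof -
  obtain g where g: "g \<in> borel_measurable lborel" "AE x in lborel. f x = g x"
    using completion_ex_borel_measurable_real[of f lborel] f by auto
  have [measurable]: "g \<in> borel_measurable borel" using g(1) by simp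
  have ae: "AE x in lebesgue. f x = g x" using g(2) by (rule AE_completion)
  have [measurable]: "f \<in> borel_measurable lebesgue" using f by auto
  have [measurable]: "g \<in> borel_measurable lebesgue" by (simp add: measurable_completion)
  have mm: "(\<lambda>y. mollifier s (x - y)) \<in> borel_measurable lebesgue" for x
    using mollifier_translate(1)[OF s, of x] by auto
  have gl: "integrable lebesgue g" using f ae by (subst integrable_cong_AE[symmetric, of f]) auto
  then have gi: "integrable lborel g" by (subst (asm) integrable_completion) auto
  have cg: "conv f (mollifier s) x = conv g (mollifier s) x" for x
    unfolding conv_def using ae mm[of x] by (intro integral_cong_AE) auto
  have [measurable]: "conv g (mollifier s) \<in> borel_measurable borel"
    by (rule borel_measurable_continuous_onI[OF conv_mollifier_continuous[OF gl s]])
  have "(\<integral>\<^sup>+x. ennreal (\<bar>conv f (mollifier s) x\<bar> ^ N) \<partial>lebesgue) = (\<integral>\<^sup>+x. ennreal (\<bar>conv g (mollifier s) x\<bar> ^ N) \<partial>lborel)"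
    by (simp add: cg nn_integral_completion)
  also have "\<dots> \<le> (\<integral>\<^sup>+x. (\<integral>\<^sup>+y. ennreal (\<bar>g y\<bar> ^ N * mollifier s (x - y)) \<partial>lborel) \<partial>lborel)"
    by (intro nn_integral_mono conv_power_le_borel gi s)
  also have "\<dots> = (\<integral>\<^sup>+y. (\<integral>\<^sup>+x. ennreal (\<bar>g y\<bar> ^ N * mollifier s (x - y)) \<partial>lborel) \<partial>lborel)"
    by (rule lborel_pair.Fubini'[symmetric]) simp
  also have "\<dots> = (\<integral>\<^sup>+y. ennreal (\<bar>g y\<bar> ^ N) \<partial>lborel)"
  proof (rule nn_integral_cong)
    fix y :: "real^'n"
    have "(\<integral>\<^sup>+x. ennreal (\<bar>g y\<bar> ^ N * mollifier s (x - y)) \<partial>lborel)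
       = ennreal (\<bar>g y\<bar> ^ N) * (\<integral>\<^sup>+x. ennreal (mollifier s (- y + 1 *\<^sub>R x)) \<partial>lborel)"
      by (subst nn_integral_cmult[symmetric]) (auto simp: ennreal_mult' mollifier_nonneg[OF s])
    also have "(\<integral>\<^sup>+x. ennreal (mollifier s (- y + 1 *\<^sub>R x)) \<partial>lborel) = 1"
      using nn_integral_lborel_affine[of "\<lambda>z. ennreal (mollifier s z)" 1 "- y", unfolded nn_integral_mollifier[OF s]]
      by (simp add: eq_commute[of 1])
    finally show "(\<integral>\<^sup>+x. ennreal (\<bar>g y\<bar> ^ N * mollifier s (x - y)) \<partial>lborel) = ennreal (\<bar>g y\<bar> ^ N)" by simp
  qed
  also have "\<dots> = (\<integral>\<^sup>+y. ennreal (\<bar>g y\<bar> ^ N) \<partial>lebesgue)"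
    by (rule nn_integral_completion[symmetric])
  also have "\<dots> = (\<integral>\<^sup>+y. ennreal (\<bar>f y\<bar> ^ N) \<partial>lebesgue)"
    using ae by (intro nn_integral_cong_AE) auto
  finally show ?thesis .
qed

section \<open>Convergence of mollifications\<close>

lemma power_add3_le:
  fixes a b c :: real
  assumes "0 \<le> a" "0 \<le> b" "0 \<le> c"
  shows "(a + b + c) ^ N \<le> 3 ^ N * (a ^ N + b ^ N + c ^ N)"
proof -
  let ?m = "max a (max b c)"
  have "(a + b + c) ^ N \<le> (3 * ?m) ^ N" using assms by (intro power_mono) auto
  also have "\<dots> = 3 ^ N * ?m ^ N" by (simp add: power_mult_distrib)
  also have "?m ^ N \<le> a ^ N + b ^ N + c ^ N" using assms by (auto simp: max_def)
  finally show ?thesis by simp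
qed

lemma Lp_dominated_convergence:
  fixes u :: "nat \<Rightarrow> 'a \<Rightarrow> real"
  assumes m: "\<And>k. u k \<in> borel_measurable M" and w: "integrable M w"
    and le: "\<And>k. AE x in M. \<bar>u k x\<bar> ^ N \<le> w x" and lim: "AE x in M. (\<lambda>k. u k x) \<longlonglongrightarrow> 0"
    and N: "N \<ge> 1" and d: "\<delta> > 0"
  shows "\<exists>k. (\<integral>\<^sup>+x. ennreal (\<bar>u k x\<bar> ^ N) \<partial>M) \<le> ennreal \<delta>"
proof -
  note [measurable] = m
  have int: "integrable M (\<lambda>x. \<bar>u k x\<bar> ^ N)" for k
    using le[of k] by (intro Bochner_Integration.integrable_bound[OF w]) (auto elim!: eventually_mono)
  have "(\<lambda>k. \<integral>x. \<bar>u k x\<bar> ^ N \<partial>M) \<longlonglongrightarrow> (\<integral>x. 0 \<partial>M)"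
  proof (rule integral_dominated_convergence[OF _ _ w])
    show "AE x in M. (\<lambda>k. \<bar>u k x\<bar> ^ N) \<longlonglongrightarrow> 0"
      using lim by eventually_elim (use N in \<open>auto intro!: tendsto_eq_intros simp: power_0_left\<close>)
    show "AE x in M. norm (\<bar>u k x\<bar> ^ N) \<le> w x" for k using le[of k] by simp
  qed auto
  then have "eventually (\<lambda>k. (\<integral>x. \<bar>u k x\<bar> ^ N \<partial>M) < \<delta>) sequentially"
    using d by (intro order_tendstoD) auto
  then obtain k where "(\<integral>x. \<bar>u k x\<bar> ^ N \<partial>M) < \<delta>" by (auto simp: eventually_sequentially)
  then have "(\<integral>\<^sup>+x. ennreal (\<bar>u k x\<bar> ^ N) \<partial>M) \<le> ennreal \<delta>"
    using int[of k] by (subst nn_integral_eq_integral) (auto intro!: ennreal_leI)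
  then show ?thesis by blast
qed

definition clamp_real :: "real \<Rightarrow> real \<Rightarrow> real" where
  "clamp_real T t = max (- T) (min T t)"

text \<open>
  First \<open>f\<close> is truncated at a large height \<open>k\<close>. A measurable function is a
  limit almost everywhere of continuous ones; truncating these at the same height and multiplying
  with a cut-off function dominates them, so they converge to the truncation of \<open>f\<close> in
  the mean of order \<open>N\<close>.
\<close>
lemma Lp_approx_continuous:
  fixes f :: "'a::euclidean_space \<Rightarrow> real"
  assumes f[measurable]: "f \<in> borel_measurable lebesgue" and supp: "\<And>x. norm x > R \<Longrightarrow> f x = 0"
    and int: "integrable lebesgue (\<lambda>x. \<bar>f x\<bar> ^ N)" and N: "N \<ge> 1" and d: "\<delta> > 0"
  obtains g where "continuous_on UNIV g" "\<And>x. norm x > R + 1 \<Longrightarrow> g x = 0"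
    "(\<integral>\<^sup>+x. ennreal (\<bar>f x - g x\<bar> ^ N) \<partial>lebesgue) \<le> ennreal \<delta>"
proof -
  define \<delta>1 where "\<delta>1 = \<delta> / (2 * 3 ^ N)"
  have d1: "\<delta>1 > 0" using d by (simp add: \<delta>1_def)
  have cm[measurable]: "clamp_real T \<in> borel_measurable borel" for T
    unfolding clamp_real_def by measurable
  have cc: "continuous_on S (clamp_real T)" for S T
    unfolding clamp_real_def by (intro continuous_intros)
  have "\<exists>k. (\<integral>\<^sup>+x. ennreal (\<bar>f x - clamp_real (real k) (f x)\<bar> ^ N) \<partial>lebesgue) \<le> ennreal \<delta>1"
  proof (rule Lp_dominated_convergence[OF _ int _ _ N d1])
    show "(\<lambda>x. f x - clamp_real (real k) (f x)) \<in> borel_measurable lebesgue" for k by measurable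
    show "AE x in lebesgue. \<bar>f x - clamp_real (real k) (f x)\<bar> ^ N \<le> \<bar>f x\<bar> ^ N" for k
      by (intro AE_I2 power_mono) (auto simp: clamp_real_def)
    show "AE x in lebesgue. (\<lambda>k. f x - clamp_real (real k) (f x)) \<longlonglongrightarrow> 0"
    proof (rule AE_I2)
      fix x
      obtain K :: nat where K: "\<bar>f x\<bar> \<le> real K" using real_arch_simple by blast
      have "eventually (\<lambda>k. 0 = f x - clamp_real (real k) (f x)) sequentially"
        using eventually_ge_at_top[of K] by eventually_elim (use K in \<open>auto simp: clamp_real_def\<close>)
      then show "(\<lambda>k. f x - clamp_real (real k) (f x)) \<longlonglongrightarrow> 0"
        by (rule Lim_transform_eventually[OF tendsto_const])
    qed
  qed
  then obtain k where k: "(\<integral>\<^sup>+x. ennreal (\<bar>f x - clamp_real (real k) (f x)\<bar> ^ N) \<partial>lebesgue) \<le> ennreal \<delta>1" by blast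
  obtain Z G where Z: "negligible Z" and G: "\<And>j. continuous_on UNIV (G j)" "\<And>x. x \<notin> Z \<Longrightarrow> (\<lambda>j. G j x) \<longlonglongrightarrow> f x"
    using lebesgue_measurable_imp_measurable_on[OF f, of UNIV] unfolding measurable_on_def by auto
  define cut where "cut = (\<lambda>x::'a. max 0 (min 1 (R + 1 - norm x)))"
  define g where "g = (\<lambda>j x. cut x * clamp_real (real k) (G j x))"
  have chi: "0 \<le> cut x" "cut x \<le> 1" "norm x > R + 1 \<Longrightarrow> cut x = 0" "norm x \<le> R \<Longrightarrow> cut x = 1" for x
    by (auto simp: cut_def)
  have gc: "continuous_on UNIV (g j)" for j
    unfolding g_def cut_def
    by (intro continuous_intros continuous_on_compose2[OF cc G(1)]) auto
  have g0: "norm x > R + 1 \<Longrightarrow> g j x = 0" for j x by (simp add: g_def chi)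
  have gm[measurable]: "g j \<in> borel_measurable lebesgue" for j
    using borel_measurable_continuous_onI[OF gc[of j]] by (simp add: measurable_completion)
  have cl: "\<bar>clamp_real (real k) t\<bar> \<le> real k" for t by (auto simp: clamp_real_def)
  have "\<exists>j. (\<integral>\<^sup>+x. ennreal (\<bar>clamp_real (real k) (f x) - g j x\<bar> ^ N) \<partial>lebesgue) \<le> ennreal \<delta>1"
  proof (rule Lp_dominated_convergence[OF _ _ _ _ N d1])
    show "(\<lambda>x. clamp_real (real k) (f x) - g j x) \<in> borel_measurable lebesgue" for j by measurable
    show "integrable lebesgue (\<lambda>x::'a. (2 * real k) ^ N * indicator (cball 0 (R + 1)) x)"
      using emeasure_lborel_cball_finite[of "0::'a" "R + 1"]
      by (intro integrable_mult_right integrable_real_indicator) auto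
    show "AE x in lebesgue. \<bar>clamp_real (real k) (f x) - g j x\<bar> ^ N \<le> (2 * real k) ^ N * indicator (cball 0 (R + 1)) x" for j
    proof (rule AE_I2)
      fix x
      show "\<bar>clamp_real (real k) (f x) - g j x\<bar> ^ N \<le> (2 * real k) ^ N * indicator (cball 0 (R + 1)) x"
      proof (cases "norm x > R + 1")
        case True
        then show ?thesis using supp[of x] g0[of x j] N by (simp add: clamp_real_def power_0_left)
      next
        case False
        have "\<bar>g j x\<bar> \<le> 1 * real k" unfolding g_def abs_mult
          using chi(1,2)[of x] cl by (intro mult_mono) auto
        then have "\<bar>clamp_real (real k) (f x) - g j x\<bar> \<le> 2 * real k" using cl[of "f x"] by simp
        then have "\<bar>clamp_real (real k) (f x) - g j x\<bar> ^ N \<le> (2 * real k) ^ N" by (intro power_mono) auto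
        then show ?thesis using False by (simp add: indicator_def)
      qed
    qed
    have "AE x in lebesgue. x \<notin> Z"
      using Z by (metis AE_not_in negligible_iff_null_sets)
    then show "AE x in lebesgue. (\<lambda>j. clamp_real (real k) (f x) - g j x) \<longlonglongrightarrow> 0"
    proof eventually_elim
      case (elim x)
      have "(\<lambda>j. g j x) \<longlonglongrightarrow> cut x * clamp_real (real k) (f x)"
        unfolding g_def clamp_real_def by (intro tendsto_intros G(2)[OF elim])
      moreover have "cut x * clamp_real (real k) (f x) = clamp_real (real k) (f x)"
        using supp[of x] chi(4)[of x] by (cases "norm x > R") (auto simp: clamp_real_def)
      ultimately show ?case by (auto intro!: tendsto_eq_intros)
    qed
  qed
  then obtain j where j: "(\<integral>\<^sup>+x. ennreal (\<bar>clamp_real (real k) (f x) - g j x\<bar> ^ N) \<partial>lebesgue) \<le> ennreal \<delta>1" by blast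
  have "(\<integral>\<^sup>+x. ennreal (\<bar>f x - g j x\<bar> ^ N) \<partial>lebesgue) \<le>
    (\<integral>\<^sup>+x. ennreal (3 ^ N) * (ennreal (\<bar>f x - clamp_real (real k) (f x)\<bar> ^ N) + ennreal (\<bar>clamp_real (real k) (f x) - g j x\<bar> ^ N)) \<partial>lebesgue)"
  proof (rule nn_integral_mono)
    fix x
    let ?c = "clamp_real (real k) (f x)"
    have "\<bar>f x - g j x\<bar> ^ N \<le> (\<bar>f x - ?c\<bar> + \<bar>?c - g j x\<bar> + 0) ^ N" by (intro power_mono) auto
    also have "\<dots> \<le> 3 ^ N * (\<bar>f x - ?c\<bar> ^ N + \<bar>?c - g j x\<bar> ^ N + 0 ^ N)" by (rule power_add3_le) auto
    finally have "\<bar>f x - g j x\<bar> ^ N \<le> 3 ^ N * (\<bar>f x - ?c\<bar> ^ N + \<bar>?c - g j x\<bar> ^ N)"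
      using N by (simp add: power_0_left)
    then show "ennreal (\<bar>f x - g j x\<bar> ^ N) \<le> ennreal (3 ^ N) * (ennreal (\<bar>f x - ?c\<bar> ^ N) + ennreal (\<bar>?c - g j x\<bar> ^ N))"
      by (subst ennreal_plus[symmetric], simp, simp, subst ennreal_mult[symmetric]) (auto intro!: ennreal_leI)
  qed
  also have "\<dots> = ennreal (3 ^ N) * ((\<integral>\<^sup>+x. ennreal (\<bar>f x - clamp_real (real k) (f x)\<bar> ^ N) \<partial>lebesgue)
     + (\<integral>\<^sup>+x. ennreal (\<bar>clamp_real (real k) (f x) - g j x\<bar> ^ N) \<partial>lebesgue))"
    by (subst nn_integral_cmult, measurable, subst nn_integral_add) auto
  also have "\<dots> \<le> ennreal (3 ^ N) * (ennreal \<delta>1 + ennreal \<delta>1)"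
    by (intro mult_left_mono add_mono k j) auto
  also have "\<dots> = ennreal \<delta>"
    using d1 by (subst ennreal_plus[symmetric], simp, simp, subst ennreal_mult[symmetric]) (auto simp: \<delta>1_def)
  finally show thesis using that[OF gc g0] by blast
qed

lemma conv_mollifier_close_uniform:
  fixes g :: "real^'n::finite \<Rightarrow> real"
  assumes g: "integrable lebesgue g" and K: "compact K'" "continuous_on K' g"
    and KK: "\<And>x y. x \<in> K \<Longrightarrow> norm (x - y) \<le> r \<Longrightarrow> y \<in> K'" and r: "r > 0" and e: "\<eta> > 0"
  shows "eventually (\<lambda>s. \<forall>x\<in>K. \<bar>conv g (mollifier s) x - g x\<bar> \<le> \<eta>) at_top"
proof -
  obtain d where d: "d > 0" "\<And>x y. x \<in> K' \<Longrightarrow> y \<in> K' \<Longrightarrow> dist y x < d \<Longrightarrow> dist (g y) (g x) < \<eta>"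
    using compact_uniformly_continuous[OF K(2,1)] e unfolding uniformly_continuous_on_def by metis
  define r' where "r' = min r (d / 2)"
  have r': "r' > 0" "r' \<le> r" "r' < d" using r d(1) by (auto simp: r'_def)
  have "eventually (\<lambda>s::real. s \<ge> real CARD('n) / r' \<and> s > 0) at_top"
    by (intro eventually_conj eventually_ge_at_top eventually_gt_at_top)
  then show ?thesis
  proof eventually_elim
    case (elim s)
    then have "real CARD('n) / s \<le> r'" using r'(1) by (simp add: field_simps)
    show ?case
    proof (intro ballI conv_mollifier_close g)
      fix x y assume x: "x \<in> K" and "norm (x - y) \<le> real CARD('n) / s"
      then have xy: "norm (x - y) \<le> r'" using \<open>real CARD('n) / s \<le> r'\<close> by simp
      have "y \<in> K'" using KK[OF x, of y] xy r'(2) by simp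
      moreover have "x \<in> K'" using KK[OF x, of x] r by simp
      ultimately show "\<bar>g y - g x\<bar> \<le> \<eta>"
        using d(2)[of x y] xy r'(3) by (simp add: dist_norm norm_minus_commute)
    qed (use elim in auto)
  qed
qed

text \<open>
  Mollifications of a continuous function with compact support converge uniformly. The general case
  follows by approximation with such a function \<open>g\<close>, because mollification does not
  increase the distance between \<open>f\<close> and \<open>g\<close>.
\<close>
lemma mollifier_Lp_convergence:
  fixes f :: "real^'n::finite \<Rightarrow> real"
  assumes f: "integrable lebesgue f" and supp: "\<And>x. norm x > R \<Longrightarrow> f x = 0"
    and int: "integrable lebesgue (\<lambda>x. \<bar>f x\<bar> ^ N)" and N: "N \<ge> 1" and d: "\<delta> > 0"
  shows "eventually (\<lambda>s. (\<integral>\<^sup>+x. ennreal (\<bar>conv f (mollifier s) x - f x\<bar> ^ N) \<partial>lebesgue) \<le> ennreal \<delta>) at_top"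
proof -
  define \<delta>1 where "\<delta>1 = \<delta> / (3 * 3 ^ N)"
  have d1: "\<delta>1 > 0" using d by (simp add: \<delta>1_def)
  have [measurable]: "f \<in> borel_measurable lebesgue" using f by auto
  obtain g where g: "continuous_on UNIV g" "\<And>x. norm x > R + 1 \<Longrightarrow> g x = 0"
    "(\<integral>\<^sup>+x. ennreal (\<bar>f x - g x\<bar> ^ N) \<partial>lebesgue) \<le> ennreal \<delta>1"
    using Lp_approx_continuous[of f R N \<delta>1] supp int N d1 by auto
  let ?B = "cball (0::real^'n) (R + 1)" and ?B2 = "cball (0::real^'n) (R + 2)"
  have gm[measurable]: "g \<in> borel_measurable lebesgue"
    using borel_measurable_continuous_onI[OF g(1)] by (simp add: measurable_completion)
  have "integrable lborel (\<lambda>x. indicator ?B x *\<^sub>R g x)"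
    by (intro borel_integrable_compact continuous_on_subset[OF g(1)]) auto
  moreover have "(\<lambda>x. indicator ?B x *\<^sub>R g x) = g"
    using g(2) by (force simp: indicator_def)
  ultimately have "integrable lborel g" by metis
  then have gi: "integrable lebesgue g" by (subst integrable_completion) auto
  have fgi: "integrable lebesgue (\<lambda>x. f x - g x)" using f gi by simp
  define V where "V = measure lebesgue ?B2"
  have V: "V \<ge> 0" "emeasure lebesgue ?B2 = ennreal V"
    using emeasure_eq_measure2[OF lmeasurable_cball[of "0::real^'n" "R + 2"]] by (simp_all add: V_def)
  define \<eta> where "\<eta> = min 1 (\<delta>1 / (V + 1))"
  have eta: "\<eta> > 0" "\<eta> \<le> 1" using d1 V(1) by (auto simp: \<eta>_def)
  have "\<eta> * V \<le> \<delta>1 / (V + 1) * (V + 1)"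
    using d1 V(1) by (intro mult_mono) (auto simp: \<eta>_def)
  then have etaV: "\<eta> * V \<le> \<delta>1" using V(1) by simp
  have "\<eta> ^ N \<le> \<eta> ^ 1" using eta N by (intro power_decreasing) auto
  then have "\<eta> ^ N * V \<le> \<eta> * V" using V(1) by (intro mult_right_mono) auto
  then have etaN: "\<eta> ^ N * V \<le> \<delta>1" using etaV by simp
  have c1: "eventually (\<lambda>s. \<forall>x\<in>?B2. \<bar>conv g (mollifier s) x - g x\<bar> \<le> \<eta>) at_top"
  proof (rule conv_mollifier_close_uniform[OF gi _ _ _ zero_less_one eta(1)])
    show "y \<in> cball 0 (R + 3)" if "x \<in> ?B2" "norm (x - y) \<le> 1" for x y
      using that norm_triangle_sub[of y x] by (simp add: norm_minus_commute)
  qed (auto intro: continuous_on_subset[OF g(1)])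
  have c2: "eventually (\<lambda>s::real. s \<ge> real CARD('n) \<and> s > 0) at_top"
    by (intro eventually_conj eventually_ge_at_top eventually_gt_at_top)
  from c1 c2 show ?thesis
  proof eventually_elim
    case (elim s)
    then have s: "s > 0" and ns: "real CARD('n) / s \<le> 1" by auto
    let ?C = "\<lambda>f. conv f (mollifier s)"
    have Cm: "?C f \<in> borel_measurable lebesgue" if "integrable lebesgue f" for f
      using borel_measurable_continuous_onI[OF conv_mollifier_continuous[OF that s]] by (simp add: measurable_completion)
    have m1: "(\<lambda>x. ennreal (\<bar>?C (\<lambda>x. f x - g x) x\<bar> ^ N)) \<in> borel_measurable lebesgue"
      using Cm[OF fgi] by measurable
    have m2: "(\<lambda>x. ennreal (\<eta> ^ N) * indicator ?B2 x) \<in> borel_measurable lebesgue"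
      by (intro borel_measurable_times_ennreal borel_measurable_const borel_measurable_indicator) auto
    have m3: "(\<lambda>x. ennreal (\<bar>f x - g x\<bar> ^ N)) \<in> borel_measurable lebesgue"
      by measurable
    have split: "?C f x = ?C (\<lambda>x. f x - g x) x + ?C g x" for x
      unfolding conv_def
      by (subst Bochner_Integration.integral_add[symmetric, OF conv_mollifier_integrable[OF fgi s] conv_mollifier_integrable[OF gi s]])
         (simp add: algebra_simps)
    have close: "\<bar>?C g x - g x\<bar> ^ N \<le> \<eta> ^ N * indicator ?B2 x" for x
    proof (cases "x \<in> ?B2")
      case True
      then show ?thesis using elim(1) by (auto intro!: power_mono)
    next
      case False
      have "\<bar>?C g x - g x\<bar> \<le> 0"
      proof (rule conv_mollifier_close[OF gi s])
        fix y assume "norm (x - y) \<le> real CARD('n) / s"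
        then have "norm y > R + 1"
          using False ns norm_triangle_sub[of x y] by simp
        then show "\<bar>g y - g x\<bar> \<le> 0" using g(2)[of x] g(2)[of y] False by simp
      qed
      then show ?thesis using False N by (simp add: power_0_left)
    qed
    have "(\<integral>\<^sup>+x. ennreal (\<bar>?C f x - f x\<bar> ^ N) \<partial>lebesgue) \<le>
      (\<integral>\<^sup>+x. ennreal (3 ^ N) * (ennreal (\<bar>?C (\<lambda>x. f x - g x) x\<bar> ^ N) + (ennreal (\<eta> ^ N) * indicator ?B2 x + ennreal (\<bar>f x - g x\<bar> ^ N))) \<partial>lebesgue)"
    proof (rule nn_integral_mono)
      fix x
      let ?a = "\<bar>?C (\<lambda>x. f x - g x) x\<bar>" and ?b = "\<bar>?C g x - g x\<bar>" and ?c = "\<bar>f x - g x\<bar>"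
      have "\<bar>?C f x - f x\<bar> ^ N \<le> (?a + ?b + ?c) ^ N" unfolding split by (intro power_mono) auto
      also have "\<dots> \<le> 3 ^ N * (?a ^ N + ?b ^ N + ?c ^ N)" by (rule power_add3_le) auto
      also have "\<dots> \<le> 3 ^ N * (?a ^ N + (\<eta> ^ N * indicator ?B2 x + ?c ^ N))"
        using close[of x] by simp
      finally have "ennreal (\<bar>?C f x - f x\<bar> ^ N) \<le> ennreal (3 ^ N * (?a ^ N + (\<eta> ^ N * indicator ?B2 x + ?c ^ N)))"
        by (rule ennreal_leI)
      also have "\<dots> = ennreal (3 ^ N) * (ennreal (?a ^ N) + (ennreal (\<eta> ^ N) * indicator ?B2 x + ennreal (?c ^ N)))"
        using eta(1) by (simp add: ennreal_mult ennreal_indicator)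
      finally show "ennreal (\<bar>?C f x - f x\<bar> ^ N) \<le> \<dots>" .
    qed
    also have "\<dots> = ennreal (3 ^ N) * ((\<integral>\<^sup>+x. ennreal (\<bar>?C (\<lambda>x. f x - g x) x\<bar> ^ N) \<partial>lebesgue)
       + (ennreal (\<eta> ^ N) * emeasure lebesgue ?B2 + (\<integral>\<^sup>+x. ennreal (\<bar>f x - g x\<bar> ^ N) \<partial>lebesgue)))"
      by (simp only: nn_integral_cmult[OF borel_measurable_add[OF m1 borel_measurable_add[OF m2 m3]]]
          nn_integral_add[OF m1 borel_measurable_add[OF m2 m3]] nn_integral_add[OF m2 m3])
         (subst nn_integral_cmult_indicator, auto)
    also have "\<dots> \<le> ennreal (3 ^ N) * (ennreal \<delta>1 + (ennreal \<delta>1 + ennreal \<delta>1))"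
    proof (intro mult_left_mono add_mono g(3))
      show "(\<integral>\<^sup>+x. ennreal (\<bar>?C (\<lambda>x. f x - g x) x\<bar> ^ N) \<partial>lebesgue) \<le> ennreal \<delta>1"
        by (rule order_trans[OF conv_Lp_contraction[OF fgi s] g(3)])
      show "ennreal (\<eta> ^ N) * emeasure lebesgue ?B2 \<le> ennreal \<delta>1"
        using etaN eta(1) V by (simp add: ennreal_mult[symmetric] ennreal_leI)
    qed auto
    also have "\<dots> = ennreal \<delta>"
      using d1 by (simp add: ennreal_mult[symmetric] ennreal_plus[symmetric] del: ennreal_plus) (simp add: \<delta>1_def)
    finally show ?case .
  qed
qed

section \<open>Weak derivatives and convolutions\<close>

lemma lebesgue_measurable_indicator_mult:
  fixes f :: "'a::euclidean_space \<Rightarrow> real"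
  assumes f: "f \<in> borel_measurable (lebesgue_on \<Omega>)" and "\<Omega> \<in> sets lebesgue" "K \<in> sets lebesgue" "K \<subseteq> \<Omega>"
  shows "(\<lambda>x. indicator K x * f x) \<in> borel_measurable lebesgue"
proof -
  have "(\<lambda>x. indicator \<Omega> x *\<^sub>R f x) \<in> borel_measurable lebesgue"
    using f assms(2) by (subst (asm) borel_measurable_restrict_space_iff) auto
  then have "(\<lambda>x. indicator K x * (indicator \<Omega> x *\<^sub>R f x)) \<in> borel_measurable lebesgue"
    using assms(3) by (intro borel_measurable_times) auto
  moreover have "(\<lambda>x. indicator K x * (indicator \<Omega> x *\<^sub>R f x)) = (\<lambda>x. indicator K x * f x)"
    using assms(4) by (auto simp: indicator_def fun_eq_iff)
  ultimately show ?thesis by metis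
qed

lemma Lq_loc_integrable_power:
  fixes f :: "real^'n::finite \<Rightarrow> real"
  assumes f: "Lq_loc (real N) \<Omega> f" and N: "N \<ge> 1" and O: "open \<Omega>" and K: "compact K" "K \<subseteq> \<Omega>"
  shows "integrable lebesgue (\<lambda>x. \<bar>indicator K x * f x\<bar> ^ N)"
proof -
  have Ks: "K \<in> sets lebesgue" using K(1) by (simp add: compact_imp_closed)
  have "integrable (lebesgue_on K) (\<lambda>x. \<bar>f x\<bar> powr real N)"
    using f K unfolding Lq_loc_def by blast
  then have "integrable lebesgue (\<lambda>x. indicator K x *\<^sub>R (\<bar>f x\<bar> powr real N))"
    using Ks by (subst (asm) integrable_restrict_space) auto
  moreover have "indicator K x *\<^sub>R (\<bar>f x\<bar> powr real N) = \<bar>indicator K x * f x\<bar> ^ N" for x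
    using N by (cases "f x = 0") (auto simp: indicator_def powr_realpow power_0_left)
  ultimately show ?thesis by simp
qed

lemma Lq_loc_integrable:
  fixes f :: "real^'n::finite \<Rightarrow> real"
  assumes f: "Lq_loc 1 \<Omega> f" and O: "open \<Omega>" and K: "compact K" "K \<subseteq> \<Omega>"
  shows "integrable lebesgue (\<lambda>x. indicator K x * f x)"
proof (rule integrable_abs_cancel)
  show "integrable lebesgue (\<lambda>x. \<bar>indicator K x * f x\<bar>)"
    using Lq_loc_integrable_power[of 1 \<Omega> f K] assms by simp
  show "(\<lambda>x. indicator K x * f x) \<in> borel_measurable lebesgue"
    using f O K by (intro lebesgue_measurable_indicator_mult[of f \<Omega>]) (auto simp: Lq_loc_def compact_imp_closed)
qed

text \<open>
  The reflected kernel is a test function, and the definition of the weak derivative moves one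
  derivative from the kernel onto \<open>u\<close>. The cut-off to \<open>K\<close> has no effect
  since the kernel centred at \<open>x\<close> is supported in \<open>K\<close>.
\<close>
lemma weak_partial_conv:
  fixes u g :: "real^'n::finite \<Rightarrow> real"
  assumes wk: "has_weak_partial \<Omega> i u g" and O: "open \<Omega>" and K: "K \<subseteq> \<Omega>" and s: "s > 0"
    and sub: "cball x (real CARD('n) / s) \<subseteq> K"
  shows "conv (\<lambda>y. indicator K y * u y) (kern (c * s) s (k(i := Suc (k i)))) x
       = conv (\<lambda>y. indicator K y * g y) (kern c s k) x"
proof -
  let ?\<psi> = "\<lambda>y. kern c s k (x - y)"
  have loc: "(LINT y|lebesgue_on \<Omega>. f y * kern c' s k' (x - y)) = conv (\<lambda>y. indicator K y * f y) (kern c' s k') x" for f c' k'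
  proof -
    have z: "kern c' s k' (x - y) = 0" if "y \<notin> K" for y
      using kern_support[OF _ s, of c' k' "x - y"] sub that by (auto simp: dist_norm subset_iff)
    have "(LINT y|lebesgue_on \<Omega>. f y * kern c' s k' (x - y)) = (LINT y|lebesgue. indicator \<Omega> y *\<^sub>R (f y * kern c' s k' (x - y)))"
      using O by (intro integral_restrict_space) auto
    also have "\<dots> = conv (\<lambda>y. indicator K y * f y) (kern c' s k') x"
      unfolding conv_def using z K by (intro Bochner_Integration.integral_cong refl) (auto simp: indicator_def)
    finally show ?thesis .
  qed
  have "test_function \<Omega> ?\<psi>" using kern_test_function[OF s] sub K by blast
  then have "(LINT y|lebesgue_on \<Omega>. u y * partial_deriv i ?\<psi> y) = - (LINT y|lebesgue_on \<Omega>. g y * ?\<psi> y)"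
    using wk unfolding has_weak_partial_def by blast
  then have "conv (\<lambda>y. indicator K y * u y) (kern (- (c * s)) s (k(i := Suc (k i)))) x
       = - conv (\<lambda>y. indicator K y * g y) (kern c s k) x"
    unfolding kern_test_partial loc .
  moreover have "conv f (kern (- (c * s)) s k') x = - conv f (kern (c * s) s k') x" for f k'
    unfolding conv_def by (subst Bochner_Integration.integral_minus[symmetric]) (simp add: kern_def)
  ultimately show ?thesis by simp
qed

section \<open>The weight on the ball of gradients\<close>

lemma geometric_radii_sum:
  fixes M :: real
  assumes M: "M > 0" and n: "n \<ge> 1"
  shows "(\<Sum>k\<le>m. 1 / (M / 2 ^ k) ^ n) \<le> 2 / (M / 2 ^ m) ^ n"
proof (induction m)
  case 0
  then show ?case using M by (simp add: divide_right_mono)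
next
  case (Suc m)
  have h: "(M / 2 ^ m) ^ n = 2 ^ n * (M / 2 ^ Suc m) ^ n"
    by (simp add: power_mult_distrib[symmetric])
  have "(2::real) ^ 1 \<le> 2 ^ n" using n by (intro power_increasing) auto
  then have "2 * (M / 2 ^ Suc m) ^ n \<le> (M / 2 ^ m) ^ n"
    unfolding h using M by (intro mult_right_mono) auto
  then have "2 / (M / 2 ^ m) ^ n \<le> 2 / (2 * (M / 2 ^ Suc m) ^ n)"
    using M by (intro divide_left_mono) auto
  then have "2 / (M / 2 ^ m) ^ n \<le> 1 / (M / 2 ^ Suc m) ^ n" by simp
  then show ?case using Suc by simp
qed

text \<open>
  Only the terms with radius at least \<open>t\<close> occur on the left, and they grow
  geometrically, so the last of them dominates; if there is one, its radius is comparable to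
  \<open>max t (M / 2\<^sup>m)\<close>.
\<close>
lemma shells_le_weight:
  fixes M t :: real
  assumes M: "M > 0" and t: "t \<ge> 0" and n: "n \<ge> 1"
  shows "(\<Sum>k<m. of_bool (t \<le> M / 2 ^ k) / (M / 2 ^ k) ^ n) \<le> 4 / ((M / 2 ^ m) ^ n + t ^ n)"
proof (induction m)
  case 0
  then show ?case using M t by simp
next
  case (Suc m)
  let ?r = "M / 2 ^ m" and ?r' = "M / 2 ^ Suc m"
  have r: "0 < ?r'" "?r' \<le> ?r" using M by (auto simp: field_simps)
  have pos: "0 < ?r' ^ n + t ^ n" "0 < ?r ^ n + t ^ n" using r t by (auto intro!: add_pos_nonneg)
  have mono: "4 / (?r ^ n + t ^ n) \<le> 4 / (?r' ^ n + t ^ n)"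
    using pos by (intro divide_left_mono add_right_mono power_mono r less_imp_le[OF r(1)] mult_pos_pos) auto
  show ?case
  proof (cases "t \<le> ?r")
    case False
    then show ?thesis using Suc mono by simp
  next
    case True
    have "(\<Sum>k<Suc m. of_bool (t \<le> M / 2 ^ k) / (M / 2 ^ k) ^ n) \<le> (\<Sum>k\<le>m. 1 / (M / 2 ^ k) ^ n)"
      unfolding lessThan_Suc_atMost using M by (intro sum_mono) (auto intro!: divide_right_mono)
    also have "\<dots> \<le> 2 / ?r ^ n" by (rule geometric_radii_sum[OF M n])
    also have "\<dots> = 4 / (?r ^ n + ?r ^ n)" using M by simp
    also have "\<dots> \<le> 4 / (?r ^ n + t ^ n)"
      using True pos t M by (intro divide_left_mono add_left_mono power_mono) (auto intro!: mult_pos_pos)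
    finally show ?thesis using mono by simp
  qed
qed

lemma weight_continuous:
  assumes "\<kappa> > 0"
  shows "continuous_on S (\<lambda>p::'a::real_normed_vector. 1 / (\<kappa> ^ n + norm p ^ n))"
  using assms by (intro continuous_intros) (smt (verit) norm_ge_zero zero_le_power zero_less_power)

text \<open>
  Each of the \<open>m\<close> balls of radius \<open>M / 2\<^sup>k\<close>, divided by the
  \<open>n\<close>-th power of its radius, contributes the volume of the unit ball. Hence the
  integral is unbounded as the cut-off radius decreases, at a rate that does not depend on
  \<open>M\<close>.
\<close>
lemma weight_integral_ge:
  assumes M: "M > 0"
  shows "real m * measure lborel (cball (0::real^'n::finite) 1) / 4
    \<le> integral (cball 0 M) (\<lambda>p::real^'n. 1 / ((M / 2 ^ m) ^ CARD('n) + norm p ^ CARD('n)))"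
proof -
  let ?n = "CARD('n)"
  let ?h = "\<lambda>k p::real^'n. of_bool (norm p \<le> M / 2 ^ k) / (M / 2 ^ k) ^ ?n"
  have hk: "(?h k has_integral measure lborel (cball (0::real^'n) 1)) (cball 0 M)" for k
  proof -
    let ?r = "M / 2 ^ k"
    have "M / 2 ^ k \<le> M / 1" using M by (intro divide_left_mono) auto
    then have sub: "cball 0 ?r \<subseteq> cball (0::real^'n) M" by (intro subset_cball) simp
    have "((\<lambda>p::real^'n. 1) has_integral measure lborel (cball (0::real^'n) ?r)) (cball 0 ?r)"
      using emeasure_lborel_cball_finite[of "0::real^'n" ?r] by (intro has_integral_measure_lborel) auto
    then have "((\<lambda>p. 1 / ?r ^ ?n) has_integral measure lborel (cball (0::real^'n) ?r) / ?r ^ ?n) (cball (0::real^'n) ?r)"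
      using has_integral_mult_left[of "\<lambda>p. 1" "measure lborel (cball (0::real^'n) ?r)" "cball (0::real^'n) ?r" "1 / ?r ^ ?n"]
      by simp
    then have "((\<lambda>p. if p \<in> cball 0 ?r then 1 / ?r ^ ?n else 0) has_integral measure lborel (cball (0::real^'n) ?r) / ?r ^ ?n) (cball (0::real^'n) M)"
      by (subst has_integral_restrict[OF sub])
    moreover have "measure lborel (cball (0::real^'n) ?r) / ?r ^ ?n = measure lborel (cball (0::real^'n) 1)"
      using M content_cball[of ?r "0::real^'n"] content_cball[of 1 "0::real^'n"] by simp
    moreover have "(\<lambda>p. if p \<in> cball 0 ?r then 1 / ?r ^ ?n else 0) = ?h k" by auto
    ultimately show ?thesis by metis
  qed
  have "((\<lambda>p. \<Sum>k<m. ?h k p) has_integral (\<Sum>k<m. measure lborel (cball (0::real^'n) 1))) (cball 0 M)"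
    by (intro has_integral_sum hk) auto
  then have "((\<lambda>p. (\<Sum>k<m. ?h k p) / 4) has_integral (real m * measure lborel (cball (0::real^'n) 1)) / 4) (cball 0 M)"
    using has_integral_divide[of _ _ _ 4] by simp
  moreover have "(\<lambda>p::real^'n. 1 / ((M / 2 ^ m) ^ ?n + norm p ^ ?n)) integrable_on cball 0 M"
    using M by (intro continuous_on_compact_integrable_on weight_continuous) auto
  moreover have "(\<Sum>k<m. ?h k p) / 4 \<le> 1 / ((M / 2 ^ m) ^ ?n + norm p ^ ?n)" for p
    using shells_le_weight[OF M norm_ge_zero[of p], of ?n m] by simp
  ultimately show ?thesis
    by (intro has_integral_le[OF _ integrable_integral])
qed

section \<open>The equation at a contact point\<close>

lemma power_add4_le:
  fixes a b c d :: real
  assumes "0 \<le> a" "0 \<le> b" "0 \<le> c" "0 \<le> d"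
  shows "(a + b + c + d) ^ N \<le> 4 ^ N * (a ^ N + b ^ N + c ^ N + d ^ N)"
proof -
  let ?m = "max (max a b) (max c d)"
  have "(a + b + c + d) ^ N \<le> (4 * ?m) ^ N" using assms by (intro power_mono) auto
  also have "\<dots> = 4 ^ N * ?m ^ N" by (simp add: power_mult_distrib)
  also have "?m ^ N \<le> a ^ N + b ^ N + c ^ N + d ^ N" using assms by (auto simp: max_def)
  finally show ?thesis by simp
qed

lemma power_sum_le:
  fixes E :: "'i \<Rightarrow> real"
  assumes T: "finite T" "T \<noteq> {}" and E: "\<And>t. t \<in> T \<Longrightarrow> 0 \<le> E t"
  shows "(\<Sum>t\<in>T. E t) ^ N \<le> real (card T) ^ N * (\<Sum>t\<in>T. E t ^ N)"
proof -
  obtain u where u: "u \<in> T" "\<And>t. t \<in> T \<Longrightarrow> E t \<le> E u"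
  proof -
    have "Max (E ` T) \<in> E ` T" using T by (intro Max_in) auto
    then obtain u where "u \<in> T" "Max (E ` T) = E u" by blast
    moreover have "E t \<le> Max (E ` T)" if "t \<in> T" for t using T that by (intro Max_ge) auto
    ultimately show thesis using that by simp
  qed
  have "(\<Sum>t\<in>T. E t) ^ N \<le> (real (card T) * E u) ^ N"
    using u E by (intro power_mono sum_bounded_above sum_nonneg) auto
  also have "\<dots> = real (card T) ^ N * E u ^ N" by (simp add: power_mult_distrib)
  also have "E u ^ N \<le> (\<Sum>t\<in>T. E t ^ N)"
    using u E T by (intro member_le_sum[of u T "\<lambda>t. E t ^ N"]) auto
  finally show ?thesis by (simp add: mult_left_mono)
qed

text \<open>
  The three uses of the weight: it bounds constants by \<open>\<kappa>\<^sup>-\<^sup>N\<close>, it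
  cancels \<open>p\<^sup>N\<close>, and it reduces \<open>p\<^sup>2\<^sup>N\<close> to
  \<open>p\<^sup>N \<le> M\<^sup>N\<close>.
\<close>
lemma weighted_power_estimate:
  fixes T c \<alpha> \<beta> \<gamma> p e \<kappa> M :: real
  assumes c: "c > 0" and k: "\<kappa> > 0" and p: "0 \<le> p" "p \<le> M"
    and nn: "0 \<le> T" "0 \<le> \<alpha>" "0 \<le> \<beta>" "0 \<le> \<gamma>" "0 \<le> e"
    and le: "c * T \<le> \<alpha> + \<beta> * p + \<gamma> * p\<^sup>2 + e"
  shows "T ^ N * (1 / (\<kappa> ^ N + p ^ N)) \<le>
    (4 / c) ^ N * (\<alpha> ^ N / \<kappa> ^ N + \<beta> ^ N + (\<gamma> * M) ^ N + e ^ N / \<kappa> ^ N)"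
proof -
  let ?D = "\<kappa> ^ N + p ^ N"
  have D: "?D > 0" "\<kappa> ^ N \<le> ?D" "p ^ N \<le> ?D" "\<kappa> ^ N > 0" using k p by (auto intro: add_pos_nonneg)
  have "(c * T) ^ N \<le> (\<alpha> + \<beta> * p + \<gamma> * p\<^sup>2 + e) ^ N"
    using c nn by (intro power_mono[OF le]) auto
  also have "\<dots> \<le> 4 ^ N * (\<alpha> ^ N + (\<beta> * p) ^ N + (\<gamma> * p\<^sup>2) ^ N + e ^ N)"
    using nn p by (intro power_add4_le) auto
  finally have 1: "(c * T) ^ N / ?D \<le> 4 ^ N * (\<alpha> ^ N + (\<beta> * p) ^ N + (\<gamma> * p\<^sup>2) ^ N + e ^ N) / ?D"
    using D by (intro divide_right_mono) auto
  have a: "x / ?D \<le> x / \<kappa> ^ N" if "x \<ge> 0" for x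
    using that D by (intro divide_left_mono) (auto intro: mult_pos_pos)
  have b: "p ^ N / ?D \<le> 1" using D by simp
  have "(\<alpha> ^ N + (\<beta> * p) ^ N + (\<gamma> * p\<^sup>2) ^ N + e ^ N) / ?D
     = \<alpha> ^ N / ?D + \<beta> ^ N * (p ^ N / ?D) + (\<gamma> * p) ^ N * (p ^ N / ?D) + e ^ N / ?D"
    by (simp add: add_divide_distrib power_mult_distrib power2_eq_square mult_ac)
  also have "\<dots> \<le> \<alpha> ^ N / \<kappa> ^ N + \<beta> ^ N * 1 + (\<gamma> * M) ^ N * 1 + e ^ N / \<kappa> ^ N"
    using nn p D b by (intro add_mono a mult_mono power_mono mult_left_mono) auto
  finally have 2: "(\<alpha> ^ N + (\<beta> * p) ^ N + (\<gamma> * p\<^sup>2) ^ N + e ^ N) / ?D \<le> \<alpha> ^ N / \<kappa> ^ N + \<beta> ^ N + (\<gamma> * M) ^ N + e ^ N / \<kappa> ^ N"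
    by simp
  have "T ^ N * (1 / ?D) = (1 / c) ^ N * ((c * T) ^ N / ?D)"
    using c by (simp add: power_mult_distrib power_divide)
  also have "\<dots> \<le> (1 / c) ^ N * (4 ^ N * (\<alpha> ^ N / \<kappa> ^ N + \<beta> ^ N + (\<gamma> * M) ^ N + e ^ N / \<kappa> ^ N))"
  proof (rule mult_left_mono)
    have "4 ^ N * (\<alpha> ^ N + (\<beta> * p) ^ N + (\<gamma> * p\<^sup>2) ^ N + e ^ N) / ?D
        \<le> 4 ^ N * (\<alpha> ^ N / \<kappa> ^ N + \<beta> ^ N + (\<gamma> * M) ^ N + e ^ N / \<kappa> ^ N)"
      unfolding times_divide_eq_right[symmetric] by (rule mult_left_mono[OF 2]) simp
    then show "(c * T) ^ N / ?D \<le> 4 ^ N * (\<alpha> ^ N / \<kappa> ^ N + \<beta> ^ N + (\<gamma> * M) ^ N + e ^ N / \<kappa> ^ N)"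
      using 1 by simp
  qed (use c in simp)
  also have "\<dots> = (4 / c) ^ N * (\<alpha> ^ N / \<kappa> ^ N + \<beta> ^ N + (\<gamma> * M) ^ N + e ^ N / \<kappa> ^ N)"
    by (simp add: power_divide)
  finally show ?thesis .
qed

text \<open>
  The pointwise form of the equation for \<open>- ln v\<close>. Here \<open>g\<close> and
  \<open>h\<close> are the gradient and Hessian of the approximation \<open>v\<close>, while
  \<open>D\<close> and \<open>D2\<close> are those of the eigenfunction, for which the equation
  holds; the differences are collected in \<open>\<epsilon>\<close>.
\<close>
lemma log_hessian_trace_estimate:
  fixes A h D2 :: "real^'n^'n::finite" and g D b :: "real^'n"
  assumes c0: "c0 > 0" and v: "v \<ge> m" "m > 0" and phi: "\<phi> > 0" "\<phi> \<le> 2 * v"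
    and eq: "(\<Sum>i\<in>UNIV. \<Sum>j\<in>UNIV. A $ i $ j * D2 $ i $ j) + (\<Sum>i\<in>UNIV. b $ i * D $ i) = - lam * \<phi>"
    and ell: "\<And>\<xi>::real^'n. c0 * (norm \<xi>)\<^sup>2 \<le> (\<Sum>i\<in>UNIV. \<Sum>j\<in>UNIV. A $ i $ j * \<xi> $ i * \<xi> $ j)"
      "\<And>\<xi>::real^'n. (\<Sum>i\<in>UNIV. \<Sum>j\<in>UNIV. A $ i $ j * \<xi> $ i * \<xi> $ j) \<le> C0 * (norm \<xi>)\<^sup>2"
    and bd: "norm b \<le> Q" "\<And>i j. \<bar>A $ i $ j\<bar> \<le> Q"
    and psd: "psd (\<lambda>i j. - h $ i $ j / v + g $ i * g $ j / v\<^sup>2)"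
    and eps: "(\<Sum>i\<in>UNIV. \<bar>g $ i - D $ i\<bar>) + (\<Sum>i\<in>UNIV. \<Sum>j\<in>UNIV. \<bar>h $ i $ j - D2 $ i $ j\<bar>) \<le> \<epsilon>"
  shows "c0 * (\<Sum>i\<in>UNIV. - h $ i $ i / v + g $ i * g $ i / v\<^sup>2)
    \<le> 2 * max lam 0 + norm b * norm (- (1 / v) *\<^sub>R g) + C0 * (norm (- (1 / v) *\<^sub>R g))\<^sup>2 + Q / m * \<epsilon>"
proof -
  let ?p = "- (1 / v) *\<^sub>R g" 
  let ?S = "\<lambda>X. \<Sum>i\<in>UNIV. \<Sum>j\<in>UNIV. A $ i $ j * X i j"
  have vp: "v > 0" using v by simp
  have Q: "Q \<ge> 0" using bd(1) norm_ge_zero order_trans by blast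
  have norm2: "(norm \<xi>)\<^sup>2 = (\<Sum>i\<in>UNIV. (\<xi> $ i)\<^sup>2)" for \<xi> :: "real^'n"
    by (simp add: norm_vec_def L2_set_def sum_nonneg)
  have "c0 * (\<Sum>i\<in>UNIV. - h $ i $ i / v + g $ i * g $ i / v\<^sup>2) \<le> ?S (\<lambda>i j. - h $ i $ j / v + g $ i * g $ j / v\<^sup>2)"
  proof (rule elliptic_trace_le[OF _ psd])
    show "c0 * (\<Sum>i\<in>UNIV. (\<xi> i)\<^sup>2) \<le> quad_form (\<lambda>i j. A $ i $ j) \<xi>" for \<xi>
      using ell(1)[of "vec_lambda \<xi>"] by (simp add: norm2 quad_form_def)
  qed
  also have "\<dots> = - ?S (\<lambda>i j. h $ i $ j) / v + ?S (\<lambda>i j. ?p $ i * ?p $ j)"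
    by (simp add: right_diff_distrib sum_subtractf sum_divide_distrib power2_eq_square)
  also have "?S (\<lambda>i j. ?p $ i * ?p $ j) \<le> C0 * (norm ?p)\<^sup>2"
    using ell(2)[of ?p] by (simp only: mult.assoc)
  finally have 1: "c0 * (\<Sum>i\<in>UNIV. - h $ i $ i / v + g $ i * g $ i / v\<^sup>2)
     \<le> - ?S (\<lambda>i j. h $ i $ j) / v + C0 * (norm ?p)\<^sup>2" by simp
  have "?S (\<lambda>i j. h $ i $ j) = ?S (\<lambda>i j. D2 $ i $ j) + ?S (\<lambda>i j. h $ i $ j - D2 $ i $ j)"
    by (simp add: right_diff_distrib sum_subtractf)
  moreover have "\<bar>?S (\<lambda>i j. h $ i $ j - D2 $ i $ j)\<bar> \<le> (\<Sum>i\<in>UNIV. \<Sum>j\<in>UNIV. Q * \<bar>h $ i $ j - D2 $ i $ j\<bar>)"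
    by (intro order_trans[OF sum_abs] sum_mono) (auto simp: abs_mult intro!: mult_right_mono bd(2))
  moreover have "(\<Sum>i\<in>UNIV. b $ i * D $ i) = - v * (b \<bullet> ?p) + (\<Sum>i\<in>UNIV. b $ i * (D $ i - g $ i))"
    using vp by (simp add: inner_vec_def right_diff_distrib sum_subtractf sum_negf sum_distrib_left)
  moreover have "\<bar>\<Sum>i\<in>UNIV. b $ i * (D $ i - g $ i)\<bar> \<le> (\<Sum>i\<in>UNIV. Q * \<bar>g $ i - D $ i\<bar>)"
    using order_trans[OF component_le_norm_cart bd(1)]
    by (intro order_trans[OF sum_abs] sum_mono) (auto simp: abs_mult abs_minus_commute intro!: mult_right_mono)
  moreover have "(\<Sum>i\<in>UNIV. Q * \<bar>g $ i - D $ i\<bar>) + (\<Sum>i\<in>UNIV. \<Sum>j\<in>UNIV. Q * \<bar>h $ i $ j - D2 $ i $ j\<bar>) \<le> Q * \<epsilon>"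
    using mult_left_mono[OF eps Q] by (simp add: distrib_left sum_distrib_left)
  moreover have "\<bar>b \<bullet> ?p\<bar> \<le> norm b * norm ?p" by (rule Cauchy_Schwarz_ineq2)
  then have "- (b \<bullet> ?p) \<le> norm b * norm ?p" by linarith
  then have "v * - (b \<bullet> ?p) \<le> v * (norm b * norm ?p)"
    by (rule mult_left_mono) (use vp in simp)
  then have "- (v * (b \<bullet> ?p)) \<le> v * (norm b * norm ?p)"
    by (simp only: mult_minus_right)
  moreover have "lam * \<phi> \<le> max lam 0 * (2 * v)"
    using phi by (intro mult_mono) auto
  ultimately have "- ?S (\<lambda>i j. h $ i $ j) \<le> 2 * max lam 0 * v + v * (norm b * norm ?p) + Q * \<epsilon>"
    using eq by (simp only: mult_minus_left)
  then have "- ?S (\<lambda>i j. h $ i $ j) / v \<le> (2 * max lam 0 * v + v * (norm b * norm ?p) + Q * \<epsilon>) / v"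
    using vp by (intro divide_right_mono) auto
  also have "\<dots> = 2 * max lam 0 + norm b * norm ?p + Q * \<epsilon> / v"
    using vp by (simp add: add_divide_distrib)
  also have "Q * \<epsilon> / v \<le> Q * \<epsilon> / m"
  proof (rule divide_left_mono)
    have "0 \<le> \<epsilon>" using eps by (rule order_trans[rotated]) (auto intro!: add_nonneg_nonneg sum_nonneg)
    then show "0 \<le> Q * \<epsilon>" using Q by simp
  qed (use v in auto)
  finally show ?thesis using 1 by simp
qed

section \<open>The contact set of a logarithm\<close>

lemma has_derivative_vecI:
  fixes f :: "'a::real_normed_vector \<Rightarrow> real^'n"
  assumes "\<And>j. ((\<lambda>x. f x $ j) has_derivative (\<lambda>z. f' z $ j)) (at x)"
  shows "(f has_derivative f') (at x)"
  using assms by (subst has_derivative_componentwise_within) (auto simp: Basis_vec_def inner_axis)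

text \<open>
  For \<open>- ln v\<close> the interior minimum condition turns into a Harnack type bound: a
  minimum point \<open>x\<close> of \<open>- ln v - p \<bullet> x\<close> with
  \<open>|p| \<le> M\<close> satisfies \<open>v x \<ge> v x0 exp (- M d)\<close>.
\<close>
lemma log_abp:
  fixes v :: "real^'n::finite \<Rightarrow> real" and h :: "real^'n \<Rightarrow> real^'n^'n"
  assumes K: "compact K" and W: "open W" "W \<subseteq> K"
    and v: "\<And>x. (v has_derivative (\<lambda>z. g x \<bullet> z)) (at x)"
    and g: "\<And>x. (g has_derivative (\<lambda>z. h x *v z)) (at x)"
    and hc: "continuous_on UNIV h" and sym: "\<And>x i j. h x $ i $ j = h x $ j $ i"
    and pos: "\<And>x. x \<in> K \<Longrightarrow> v x > 0"
    and x0: "x0 \<in> K" and diam: "\<And>x. x \<in> K \<Longrightarrow> norm (x - x0) \<le> d" and M: "M \<ge> 0"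
    and contact: "\<And>x. x \<in> K \<Longrightarrow> v x0 * exp (- (M * d)) \<le> v x \<Longrightarrow> x \<in> W"
    and k: "\<kappa> > 0"
  obtains S where "compact S" "S \<subseteq> W"
    "\<And>x. x \<in> S \<Longrightarrow> norm (- (1 / v x) *\<^sub>R g x) \<le> M"
    "\<And>x. x \<in> S \<Longrightarrow> psd (\<lambda>i j. - h x $ i $ j / v x + g x $ i * g x $ j / (v x)\<^sup>2)"
    "continuous_on S (\<lambda>x. fact CARD('n) * (\<Sum>k\<in>UNIV. - h x $ k $ k / v x + g x $ k * g x $ k / (v x)\<^sup>2) ^ CARD('n) *
        (1 / (\<kappa> ^ CARD('n) + norm (- (1 / v x) *\<^sub>R g x) ^ CARD('n))))"
    "integral (cball 0 M) (\<lambda>p::real^'n. 1 / (\<kappa> ^ CARD('n) + norm p ^ CARD('n))) \<le>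
      integral S (\<lambda>x. fact CARD('n) * (\<Sum>k\<in>UNIV. - h x $ k $ k / v x + g x $ k * g x $ k / (v x)\<^sup>2) ^ CARD('n) *
        (1 / (\<kappa> ^ CARD('n) + norm (- (1 / v x) *\<^sub>R g x) ^ CARD('n))))"
proof -
  define w where "w = (\<lambda>x. - ln (v x))"
  define Dw where "Dw = (\<lambda>x. - (1 / v x) *\<^sub>R g x)"
  define Hw :: "real^'n \<Rightarrow> real^'n^'n" where
    "Hw = (\<lambda>x. \<chi> i j. - h x $ i $ j / v x + g x $ i * g x $ j / (v x)\<^sup>2)"
  have vc: "continuous_on S v" and gc: "continuous_on S g" for S
    by (auto intro!: continuous_at_imp_continuous_on has_derivative_continuous[OF v] has_derivative_continuous[OF g])
  have hc': "continuous_on S h" for S using hc continuous_on_subset by blast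
  have nz: "\<forall>x\<in>K. v x \<noteq> 0" using pos by force
  have wc: "continuous_on K w" and Dwc: "continuous_on K Dw" and Hwc: "continuous_on K Hw"
    unfolding w_def Dw_def Hw_def using nz by (auto intro!: continuous_intros vc gc hc')
  have interior: "x \<in> W" if p: "norm p \<le> M" and x: "x \<in> K" and min: "\<And>y. y \<in> K \<Longrightarrow> w x - p \<bullet> x \<le> w y - p \<bullet> y" for p x
  proof (rule contact[OF x])
    have "p \<bullet> (x - x0) \<le> norm p * norm (x - x0)" by (rule norm_cauchy_schwarz)
    also have "\<dots> \<le> M * d" using p diam[OF x] M by (intro mult_mono) auto
    finally have "p \<bullet> x - p \<bullet> x0 \<le> M * d" by (simp add: inner_diff_right)
    then have "ln (v x0) - M * d \<le> ln (v x)" using min[OF x0] by (simp add: w_def)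
    then have "exp (ln (v x0) - M * d) \<le> exp (ln (v x))" by simp
    then show "v x0 * exp (- (M * d)) \<le> v x"
      using pos[OF x] pos[OF x0] by (simp add: exp_diff exp_minus divide_inverse)
  qed
  have dw: "(w has_derivative (\<lambda>z. Dw x \<bullet> z)) (at x)" if "x \<in> W" for x
  proof -
    have px: "v x > 0" using that W(2) pos by blast
    have "(w has_derivative (\<lambda>z. - (g x \<bullet> z * inverse (v x)))) (at x)"
      unfolding w_def by (rule derivative_eq_intros v px refl)+
    then show ?thesis by (rule has_derivative_eq_rhs) (simp add: Dw_def fun_eq_iff divide_inverse)
  qed
  have dDw: "(Dw has_derivative (\<lambda>z. Hw x *v z)) (at x)" if "x \<in> W" for x
  proof -
    have px: "v x > 0" using that W(2) pos by blast
    have "((\<lambda>x. - inverse (v x)) has_derivative (\<lambda>z. inverse (v x) * (g x \<bullet> z) * inverse (v x))) (at x)"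
      using has_derivative_minus[OF Deriv.has_derivative_inverse[OF _ v, of x]] px by simp
    from has_derivative_scaleR[OF this g]
    have "((\<lambda>x. - inverse (v x) *\<^sub>R g x) has_derivative
      (\<lambda>z. - inverse (v x) *\<^sub>R (h x *v z) + (inverse (v x) * (g x \<bullet> z) * inverse (v x)) *\<^sub>R g x)) (at x)" .
    then have "(Dw has_derivative
      (\<lambda>z. - inverse (v x) *\<^sub>R (h x *v z) + (inverse (v x) * (g x \<bullet> z) * inverse (v x)) *\<^sub>R g x)) (at x)"
      by (simp add: Dw_def divide_inverse)
    moreover have "- inverse (v x) *\<^sub>R (h x *v z) + (inverse (v x) * (g x \<bullet> z) * inverse (v x)) *\<^sub>R g x = Hw x *v z" for z
    proof (rule vec_eq_iff[THEN iffD2], rule allI)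
      fix i
      have "(- inverse (v x) *\<^sub>R (h x *v z) + (inverse (v x) * (g x \<bullet> z) * inverse (v x)) *\<^sub>R g x) $ i
        = (\<Sum>j\<in>UNIV. - inverse (v x) * (h x $ i $ j * z $ j) + (inverse (v x) * (g x $ j * z $ j) * inverse (v x)) * g x $ i)"
        by (simp add: matrix_vector_mult_def inner_vec_def sum_subtractf sum_distrib_left sum_distrib_right)
      also have "\<dots> = (Hw x *v z) $ i"
        unfolding Hw_def matrix_vector_mult_def
        by (simp, intro sum.cong refl) (simp add: divide_inverse power2_eq_square algebra_simps)
      finally show "(- inverse (v x) *\<^sub>R (h x *v z) + (inverse (v x) * (g x \<bullet> z) * inverse (v x)) *\<^sub>R g x) $ i = (Hw x *v z) $ i" .
    qed
    ultimately show ?thesis by simp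
  qed
  have symw: "Hw x $ i $ j = Hw x $ j $ i" for x i j using sym[of x i j] by (simp add: Hw_def mult.commute)
  have Kne: "K \<noteq> {}" using x0 by blast
  obtain S where S: "compact S" "S \<subseteq> W" "\<And>x. x \<in> S \<Longrightarrow> norm (Dw x) \<le> M"
    "\<And>x. x \<in> S \<Longrightarrow> psd (\<lambda>i j. Hw x $ i $ j)"
    "integral (cball 0 M) (\<lambda>p::real^'n. 1 / (\<kappa> ^ CARD('n) + norm p ^ CARD('n))) \<le>
      integral S (\<lambda>x. fact CARD('n) * (\<Sum>k\<in>UNIV. Hw x $ k $ k) ^ CARD('n) * (1 / (\<kappa> ^ CARD('n) + norm (Dw x) ^ CARD('n))))"
    by (rule abp_gradient_image[OF K Kne W wc Dwc Hwc dw dDw symw interior weight_continuous[OF k, of UNIV "CARD('n)"]])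
       (use k in \<open>auto\<close>)
  have SK: "S \<subseteq> K" using S(2) W(2) by blast
  have c: "continuous_on S (\<lambda>x. fact CARD('n) * (\<Sum>k\<in>UNIV. Hw x $ k $ k) ^ CARD('n) * (1 / (\<kappa> ^ CARD('n) + norm (Dw x) ^ CARD('n))))"
    using continuous_on_subset[OF Dwc SK] continuous_on_subset[OF Hwc SK]
    by (intro continuous_intros continuous_on_compose2[OF weight_continuous[OF k, of UNIV "CARD('n)"]]) auto
  show thesis
    by (rule that[OF S(1,2)]) (use S(3-5) c in \<open>simp_all add: Dw_def Hw_def\<close>)
qed

section \<open>Derivatives of the mollified eigenfunction\<close>

text \<open>
  The derivatives of the mollification exist everywhere, as convolutions with derivatives of the
  kernel; this also makes the Hessian symmetric. Only where the kernel is supported in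
  \<open>K\<close> do they coincide with the mollified weak derivatives.
\<close>
lemma mollified_derivatives:
  fixes u :: "real^'n::finite \<Rightarrow> real" and D :: "real^'n \<Rightarrow> real^'n" and D2 :: "real^'n \<Rightarrow> real^'n^'n"
  assumes Ui: "integrable lebesgue (\<lambda>y. indicator K y * u y)" and s: "s > 0"
    and O: "open \<Omega>" "K \<subseteq> \<Omega>"
    and w: "\<And>j. has_weak_partial \<Omega> j u (\<lambda>x. D x $ j)"
      "\<And>i j. has_weak_partial \<Omega> i (\<lambda>x. D x $ j) (\<lambda>x. D2 x $ i $ j)"
  obtains g :: "real^'n \<Rightarrow> real^'n" and h :: "real^'n \<Rightarrow> real^'n^'n" where
    "\<And>x. (conv (\<lambda>y. indicator K y * u y) (mollifier s) has_derivative (\<lambda>z. g x \<bullet> z)) (at x)"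
    "\<And>x. (g has_derivative (\<lambda>z. h x *v z)) (at x)"
    "continuous_on UNIV h" "\<And>x i j. h x $ i $ j = h x $ j $ i"
    "\<And>x j. cball x (real CARD('n) / s) \<subseteq> K \<Longrightarrow>
       g x $ j = conv (\<lambda>y. indicator K y * D y $ j) (mollifier s) x"
    "\<And>x i j. cball x (real CARD('n) / s) \<subseteq> K \<Longrightarrow>
       h x $ i $ j = conv (\<lambda>y. indicator K y * D2 y $ i $ j) (mollifier s) x"
proof -
  define U where "U = (\<lambda>y. indicator K y * u y)"
  have U: "integrable lebesgue U" using Ui by (simp add: U_def)
  define c where "c = s ^ CARD('n) / (\<integral>z. kern 1 1 (\<lambda>_. 0) (z::real^'n) \<partial>lborel)"
  have mol: "(mollifier s :: real^'n \<Rightarrow> real) = kern c s (\<lambda>_. 0)" by (simp add: mollifier_def c_def)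
  define e where "e = (\<lambda>j::'n. (\<lambda>_. 0::nat)(j := Suc 0))"
  define g where "g = (\<lambda>x. \<chi> j. conv U (kern (c * s) s (e j)) x)"
  define h :: "real^'n \<Rightarrow> real^'n^'n" where
    "h = (\<lambda>x. \<chi> j i. conv U (kern (c * s * s) s ((e j)(i := Suc (e j i)))) x)"
  have e0: "(\<lambda>_. 0::nat)(j := Suc 0) = e j" for j by (simp add: e_def)
  show thesis
  proof (rule that)
    show "(conv (\<lambda>y. indicator K y * u y) (mollifier s) has_derivative (\<lambda>z. g x \<bullet> z)) (at x)" for x
      unfolding U_def[symmetric]
      using conv_kern_deriv[OF U s, of c "\<lambda>_. 0" x]
      by (simp add: mol g_def inner_vec_def e0)
    show "(g has_derivative (\<lambda>z. h x *v z)) (at x)" for x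
    proof (rule has_derivative_vecI)
      show "((\<lambda>x. g x $ j) has_derivative (\<lambda>z. (h x *v z) $ j)) (at x)" for j
        using conv_kern_deriv[OF U s, of "c * s" "e j" x]
        by (simp add: g_def h_def matrix_vector_mult_def)
    qed
    have cc: "continuous_on UNIV (conv U (kern c' s k'))" for c' k'
      by (auto intro!: continuous_at_imp_continuous_on has_derivative_continuous[OF conv_kern_deriv] U s)
    show "continuous_on UNIV h" unfolding h_def by (intro continuous_intros cc)
    have "(e i)(j := Suc (e i j)) = (e j)(i := Suc (e j i))" for i j
      by (auto simp: e_def fun_eq_iff)
    then show "h x $ i $ j = h x $ j $ i" for x i j by (simp add: h_def)
    have hsym: "h x $ i $ j = conv U (kern (c * s * s) s ((e i)(j := Suc (e i j)))) x" for x i j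
      by (simp add: h_def)
    fix x j
    assume sub: "cball x (real CARD('n) / s) \<subseteq> K"
    show "g x $ j = conv (\<lambda>y. indicator K y * D y $ j) (mollifier s) x"
      using weak_partial_conv[OF w(1)[of j] O s sub, where c = c and k = "\<lambda>_. 0"] by (simp add: g_def U_def e0 mol)
    fix i
    have "h x $ i $ j = conv (\<lambda>y. indicator K y * D y $ j) (kern (c * s) s (e i)) x"
      unfolding hsym U_def by (rule weak_partial_conv[OF w(1) O s sub])
    also have "\<dots> = conv (\<lambda>y. indicator K y * D2 y $ i $ j) (mollifier s) x"
      using weak_partial_conv[OF w(2)[of i j] O s sub, where c = c and k = "\<lambda>_. 0"] by (simp add: e0 mol)
    finally show "h x $ i $ j = conv (\<lambda>y. indicator K y * D2 y $ i $ j) (mollifier s) x" .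
  qed
qed

text \<open>
  Passes from the pointwise estimate on the contact set to an integral estimate. The error terms are
  controlled by their integrals over the whole space, not pointwise.
\<close>
lemma integral_le_of_AE_bound:
  fixes F B :: "'a::euclidean_space \<Rightarrow> real" and E :: "'t \<Rightarrow> 'a \<Rightarrow> real"
  assumes S: "compact S" and F: "continuous_on S F" "\<And>x. x \<in> S \<Longrightarrow> 0 \<le> F x"
    and B: "integrable lebesgue B" "\<And>x. 0 \<le> B x" and T: "finite T"
    and E: "\<And>t. t \<in> T \<Longrightarrow> E t \<in> borel_measurable lebesgue" "\<And>t x. 0 \<le> E t x"
      "\<And>t. t \<in> T \<Longrightarrow> (\<integral>\<^sup>+x. ennreal (E t x) \<partial>lebesgue) \<le> ennreal \<delta>"
    and d: "\<delta> \<ge> 0" and C: "C \<ge> 0"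
    and le: "AE x in lebesgue. x \<in> S \<longrightarrow> F x \<le> B x + C * (\<Sum>t\<in>T. E t x)"
  shows "integral S F \<le> (\<integral>x. B x \<partial>lebesgue) + C * (real (card T) * \<delta>)"
proof -
  have iF: "integrable lborel (\<lambda>x. indicator S x *\<^sub>R F x)" by (rule borel_integrable_compact[OF S F(1)])
  have Bm: "(\<lambda>x. ennreal (B x)) \<in> borel_measurable lebesgue" using B(1) by auto
  have Em: "(\<lambda>x. ennreal (E t x)) \<in> borel_measurable lebesgue" if "t \<in> T" for t
    using E(1)[OF that] by measurable
  have "ennreal (integral S F) = (\<integral>\<^sup>+x. ennreal (indicator S x *\<^sub>R F x) \<partial>lborel)"
    unfolding continuous_on_compact_integrable_on(3)[OF S F(1)]
    by (rule nn_integral_eq_integral[symmetric, OF iF]) (auto simp: indicator_def F(2))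
  also have "\<dots> = (\<integral>\<^sup>+x. ennreal (indicator S x *\<^sub>R F x) \<partial>lebesgue)"
    by (rule nn_integral_completion[symmetric])
  also have "\<dots> \<le> (\<integral>\<^sup>+x. ennreal (B x) + ennreal C * (\<Sum>t\<in>T. ennreal (E t x)) \<partial>lebesgue)"
  proof (rule nn_integral_mono_AE, use le in eventually_elim)
    fix x assume x: "x \<in> S \<longrightarrow> F x \<le> B x + C * (\<Sum>t\<in>T. E t x)"
    have nn: "0 \<le> (\<Sum>t\<in>T. E t x)" by (intro sum_nonneg E(2))
    have "indicator S x *\<^sub>R F x \<le> B x + C * (\<Sum>t\<in>T. E t x)"
      using x B(2)[of x] C nn by (auto simp: indicator_def)
    then have "ennreal (indicator S x *\<^sub>R F x) \<le> ennreal (B x + C * (\<Sum>t\<in>T. E t x))" by (rule ennreal_leI)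
    also have "\<dots> = ennreal (B x) + ennreal C * (\<Sum>t\<in>T. ennreal (E t x))"
      using B(2) C nn E(2) by (simp add: ennreal_mult sum_ennreal)
    finally show "ennreal (indicator S x *\<^sub>R F x) \<le> ennreal (B x) + ennreal C * (\<Sum>t\<in>T. ennreal (E t x))" .
  qed
  also have "\<dots> = (\<integral>\<^sup>+x. ennreal (B x) \<partial>lebesgue) + (\<integral>\<^sup>+x. ennreal C * (\<Sum>t\<in>T. ennreal (E t x)) \<partial>lebesgue)"
    by (intro nn_integral_add Bm borel_measurable_times_ennreal borel_measurable_const borel_measurable_sum Em)
  also have "(\<integral>\<^sup>+x. ennreal C * (\<Sum>t\<in>T. ennreal (E t x)) \<partial>lebesgue) = ennreal C * (\<integral>\<^sup>+x. (\<Sum>t\<in>T. ennreal (E t x)) \<partial>lebesgue)"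
    by (intro nn_integral_cmult borel_measurable_sum Em)
  also have "(\<integral>\<^sup>+x. (\<Sum>t\<in>T. ennreal (E t x)) \<partial>lebesgue) = (\<Sum>t\<in>T. \<integral>\<^sup>+x. ennreal (E t x) \<partial>lebesgue)"
    by (intro nn_integral_sum Em)
  also have "(\<integral>\<^sup>+x. ennreal (B x) \<partial>lebesgue) = ennreal (\<integral>x. B x \<partial>lebesgue)"
    using B by (intro nn_integral_eq_integral) auto
  also have "ennreal (\<integral>x. B x \<partial>lebesgue) + ennreal C * (\<Sum>t\<in>T. \<integral>\<^sup>+x. ennreal (E t x) \<partial>lebesgue)
      \<le> ennreal (\<integral>x. B x \<partial>lebesgue) + ennreal C * ennreal (real (card T) * \<delta>)"
  proof (intro add_left_mono mult_left_mono)
    have "(\<Sum>t\<in>T. \<integral>\<^sup>+x. ennreal (E t x) \<partial>lebesgue) \<le> (\<Sum>t\<in>T. ennreal \<delta>)"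
      by (intro sum_mono E(3))
    also have "\<dots> = ennreal (real (card T) * \<delta>)"
      using d by (simp add: ennreal_mult ennreal_of_nat_eq_real_of_nat)
    finally show "(\<Sum>t\<in>T. \<integral>\<^sup>+x. ennreal (E t x) \<partial>lebesgue) \<le> ennreal (real (card T) * \<delta>)" .
  qed simp
  also have "\<dots> = ennreal ((\<integral>x. B x \<partial>lebesgue) + C * (real (card T) * \<delta>))"
    using B(2) C d by (simp add: ennreal_mult[symmetric] integral_nonneg_AE)
  finally show ?thesis
    using B(2) C d by (subst (asm) ennreal_le_iff) (auto intro!: add_nonneg_nonneg integral_nonneg_AE)
qed

section \<open>The eigenvalue estimate\<close>

lemma Linfty_power_integrable:
  fixes b :: "real^'n::finite \<Rightarrow> real^'n"
  assumes b: "Linfty_on \<Omega> b" and O: "open \<Omega>" "bounded \<Omega>"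
  shows "integrable lebesgue (\<lambda>x. indicator \<Omega> x * norm (b x) ^ N)"
proof -
  obtain Q where Q: "AE x in lebesgue_on \<Omega>. norm (b x) \<le> Q" using b unfolding Linfty_on_def by blast
  have Os: "\<Omega> \<in> sets lebesgue" "\<Omega> \<in> lmeasurable"
    using O by (auto simp: bounded_set_imp_lmeasurable)
  then have "integrable lebesgue (\<lambda>x. \<bar>Q\<bar> ^ N * indicator \<Omega> x)"
    using fmeasurableD2[of \<Omega> lebesgue] by (intro integrable_mult_right integrable_real_indicator) (auto simp: less_top)
  moreover have "(\<lambda>x. indicator \<Omega> x * norm (b x) ^ N) \<in> borel_measurable lebesgue"
    using b Os by (intro lebesgue_measurable_indicator_mult[of _ \<Omega>]) (auto simp: Linfty_on_def)
  moreover have "AE x in lebesgue. x \<in> \<Omega> \<longrightarrow> norm (b x) \<le> Q"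
    using Q Os by (subst (asm) AE_restrict_space_iff) auto
  then have "AE x in lebesgue. norm (indicator \<Omega> x * norm (b x) ^ N) \<le> norm (\<bar>Q\<bar> ^ N * indicator \<Omega> x :: real)"
    by eventually_elim (auto simp: indicator_def power_abs intro!: power_mono)
  ultimately show ?thesis by (rule Bochner_Integration.integrable_bound)
qed

lemma sum_option_prod:
  "(\<Sum>t\<in>(UNIV :: ('a::finite option \<times> 'b::finite) set). f t) =
    (\<Sum>j\<in>UNIV. f (None, j)) + (\<Sum>i\<in>UNIV. \<Sum>j\<in>UNIV. f (Some i, j))"
proof -
  have "(\<Sum>t\<in>(UNIV :: ('a option \<times> 'b) set). f t) = (\<Sum>q\<in>UNIV. \<Sum>j\<in>UNIV. f (q, j))"
    by (simp add: sum.cartesian_product UNIV_Times_UNIV[symmetric] del: UNIV_Times_UNIV)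
  also have "\<dots> = (\<Sum>j\<in>UNIV. f (None, j)) + (\<Sum>i\<in>UNIV. \<Sum>j\<in>UNIV. f (Some i, j))"
    by (simp add: UNIV_option_conv sum.reindex)
  finally show ?thesis .
qed

text \<open>
  The ABP inequality for \<open>- ln \<phi>\<close>. The contact points lie where
  \<open>\<phi>\<close> is bounded below, so the mollification is compared with
  \<open>\<phi>\<close> on a compact subset of \<open>\<Omega>\<close> only, and the approximation
  error tends to zero for fixed \<open>M\<close> and \<open>\<kappa>\<close>.
\<close>
lemma eigenvalue_gradient_estimate:
  fixes \<Omega> :: "(real^'n::finite) set" and a :: "real^'n \<Rightarrow> real^'n^'n" and b :: "real^'n \<Rightarrow> real^'n"
  assumes O: "open \<Omega>" "bounded \<Omega>" "\<Omega> \<noteq> {}"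
    and ac: "\<And>i j. continuous_on \<Omega> (\<lambda>x. a x $ i $ j)"
    and ell: "elliptic_on c0 C0 \<Omega> a" and c0: "c0 > 0" and C0: "C0 \<ge> 0"
    and b: "Linfty_on \<Omega> b" and eig: "is_principal_eigenvalue a b \<Omega> lam"
    and M: "M > 0" and k: "\<kappa> > 0"
  shows "integral (cball 0 M) (\<lambda>p::real^'n. 1 / (\<kappa> ^ CARD('n) + norm p ^ CARD('n)))
    \<le> fact CARD('n) * (4 / c0) ^ CARD('n) *
      (((2 * max lam 0) ^ CARD('n) / \<kappa> ^ CARD('n) + (C0 * M) ^ CARD('n)) * measure lebesgue \<Omega>
        + (LINT x|lebesgue_on \<Omega>. norm (b x) ^ CARD('n)))"
proof -
  let ?n = "CARD('n)"
  have n1: "?n \<ge> 1" by (simp add: Suc_leI)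
  obtain \<phi> D D2 where
    W2: "\<And>q. q \<ge> 1 \<Longrightarrow> W2q_loc q \<Omega> \<phi> D D2" and \<phi>c: "continuous_on (closure \<Omega>) \<phi>"
    and pde: "AE x in lebesgue_on \<Omega>. L0 a b D D2 x = - lam * \<phi> x"
    and \<phi>0: "\<And>x. x \<in> frontier \<Omega> \<Longrightarrow> \<phi> x = 0" and \<phi>pos: "\<And>x. x \<in> \<Omega> \<Longrightarrow> \<phi> x > 0"
    using eig unfolding is_principal_eigenvalue_def by blast
  have w1: "has_weak_partial \<Omega> i \<phi> (\<lambda>x. D x $ i)" "has_weak_partial \<Omega> i (\<lambda>x. D x $ j) (\<lambda>x. D2 x $ i $ j)" for i j
    using W2[of 1] unfolding W2q_loc_def by auto
  have Lq: "Lq_loc q \<Omega> \<phi>" "Lq_loc q \<Omega> (\<lambda>x. D x $ i)" "Lq_loc q \<Omega> (\<lambda>x. D2 x $ i $ j)" if "q \<ge> 1" for q i j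
    using W2[OF that] unfolding W2q_loc_def by auto
  have Os: "\<Omega> \<in> sets lebesgue" "\<Omega> \<in> lmeasurable"
    using O by (auto simp: bounded_set_imp_lmeasurable)

  obtain x0 where x0: "x0 \<in> \<Omega>" using O(3) by blast
  have x0c: "x0 \<in> closure \<Omega>" using x0 closure_subset by blast
  obtain R0 where R0: "\<And>x. x \<in> closure \<Omega> \<Longrightarrow> norm x \<le> R0"
    using bounded_closure[OF O(2)] unfolding bounded_iff by blast
  define d where "d = 2 * R0"
  have d: "norm (x - x0) \<le> d" if "x \<in> closure \<Omega>" for x
    using norm_triangle_ineq4[of x x0] R0[OF that] R0[OF x0c] by (simp add: d_def)
  (* Contact points for slopes in the ball of radius M satisfy \<open>\<phi> \<ge> m\<close>. The set K leaves a
     margin for the mollification error, and W is an open set between the contact points and K. *)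
  define m where "m = \<phi> x0 * exp (- (M * d))"
  have m: "m > 0" using \<phi>pos[OF x0] by (simp add: m_def)
  have d0: "d \<ge> 0" using d[OF x0c] by simp
  have "exp (- (M * d)) \<le> 1" using d0 M by simp
  then have m_le: "m \<le> \<phi> x0" using \<phi>pos[OF x0] by (simp add: m_def mult_left_le)
  define K where "K = {x \<in> closure \<Omega>. m / 2 \<le> \<phi> x}"
  have "closed K" unfolding K_def by (intro continuous_on_closed_Collect_le continuous_intros \<phi>c) auto
  moreover have "K \<subseteq> closure \<Omega>" by (auto simp: K_def)
  ultimately have K: "compact K"
    using O(2) by (meson bounded_closure bounded_subset compact_eq_bounded_closed)
  have KO: "K \<subseteq> \<Omega>"
  proof
    fix x assume x: "x \<in> K"
    have "x \<notin> frontier \<Omega>" using x \<phi>0[of x] m by (auto simp: K_def)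
    then show "x \<in> \<Omega>" using x O(1) by (auto simp: K_def frontier_def interior_open)
  qed
  define W where "W = \<Omega> \<inter> \<phi> -` {m / 2 <..}"
  have Wo: "open W" unfolding W_def
    using O(1) \<phi>c closure_subset by (intro continuous_open_preimage) (auto intro: continuous_on_subset)
  have WK: "W \<subseteq> K" unfolding W_def K_def using closure_subset[of \<Omega>] by auto
  (* K2 contains the supports of the kernels centred in K as soon as \<open>s \<ge> n / r\<close>, and the weak
     derivatives are integrable on it. *)
  obtain r where r: "r > 0" "(\<Union>x\<in>K. cball x r) \<subseteq> \<Omega>"
    using compact_subset_open_imp_cball_epsilon_subset[OF K O(1) KO] by blast
  define K2 where "K2 = (\<Union>x\<in>K. cball x r)"
  have "K2 = {x + y |x y. x \<in> K \<and> y \<in> cball 0 r}"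
  proof safe
    fix z assume "z \<in> K2"
    then obtain x where "x \<in> K" "dist x z \<le> r" by (auto simp: K2_def)
    then show "\<exists>x y. z = x + y \<and> x \<in> K \<and> y \<in> cball 0 r"
      by (intro exI[of _ x] exI[of _ "z - x"]) (simp add: dist_norm norm_minus_commute)
  next
    fix x y :: "real^'n" assume "x \<in> K" "y \<in> cball 0 r"
    then show "x + y \<in> K2" unfolding K2_def by (intro UN_I[of x]) (simp_all add: dist_norm)
  qed
  then have K2: "compact K2" using compact_sums[OF K compact_cball[of 0 r]] by simp
  have K2O: "K2 \<subseteq> \<Omega>" using r(2) by (simp add: K2_def)
  have KK2: "K \<subseteq> K2" using r(1) by (force simp: K2_def)
  obtain R where R: "\<And>x. x \<in> K2 \<Longrightarrow> norm x \<le> R"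
    using compact_imp_bounded[OF K2] unfolding bounded_iff by blast
  obtain Qb where Qb: "AE x in lebesgue_on \<Omega>. norm (b x) \<le> Qb" using b unfolding Linfty_on_def by blast
  have "\<exists>q. \<forall>x\<in>K. \<bar>a x $ i $ j\<bar> \<le> q" for i j
  proof -
    have "bounded ((\<lambda>x. a x $ i $ j) ` K)"
      by (intro compact_imp_bounded compact_continuous_image K continuous_on_subset[OF ac KO])
    then show ?thesis by (auto simp: bounded_iff)
  qed
  then obtain qa where qa: "\<And>i j x. x \<in> K \<Longrightarrow> \<bar>a x $ i $ j\<bar> \<le> qa i j" by metis
  define Q where "Q = \<bar>Qb\<bar> + (\<Sum>i\<in>UNIV. \<Sum>j\<in>UNIV. \<bar>qa i j\<bar>)"
  have Q0: "Q \<ge> 0" unfolding Q_def by (intro add_nonneg_nonneg sum_nonneg) auto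
  have Qa: "\<bar>a x $ i $ j\<bar> \<le> Q" if "x \<in> K" for x i j
  proof -
    have "\<bar>a x $ i $ j\<bar> \<le> \<bar>qa i j\<bar>" using qa[OF that, of i j] by simp
    also have "\<dots> \<le> (\<Sum>j\<in>UNIV. \<bar>qa i j\<bar>)" by (rule member_le_sum) auto
    also have "\<dots> \<le> (\<Sum>i\<in>UNIV. \<Sum>j\<in>UNIV. \<bar>qa i j\<bar>)" by (rule member_le_sum) (auto intro: sum_nonneg)
    finally show ?thesis by (simp add: Q_def)
  qed
  have Qb': "norm y \<le> Qb \<Longrightarrow> norm y \<le> Q" for y :: "real^'n"
    unfolding Q_def by (rule add_increasing2[OF sum_nonneg]) (auto intro: sum_nonneg)

  define U where "U = (\<lambda>y. indicator K2 y * \<phi> y)"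
  have Ui: "integrable lebesgue U" unfolding U_def by (intro Lq_loc_integrable[OF Lq(1) O(1) K2 K2O]) simp
  (* One family for all weak derivatives that have to be approximated: \<open>(None, j)\<close> stands for
     \<open>\<partial>\<^sub>j \<phi>\<close> and \<open>(Some i, j)\<close> for \<open>\<partial>\<^sub>i \<partial>\<^sub>j \<phi>\<close>. *)
  define Y where "Y = (\<lambda>t::'n option \<times> 'n. \<lambda>y. indicator K2 y *
     (case fst t of None \<Rightarrow> D y $ snd t | Some i \<Rightarrow> D2 y $ i $ snd t))"
  have Yq: "Lq_loc q \<Omega> (\<lambda>y. case fst t of None \<Rightarrow> D y $ snd t | Some i \<Rightarrow> D2 y $ i $ snd t)"
    if "q \<ge> 1" for q t
    by (cases "fst t") (simp_all add: Lq[OF that])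
  have Yi: "integrable lebesgue (Y t)" for t
    unfolding Y_def by (intro Lq_loc_integrable[OF Yq O(1) K2 K2O]) simp
  have Yp: "integrable lebesgue (\<lambda>y. \<bar>Y t y\<bar> ^ ?n)" for t
    unfolding Y_def using n1 by (intro Lq_loc_integrable_power[OF Yq n1 O(1) K2 K2O]) simp
  have Y0: "norm y > R \<Longrightarrow> Y t y = 0" for t y using R[of y] by (auto simp: Y_def indicator_def)
  have \<phi>K2: "continuous_on K2 \<phi>" using K2O closure_subset[of \<Omega>] by (intro continuous_on_subset[OF \<phi>c]) auto

  define C1 where "C1 = fact ?n * (4 / c0) ^ ?n"
  have C1: "C1 \<ge> 0" using c0 by (simp add: C1_def)
  (* A lower bound on K for functions within m/8 of \<open>\<phi>\<close>, since \<open>\<phi> \<ge> m/2\<close> there. *)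
  define m' where "m' = 3 * m / 8"
  have m': "m' > 0" using m by (simp add: m'_def)
  define T where "T = (UNIV :: ('n option \<times> 'n) set)"
  have T: "finite T" "T \<noteq> {}" by (auto simp: T_def)
  define C2 where "C2 = C1 * ((Q / m') ^ ?n * real (card T) ^ ?n / \<kappa> ^ ?n)"
  have C2: "C2 \<ge> 0" using C1 Q0 m' k by (simp add: C2_def)
  define \<alpha> where "\<alpha> = 2 * max lam 0"
  have \<alpha>: "\<alpha> \<ge> 0" by (simp add: \<alpha>_def)
  define B where "B = (\<lambda>x. C1 * ((\<alpha> ^ ?n / \<kappa> ^ ?n + (C0 * M) ^ ?n) * indicator \<Omega> x + indicator \<Omega> x * norm (b x) ^ ?n))"
  have ind: "integrable lebesgue (indicator \<Omega> :: real^'n \<Rightarrow> real)"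
    using Os fmeasurableD2[of \<Omega> lebesgue] by (intro integrable_real_indicator) (auto simp: less_top)
  have Bi: "integrable lebesgue B"
    unfolding B_def by (intro integrable_mult_right Bochner_Integration.integrable_add ind Linfty_power_integrable[OF b O(1,2)])
  have B0: "0 \<le> B x" for x
    unfolding B_def using C1 \<alpha> k C0 M by (intro mult_nonneg_nonneg add_nonneg_nonneg) auto
  have "(LINT x|lebesgue_on \<Omega>. norm (b x) ^ ?n) = (LINT x|lebesgue. indicator \<Omega> x * norm (b x) ^ ?n)"
    using Os by (subst integral_restrict_space) auto
  then have Bint: "(LINT x|lebesgue. B x) = C1 * ((\<alpha> ^ ?n / \<kappa> ^ ?n + (C0 * M) ^ ?n) * measure lebesgue \<Omega> + (LINT x|lebesgue_on \<Omega>. norm (b x) ^ ?n))"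
    unfolding B_def using ind Linfty_power_integrable[OF b O(1,2), of ?n] Os
    by (simp add: Bochner_Integration.integral_add)

  have main: "integral (cball 0 M) (\<lambda>p::real^'n. 1 / (\<kappa> ^ ?n + norm p ^ ?n)) \<le> (LINT x|lebesgue. B x) + C2 * (real (card T) * \<delta>)"
    if \<delta>: "\<delta> > 0" for \<delta>
  proof -
    have "eventually (\<lambda>s. \<forall>t\<in>T. (\<integral>\<^sup>+x. ennreal (\<bar>conv (Y t) (mollifier s) x - Y t x\<bar> ^ ?n) \<partial>lebesgue) \<le> ennreal \<delta>) at_top"
      by (intro eventually_ball_finite T ballI mollifier_Lp_convergence[OF Yi Y0 Yp n1 \<delta>])
    moreover have "eventually (\<lambda>s. \<forall>x\<in>K. \<bar>conv U (mollifier s) x - U x\<bar> \<le> m / 8) at_top"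
    proof (rule conv_mollifier_close_uniform[OF Ui K2 _ _ r(1)])
      show "continuous_on K2 U"
        using \<phi>K2 by (rule continuous_on_eq) (auto simp: U_def)
      show "y \<in> K2" if "x \<in> K" "norm (x - y) \<le> r" for x y
        using that by (auto simp: K2_def dist_norm)
    qed (use m in simp)
    moreover have "eventually (\<lambda>s::real. s \<ge> real ?n / r \<and> s > 0) at_top"
      by (intro eventually_conj eventually_ge_at_top eventually_gt_at_top)
    ultimately have "eventually (\<lambda>s. (\<forall>t\<in>T. (\<integral>\<^sup>+x. ennreal (\<bar>conv (Y t) (mollifier s) x - Y t x\<bar> ^ ?n) \<partial>lebesgue) \<le> ennreal \<delta>)
       \<and> (\<forall>x\<in>K. \<bar>conv U (mollifier s) x - U x\<bar> \<le> m / 8) \<and> s \<ge> real ?n / r \<and> s > 0) at_top"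
      by eventually_elim auto
    then obtain s where s1: "\<And>t. t \<in> T \<Longrightarrow> (\<integral>\<^sup>+x. ennreal (\<bar>conv (Y t) (mollifier s) x - Y t x\<bar> ^ ?n) \<partial>lebesgue) \<le> ennreal \<delta>"
      and s2: "\<And>x. x \<in> K \<Longrightarrow> \<bar>conv U (mollifier s) x - U x\<bar> \<le> m / 8" and s3: "s \<ge> real ?n / r" "s > 0"
      using eventually_happens'[OF trivial_limit_at_top_linorder] by blast
    have "real ?n / s \<le> r" using s3 r(1) by (simp add: field_simps)
    then have sub: "cball x (real ?n / s) \<subseteq> K2" if "x \<in> K" for x
      using that by (force simp: K2_def)
    define v where "v = conv U (mollifier s)"
    obtain g h where vd: "\<And>x. (v has_derivative (\<lambda>z. g x \<bullet> z)) (at x)"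
      and gd: "\<And>x. (g has_derivative (\<lambda>z. h x *v z)) (at x)" and hc: "continuous_on UNIV h"
      and hsym: "\<And>x i j. h x $ i $ j = h x $ j $ i"
      and g: "\<And>x j. x \<in> K \<Longrightarrow> g x $ j = conv (Y (None, j)) (mollifier s) x"
      and h: "\<And>x i j. x \<in> K \<Longrightarrow> h x $ i $ j = conv (Y (Some i, j)) (mollifier s) x"
    proof -
      obtain g h where gh: "\<And>x. (conv (\<lambda>y. indicator K2 y * \<phi> y) (mollifier s) has_derivative (\<lambda>z. g x \<bullet> z)) (at x)"
        "\<And>x. (g has_derivative (\<lambda>z. h x *v z)) (at x)" "continuous_on UNIV h" "\<And>x i j. h x $ i $ j = h x $ j $ i"
        "\<And>x j. cball x (real ?n / s) \<subseteq> K2 \<Longrightarrow> g x $ j = conv (\<lambda>y. indicator K2 y * D y $ j) (mollifier s) x"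
        "\<And>x i j. cball x (real ?n / s) \<subseteq> K2 \<Longrightarrow> h x $ i $ j = conv (\<lambda>y. indicator K2 y * D2 y $ i $ j) (mollifier s) x"
        using mollified_derivatives[OF Ui[unfolded U_def] s3(2) O(1) K2O w1] by blast
      show thesis
      proof (rule that)
        show "(v has_derivative (\<lambda>z. g x \<bullet> z)) (at x)" for x
          unfolding v_def U_def by (rule gh(1))
        show "g x $ j = conv (Y (None, j)) (mollifier s) x"
          "h x $ i $ j = conv (Y (Some i, j)) (mollifier s) x" if "x \<in> K" for x i j
          using gh(5)[OF sub[OF that], of j] gh(6)[OF sub[OF that], of i j] by (simp_all add: Y_def)
      qed (fact gh)+
    qed
    have vK: "v x \<ge> m'" "\<phi> x \<le> 2 * v x" "v x \<le> \<phi> x + m / 8" if "x \<in> K" for x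
    proof -
      have "U x = \<phi> x" using that KK2 by (auto simp: U_def)
      moreover have "\<phi> x \<ge> m / 2" using that by (simp add: K_def)
      ultimately have "\<bar>v x - \<phi> x\<bar> \<le> m / 8" "\<phi> x \<ge> m / 2"
        using s2[OF that] by (simp_all add: v_def)
      then show "v x \<ge> m'" "\<phi> x \<le> 2 * v x" "v x \<le> \<phi> x + m / 8"
        using m unfolding m'_def by linarith+
    qed
    have x0K: "x0 \<in> K" using x0c m_le m by (simp add: K_def)
    have contact: "x \<in> W" if "x \<in> K" "v x0 * exp (- (M * d)) \<le> v x" for x
    proof -
      have "U x0 = \<phi> x0" using x0K KK2 by (auto simp: U_def)
      then have "\<bar>v x0 - \<phi> x0\<bar> \<le> m / 8" using s2[OF x0K] by (simp add: v_def)
      then have "v x0 \<ge> \<phi> x0 - m / 8" by linarith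
      then have "(\<phi> x0 - m / 8) * exp (- (M * d)) \<le> v x0 * exp (- (M * d))" by (intro mult_right_mono) auto
      moreover have "(\<phi> x0 - m / 8) * exp (- (M * d)) = m - m / 8 * exp (- (M * d))"
        by (simp add: m_def algebra_simps)
      moreover have "m / 8 * exp (- (M * d)) \<le> m / 8 * 1"
        using m \<open>exp (- (M * d)) \<le> 1\<close> by (intro mult_left_mono) auto
      ultimately have "\<phi> x > m / 2" using that(2) vK(3)[OF that(1)] m by linarith
      then show ?thesis using that(1) KO by (auto simp: W_def)
    qed
    let ?tr = "\<lambda>x. \<Sum>k\<in>UNIV. - h x $ k $ k / v x + g x $ k * g x $ k / (v x)\<^sup>2"
    let ?F = "\<lambda>x. fact ?n * ?tr x ^ ?n * (1 / (\<kappa> ^ ?n + norm (- (1 / v x) *\<^sub>R g x) ^ ?n))"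
    obtain S where S: "compact S" "S \<subseteq> W" "\<And>x. x \<in> S \<Longrightarrow> norm (- (1 / v x) *\<^sub>R g x) \<le> M"
      "\<And>x. x \<in> S \<Longrightarrow> psd (\<lambda>i j. - h x $ i $ j / v x + g x $ i * g x $ j / (v x)\<^sup>2)"
      "continuous_on S ?F"
      "integral (cball 0 M) (\<lambda>p::real^'n. 1 / (\<kappa> ^ ?n + norm p ^ ?n)) \<le> integral S ?F"
    proof (rule log_abp[OF K Wo WK vd gd hc hsym _ x0K _ _ contact k])
      show "0 < v x" if "x \<in> K" for x using vK(1)[OF that] m' by simp
      show "norm (x - x0) \<le> d" if "x \<in> K" for x using that d by (simp add: K_def)
    qed (use M in auto)
    have SK: "x \<in> K" "x \<in> \<Omega>" if "x \<in> S" for x using that S(2) WK KO by auto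
    have tr0: "0 \<le> ?tr x" if "x \<in> S" for x
      by (intro sum_nonneg) (use psd_diag_nonneg[OF S(4)[OF that]] in simp)
    have "integral S ?F \<le> (LINT x|lebesgue. B x) + C2 * (real (card T) * \<delta>)"
    proof (rule integral_le_of_AE_bound[OF S(1,5) _ Bi B0 T(1), where E = "\<lambda>t x. \<bar>conv (Y t) (mollifier s) x - Y t x\<bar> ^ ?n"])
      show "0 \<le> ?F x" if "x \<in> S" for x
        using tr0[OF that] k by (intro mult_nonneg_nonneg divide_nonneg_nonneg add_nonneg_nonneg) auto
      show "(\<lambda>x. \<bar>conv (Y t) (mollifier s) x - Y t x\<bar> ^ ?n) \<in> borel_measurable lebesgue" for t
      proof -
        have [measurable]: "Y t \<in> borel_measurable lebesgue" using Yi by auto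
        have [measurable]: "conv (Y t) (mollifier s) \<in> borel_measurable lebesgue"
          using borel_measurable_continuous_onI[OF conv_mollifier_continuous[OF Yi s3(2)]] by (simp add: measurable_completion)
        show ?thesis by measurable
      qed
      have "AE x in lebesgue. x \<in> \<Omega> \<longrightarrow> L0 a b D D2 x = - lam * \<phi> x"
        using pde Os by (subst (asm) AE_restrict_space_iff) auto
      moreover have "AE x in lebesgue. x \<in> \<Omega> \<longrightarrow> norm (b x) \<le> Qb"
        using Qb Os by (subst (asm) AE_restrict_space_iff) auto
      ultimately show "AE x in lebesgue. x \<in> S \<longrightarrow> ?F x \<le> B x + C2 * (\<Sum>t\<in>T. \<bar>conv (Y t) (mollifier s) x - Y t x\<bar> ^ ?n)"
      proof eventually_elim
        case (elim x)
        show ?case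
        proof
          assume x: "x \<in> S"
          note xK = SK(1)[OF x] and xO = SK(2)[OF x]
          let ?\<epsilon> = "\<Sum>t\<in>T. \<bar>conv (Y t) (mollifier s) x - Y t x\<bar>"
          let ?p = "norm (- (1 / v x) *\<^sub>R g x)"
          have eps0: "?\<epsilon> \<ge> 0" by (intro sum_nonneg) auto
          have xK2: "x \<in> K2" using xK KK2 by blast
          have "c0 * ?tr x \<le> 2 * max lam 0 + norm (b x) * ?p + C0 * ?p\<^sup>2 + Q / m' * ?\<epsilon>"
          proof (rule log_hessian_trace_estimate[OF c0 vK(1)[OF xK] m' \<phi>pos[OF xO] vK(2)[OF xK] _ _ _ Qb' Qa[OF xK] S(4)[OF x]])
            show "(\<Sum>i\<in>UNIV. \<Sum>j\<in>UNIV. a x $ i $ j * D2 x $ i $ j) + (\<Sum>i\<in>UNIV. b x $ i * D x $ i) = - lam * \<phi> x"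
              using elim(1) xO by (simp add: L0_def)
            show "c0 * (norm \<xi>)\<^sup>2 \<le> (\<Sum>i\<in>UNIV. \<Sum>j\<in>UNIV. a x $ i $ j * \<xi> $ i * \<xi> $ j)"
              "(\<Sum>i\<in>UNIV. \<Sum>j\<in>UNIV. a x $ i $ j * \<xi> $ i * \<xi> $ j) \<le> C0 * (norm \<xi>)\<^sup>2" for \<xi>
              using ell xO unfolding elliptic_on_def by blast+
            show "norm (b x) \<le> Qb" using elim(2) xO by blast
            show "(\<Sum>i\<in>UNIV. \<bar>g x $ i - D x $ i\<bar>) + (\<Sum>i\<in>UNIV. \<Sum>j\<in>UNIV. \<bar>h x $ i $ j - D2 x $ i $ j\<bar>) \<le> ?\<epsilon>"
              unfolding T_def sum_option_prod using xK2 by (simp add: g[OF xK] h[OF xK]) (simp add: Y_def)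
          qed
          then have "?tr x ^ ?n * (1 / (\<kappa> ^ ?n + ?p ^ ?n)) \<le>
             (4 / c0) ^ ?n * (\<alpha> ^ ?n / \<kappa> ^ ?n + norm (b x) ^ ?n + (C0 * M) ^ ?n + (Q / m' * ?\<epsilon>) ^ ?n / \<kappa> ^ ?n)"
            using tr0[OF x] \<alpha> C0 Q0 m' eps0
            by (intro weighted_power_estimate[OF c0 k _ S(3)[OF x]]) (auto simp: \<alpha>_def)
          then have "fact ?n * (?tr x ^ ?n * (1 / (\<kappa> ^ ?n + ?p ^ ?n))) \<le>
             fact ?n * ((4 / c0) ^ ?n * (\<alpha> ^ ?n / \<kappa> ^ ?n + norm (b x) ^ ?n + (C0 * M) ^ ?n + (Q / m' * ?\<epsilon>) ^ ?n / \<kappa> ^ ?n))"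
            by (intro mult_left_mono) auto
          then have "?F x \<le> C1 * (\<alpha> ^ ?n / \<kappa> ^ ?n + norm (b x) ^ ?n + (C0 * M) ^ ?n + (Q / m' * ?\<epsilon>) ^ ?n / \<kappa> ^ ?n)"
            by (simp only: C1_def mult.assoc)
          also have "\<dots> = B x + C1 * ((Q / m') ^ ?n * ?\<epsilon> ^ ?n / \<kappa> ^ ?n)"
            unfolding power_mult_distrib[of "Q / m'"] using xO by (simp add: B_def distrib_left)
          also have "C1 * ((Q / m') ^ ?n * ?\<epsilon> ^ ?n / \<kappa> ^ ?n) \<le>
              C1 * ((Q / m') ^ ?n * (real (card T) ^ ?n * (\<Sum>t\<in>T. \<bar>conv (Y t) (mollifier s) x - Y t x\<bar> ^ ?n)) / \<kappa> ^ ?n)"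
            using C1 Q0 m' k by (intro mult_left_mono divide_right_mono power_sum_le T) auto
          also have "\<dots> = C2 * (\<Sum>t\<in>T. \<bar>conv (Y t) (mollifier s) x - Y t x\<bar> ^ ?n)"
            by (simp add: C2_def)
          finally show "?F x \<le> B x + C2 * (\<Sum>t\<in>T. \<bar>conv (Y t) (mollifier s) x - Y t x\<bar> ^ ?n)" by simp
        qed
      qed
    qed (use s1 \<delta> C2 in auto)
    then show ?thesis using S(6) by simp
  qed
  have "integral (cball 0 M) (\<lambda>p::real^'n. 1 / (\<kappa> ^ ?n + norm p ^ ?n)) \<le> (LINT x|lebesgue. B x)"
  proof (rule field_le_epsilon)
    fix e :: real assume e: "e > 0"
    let ?c = "C2 * real (card T)"
    have c: "?c \<ge> 0" using C2 by simp
    have "?c * (e / (?c + 1)) \<le> (?c + 1) * (e / (?c + 1))" using c e by (intro mult_right_mono) auto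
    also have "\<dots> = e" using c by simp
    finally show "integral (cball 0 M) (\<lambda>p::real^'n. 1 / (\<kappa> ^ ?n + norm p ^ ?n)) \<le> (LINT x|lebesgue. B x) + e"
      using main[of "e / (?c + 1)"] e c by (simp add: mult.assoc)
  qed
  then show ?thesis unfolding Bint C1_def \<alpha>_def .
qed

theorem theorem2p1:
  fixes c0 C0 :: real
  assumes "0 < c0" and "c0 \<le> C0"
  shows "\<exists>\<mu>::real \<Rightarrow> real. (\<forall>t\<ge>0. \<mu> t > 0) \<and>
    (\<forall>(\<Omega>::(real^'n::finite) set) (a::real^'n \<Rightarrow> real^'n^'n) (b::real^'n \<Rightarrow> real^'n) (lam::real).
       bounded_smooth_domain \<Omega> \<and>
       (\<forall>i j. smooth_upto_closure \<Omega> (\<lambda>x. a x $ i $ j)) \<and>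
       elliptic_on c0 C0 \<Omega> a \<and>
       Linfty_on \<Omega> b \<and>
       is_principal_eigenvalue a b \<Omega> lam
       \<longrightarrow> lam \<ge> \<mu> (Ln_norm \<Omega> b) * measure lebesgue \<Omega> powr (- 2 / real CARD('n)))"
proof -
  let ?n = "CARD('n)"
  have n1: "?n \<ge> 1" by (simp add: Suc_leI)
  define \<omega> where "\<omega> = measure lborel (cball (0::real^'n) 1)"
  have \<omega>: "\<omega> > 0" by (simp add: \<omega>_def)
  define C1 where "C1 = fact ?n * (4 / c0) ^ ?n"
  have C1: "C1 > 0" using assms by (simp add: C1_def)
  (* The number of shells is chosen such that the shells outweigh the term with b, the term with C0
     and a further C1, which is left over for the term with the eigenvalue. *)
  define N where "N = (\<lambda>t. nat \<lceil>4 * C1 * (1 + C0 ^ ?n + t ^ ?n) / \<omega>\<rceil>)"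
  (* The factor 1/2 undoes the 2 in front of the eigenvalue, which comes from \<open>\<phi> \<le> 2 v\<close>. *)
  define \<mu> where "\<mu> = (\<lambda>t. 1 / 2 / 2 ^ N t :: real)"
  have N: "C1 * (1 + C0 ^ ?n + t ^ ?n) \<le> real (N t) * \<omega> / 4" for t
  proof -
    have "4 * C1 * (1 + C0 ^ ?n + t ^ ?n) / \<omega> \<le> real (N t)" unfolding N_def by (rule real_nat_ceiling_ge)
    then show ?thesis using \<omega> by (simp add: field_simps)
  qed
  show ?thesis
  proof (intro exI[of _ \<mu>] conjI allI impI)
    show "\<mu> t > 0" for t by (simp add: \<mu>_def)
    fix \<Omega> :: "(real^'n) set" and a :: "real^'n \<Rightarrow> real^'n^'n" and b :: "real^'n \<Rightarrow> real^'n" and lam :: real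
    assume H: "bounded_smooth_domain \<Omega> \<and> (\<forall>i j. smooth_upto_closure \<Omega> (\<lambda>x. a x $ i $ j)) \<and>
       elliptic_on c0 C0 \<Omega> a \<and> Linfty_on \<Omega> b \<and> is_principal_eigenvalue a b \<Omega> lam"
    then have O: "open \<Omega>" "bounded \<Omega>" "\<Omega> \<noteq> {}" by (auto simp: bounded_smooth_domain_def)
    have ac: "continuous_on \<Omega> (\<lambda>x. a x $ i $ j)" for i j
    proof -
      have "iter_partial [] (\<lambda>x. a x $ i $ j) differentiable_on \<Omega>"
        using H unfolding smooth_upto_closure_def smooth_on_def by blast
      then show ?thesis by (simp add: differentiable_imp_continuous_on)
    qed
    define V where "V = measure lebesgue \<Omega>"
    have "V \<noteq> 0"
    proof
      assume "V = 0"
      then have "negligible \<Omega>"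
        using O(1,2) by (simp add: V_def bounded_set_imp_lmeasurable negligible_iff_measure)
      then show False using O(1,3) open_not_negligible by blast
    qed
    then have V: "V > 0" by (simp add: V_def zero_less_measure_iff)
    define t where "t = Ln_norm \<Omega> b"
    have "0 \<le> (LINT x|lebesgue_on \<Omega>. norm (b x) ^ ?n)" by (intro integral_nonneg_AE) auto
    then have tn: "t ^ ?n = (LINT x|lebesgue_on \<Omega>. norm (b x) ^ ?n)"
      unfolding t_def Ln_norm_def by (cases "(LINT x|lebesgue_on \<Omega>. norm (b x) ^ ?n) = 0")
        (auto simp: powr_realpow[symmetric] powr_powr power_0_left)
    (* With this radius the term \<open>(C0 M)\<^sup>n |\<Omega>|\<close> does not depend on \<open>\<Omega>\<close>. *)
    define M where "M = V powr (- 1 / real ?n)"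
    have M: "M > 0" using V by (simp add: M_def)
    have Mn: "M ^ ?n * V = 1"
    proof -
      have "M ^ ?n = M powr real ?n" using M by (simp add: powr_realpow)
      also have "\<dots> = V powr (- 1 / real ?n * real ?n)" unfolding M_def by (rule powr_powr)
      also have "- 1 / real ?n * real ?n = - 1" by simp
      also have "V powr - 1 = 1 / V" using V by (simp add: powr_minus_divide)
      finally show ?thesis using V by simp
    qed
    define \<kappa> where "\<kappa> = M / 2 ^ N t"
    have k: "\<kappa> > 0" using M by (simp add: \<kappa>_def)
    let ?l = "2 * max lam 0"
    have "real (N t) * \<omega> / 4 \<le> integral (cball 0 M) (\<lambda>p::real^'n. 1 / (\<kappa> ^ ?n + norm p ^ ?n))"
      unfolding \<omega>_def \<kappa>_def by (rule weight_integral_ge[OF M])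
    also have "\<dots> \<le> C1 * ((?l ^ ?n / \<kappa> ^ ?n + (C0 * M) ^ ?n) * V + t ^ ?n)"
      unfolding C1_def V_def tn using H assms M k O ac
      by (intro eigenvalue_gradient_estimate[where a = a]) auto
    finally have "real (N t) * \<omega> / 4 \<le> C1 * ((?l ^ ?n / \<kappa> ^ ?n + (C0 * M) ^ ?n) * V + t ^ ?n)" .
    then have "C1 * (1 + C0 ^ ?n + t ^ ?n) \<le> C1 * ((?l ^ ?n / \<kappa> ^ ?n + (C0 * M) ^ ?n) * V + t ^ ?n)"
      by (rule order_trans[OF N])
    then have "1 + C0 ^ ?n + t ^ ?n \<le> (?l ^ ?n / \<kappa> ^ ?n + (C0 * M) ^ ?n) * V + t ^ ?n"
      using C1 by simp
    moreover have "(C0 * M) ^ ?n * V = C0 ^ ?n" using Mn by (simp add: power_mult_distrib mult.assoc)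
    ultimately have "1 \<le> ?l ^ ?n / \<kappa> ^ ?n * V" by (simp add: distrib_right)
    also have "\<dots> = (?l / (\<kappa> * M)) ^ ?n"
      using Mn M k V by (simp add: power_mult_distrib power_divide field_simps)
    finally have "1 \<le> (?l / (\<kappa> * M)) ^ ?n" .
    moreover have "0 \<le> ?l / (\<kappa> * M)" using M k by (intro divide_nonneg_pos) auto
    ultimately have "1 \<le> ?l / (\<kappa> * M)"
      using power_less_one_iff[of "?l / (\<kappa> * M)" ?n] by (meson n1 less_le_trans not_less zero_less_one)
    then have "\<kappa> * M / 2 \<le> max lam 0" using M k by (simp add: field_simps)
    moreover have "\<kappa> * M / 2 > 0" using M k by simp
    ultimately have "\<kappa> * M / 2 \<le> lam" by (auto simp: max_def split: if_splits)
    moreover have "M * M = V powr (- 2 / real ?n)"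
      by (simp add: M_def powr_add[symmetric])
    then have "\<kappa> * M / 2 = \<mu> t * V powr (- 2 / real ?n)"
      by (simp add: \<kappa>_def \<mu>_def)
    ultimately show "\<mu> (Ln_norm \<Omega> b) * measure lebesgue \<Omega> powr (- 2 / real ?n) \<le> lam"
      by (simp add: t_def V_def)
  qed
qed

end
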